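(* Let $d\ge2$ and $T>0$. Let $\{\theta_k\}_{k\in\mathbb{Z}^d_0}$ be real coefficients with $\theta_{-k}=\theta_k$ for all $k$, $\sum_k\theta_k^2<\infty$, and $\theta_{Ok}=\theta_k$ for all $k$ and all $O\in E_{\mathbb{Z}}(d)$, let $W$ be the associated divergence free noise and $c=\frac{d-1}{d}\sum_k\theta_k^2$. If $u$ and $v$ are two weak solutions on $[0,T]$ (on the same filtered probability space, with the same noise $W$) of $$\mathrm{d}u=c\,\Delta u\,\mathrm{d}t+\mathrm{d}W\cdot\nabla u$$ with the same initial data $u_0\in L^2$, then $$\mathbb{P}\big(u(t)=v(t)\big)=1\qquad\forall\,t\in[0,T].$$
   Context: Notation. $\mathbb{T}^d=\mathbb{R}^d/(2\pi\mathbb{Z}^d)$; $L^2=L^2(\mathbb{T}^d)$ is the space of real-valued square integrable functions with normalized inner product $\langle f,g\rangle=(2\pi)^{-d}\int_{\mathbb{T}^d}fg\,\mathrm{d}x$ and norm $|\cdot|_{L^2}$. $\langle\cdot,\cdot\rangle$ is extended bilinearly (no complex conjugation) to complex-valued functions. $e_k(x)=e^{ik\cdot x}$ for $k\in\mathbb{Z}^d$; $\mathbb{Z}^d_0=\mathbb{Z}^d\setminus\{0\}$. $E_{\mathbb{Z}}(d)$ is the group of linear isometries of $\mathbb{R}^d$ leaving $\mathbb{Z}^d$ invariant (generated by permutations of coordinates and sign changes of coordinates). $C([0,T];L^2_w)$ is the space of functions $[0,T]\to L^2$ continuous for the weak topology of $L^2$. Noise. Fix a filtered probability space $(\Omega,\mathcal{F},\mathcal{F}_t,\mathbb{P})$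 with normal (complete, right-continuous) filtration, carrying independent standard real $\mathcal{F}_t$-Brownian motions $\{B^{(j)}_k: k\in\mathbb{Z}^d_0, 1\le j\le d-1\}$. Fix $\Lambda\subset\mathbb{Z}^d_0$ such that $\Lambda,-\Lambda$ partition $\mathbb{Z}^d_0$. Set $W^{(j)}_k=B^{(j)}_k+iB^{(j)}_{-k}$ for $k\in\Lambda$ and $W^{(j)}_k=\overline{W^{(j)}_{-k}}$ for $k\in-\Lambda$, so that the (bilinear) quadratic covariation is $[W^{(j)}_k,W^{(m)}_l]_t=2t\,\delta_{j,m}\delta_{k,-l}$. For $k\in\Lambda$ let $\{a_k^{(1)},\dots,a_k^{(d-1)}\}$ be an orthonormal basis of $k^\perp\subset\mathbb{R}^d$, and $a_{-k}^{(j)}=a_k^{(j)}$. The divergence free noise associated with $\{\theta_k\}$ is $$W(t,x)=\sum_{k\in\mathbb{Z}^d_0}\theta_k\Big(\sum_{j=1}^{d-1}a_k^{(j)}W_k^{(j)}(t)\Big)e_k(x).$$ Weak solution. An $\mathcal{F}_t$-progressively measurable, $L^2$-valued process $u$ with paths in $C([0,T];L^2_w)$ and $\int_0^T\mathbb{E}[|u(t)|^2_{L^2}]\mathrm{d}t<\infty$ is a weak solution on $[0,T]$ of $\mathrm{d}u=c\Delta u\,\mathrm{d}t+\mathrm{d}W\cdot\nabla u$ with (deterministic) initial data $u_0\in L^2$ if $u(0)=u_0$ and for every $\varphi\in C^\infty(\mathbb{T}^d)$, $\mathbb{P}$-a.s., for all $t\in[0,T]$, $$\langle u(t),\varphi\rangle-\langle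 u_0,\varphi\rangle=c\int_0^t\langle u(s),\Delta\varphi\rangle\mathrm{d}s-\sum_{j,k}\theta_k\int_0^t\langle u(s),e_k\,a_k^{(j)}\cdot\nabla\varphi\rangle\mathrm{d}W^{(j)}_k(s),$$ with It\^o integrals, the series converging in $L^2(\Omega)$. *)

theory Defs
  imports "HOL-Probability.Probability"
begin

section \<open>Real-valued square integrable functions on the torus\<close>

text \<open>
  Functions on the torus are represented by functions on \<open>\<real>\<^sup>d\<close>, where \<open>d = CARD('n)\<close>.  The measure is
  Lebesgue measure on the fundamental cell \<open>[0, 2\<pi>]\<^sup>d\<close>, divided by \<open>(2\<pi>)\<^sup>d\<close>.
\<close>

definition torus :: "(real ^ 'n) measure" where
  "torus = uniform_measure lborel (cbox 0 (\<chi> i. 2 * pi))"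

definition square_integrable :: "'a measure \<Rightarrow> ('a \<Rightarrow> real) \<Rightarrow> bool" where
  "square_integrable M f \<longleftrightarrow> f \<in> borel_measurable M \<and> integrable M (\<lambda>x. (f x)\<^sup>2)"

definition torus_l2_rel :: "(real ^ 'n \<Rightarrow> real) \<Rightarrow> (real ^ 'n \<Rightarrow> real) \<Rightarrow> bool" where
  "torus_l2_rel f g \<longleftrightarrow>
     square_integrable torus f \<and> square_integrable torus g \<and> (AE x in torus. f x = g x)"

lemma square_integrable_mult:
  assumes "square_integrable M f" "square_integrable M g"
  shows "integrable M (\<lambda>x. f x * g x)"
proof (rule Bochner_Integration.integrable_bound)
  show "integrable M (\<lambda>x. (f x)\<^sup>2 + (g x)\<^sup>2)" "(\<lambda>x. f x * g x) \<in> borel_measurable M"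
    using assms by (auto simp: square_integrable_def)
  have "\<bar>f x * g x\<bar> \<le> (f x)\<^sup>2 + (g x)\<^sup>2" for x
  proof -
    have "0 \<le> (f x + g x)\<^sup>2" "0 \<le> (f x - g x)\<^sup>2" "0 \<le> (f x)\<^sup>2" "0 \<le> (g x)\<^sup>2" by simp_all
    then show ?thesis unfolding power2_sum power2_diff by linarith
  qed
  then show "AE x in M. norm (f x * g x) \<le> norm ((f x)\<^sup>2 + (g x)\<^sup>2)" by simp
qed

lemma square_integrable_add:
  assumes "square_integrable M f" "square_integrable M g"
  shows "square_integrable M (\<lambda>x. f x + g x)"
  using assms square_integrable_mult[OF assms]
  by (auto simp: square_integrable_def power2_sum mult.assoc)

lemma square_integrable_scale:
  "square_integrable M f \<Longrightarrow> square_integrable M (\<lambda>x. r * f x)"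
  by (auto simp: square_integrable_def power_mult_distrib)

lemma square_integrable_minus:
  "square_integrable M f \<Longrightarrow> square_integrable M (\<lambda>x. - f x)"
  by (auto simp: square_integrable_def)

lemma square_integrable_diff:
  assumes "square_integrable M f" "square_integrable M g"
  shows "square_integrable M (\<lambda>x. f x - g x)"
  using square_integrable_add[OF assms(1) square_integrable_minus[OF assms(2)]] by simp

lemma square_integrable_zero: "square_integrable M (\<lambda>x. 0)"
  by (simp add: square_integrable_def)

quotient_type 'n torus_l2 = "real ^ ('n::finite) \<Rightarrow> real" / partial: torus_l2_rel
proof (rule part_equivpI)
  show "\<exists>f :: real ^ 'n \<Rightarrow> real. torus_l2_rel f f"
    using square_integrable_zero by (auto simp: torus_l2_rel_def)
  show "symp (torus_l2_rel :: (real ^ 'n \<Rightarrow> real) \<Rightarrow> _)"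
    by (rule sympI) (auto simp: torus_l2_rel_def elim: AE_mp)
  show "transp (torus_l2_rel :: (real ^ 'n \<Rightarrow> real) \<Rightarrow> _)"
    by (rule transpI) (auto simp: torus_l2_rel_def)
qed

instantiation torus_l2 :: (finite) real_vector
begin

lift_definition zero_torus_l2 :: "'a torus_l2" is "\<lambda>_. 0"
  by (simp add: torus_l2_rel_def square_integrable_zero)

lift_definition plus_torus_l2 :: "'a torus_l2 \<Rightarrow> 'a torus_l2 \<Rightarrow> 'a torus_l2" is "\<lambda>f g x. f x + g x"
  by (auto simp: torus_l2_rel_def square_integrable_add)

lift_definition minus_torus_l2 :: "'a torus_l2 \<Rightarrow> 'a torus_l2 \<Rightarrow> 'a torus_l2" is "\<lambda>f g x. f x - g x"
  by (auto simp: torus_l2_rel_def square_integrable_diff)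

lift_definition uminus_torus_l2 :: "'a torus_l2 \<Rightarrow> 'a torus_l2" is "\<lambda>f x. - f x"
  by (auto simp: torus_l2_rel_def square_integrable_minus)

lift_definition scaleR_torus_l2 :: "real \<Rightarrow> 'a torus_l2 \<Rightarrow> 'a torus_l2" is "\<lambda>r f x. r * f x"
  by (auto simp: torus_l2_rel_def square_integrable_scale)

instance
proof
  fix f g h :: "'a torus_l2" and r s :: real
  show "f + g + h = f + (g + h)" "f + g = g + f" "0 + f = f" "- f + f = 0" "f - g = f + - g"
    by (transfer; auto simp: torus_l2_rel_def square_integrable_add square_integrable_diff
          square_integrable_minus square_integrable_zero algebra_simps)+
  show "r *\<^sub>R (f + g) = r *\<^sub>R f + r *\<^sub>R g" "(r + s) *\<^sub>R f = r *\<^sub>R f + s *\<^sub>R f"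
    "r *\<^sub>R s *\<^sub>R f = (r * s) *\<^sub>R f" "1 *\<^sub>R f = f"
    by (transfer; auto simp: torus_l2_rel_def square_integrable_add square_integrable_scale
          algebra_simps)+
qed

end

instantiation torus_l2 :: (finite) real_inner
begin

lift_definition inner_torus_l2 :: "'a torus_l2 \<Rightarrow> 'a torus_l2 \<Rightarrow> real" is
  "\<lambda>f g. \<integral>x. f x * g x \<partial>torus"
  by (rule integral_cong_AE) (auto simp: torus_l2_rel_def square_integrable_def)

definition norm_torus_l2 :: "'a torus_l2 \<Rightarrow> real" where
  "norm_torus_l2 f = sqrt (inner f f)"

definition sgn_torus_l2 :: "'a torus_l2 \<Rightarrow> 'a torus_l2" where
  "sgn_torus_l2 f = f /\<^sub>R norm f"

definition dist_torus_l2 :: "'a torus_l2 \<Rightarrow> 'a torus_l2 \<Rightarrow> real" where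
  "dist_torus_l2 f g = norm (f - g)"

definition uniformity_torus_l2 :: "('a torus_l2 \<times> 'a torus_l2) filter" where
  "uniformity_torus_l2 = (INF e\<in>{0<..}. principal {(x, y). dist x y < e})"

definition open_torus_l2 :: "'a torus_l2 set \<Rightarrow> bool" where
  "open_torus_l2 U \<longleftrightarrow> (\<forall>x\<in>U. \<forall>\<^sub>F (x', y) in uniformity. x' = x \<longrightarrow> y \<in> U)"

instance
proof
  fix f g h :: "'a torus_l2" and r :: real and U :: "'a torus_l2 set"
  show "dist f g = norm (f - g)" by (fact dist_torus_l2_def)
  show "sgn f = f /\<^sub>R norm f" by (fact sgn_torus_l2_def)
  show "uniformity = (INF e\<in>{0<..}. principal {(x :: 'a torus_l2, y). dist x y < e})"
    by (fact uniformity_torus_l2_def)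
  show "open U \<longleftrightarrow> (\<forall>x\<in>U. \<forall>\<^sub>F (x', y) in uniformity. x' = x \<longrightarrow> y \<in> U)"
    by (fact open_torus_l2_def)
  show "norm f = sqrt (inner f f)" by (fact norm_torus_l2_def)
  show "inner f g = inner g f" by transfer (simp add: mult.commute)
  show "inner (f + g) h = inner f h + inner g h"
    by transfer (auto simp: torus_l2_rel_def square_integrable_mult distrib_right)
  show "inner (r *\<^sub>R f) g = r * inner f g"
    by transfer (simp add: mult.assoc)
  show "0 \<le> inner f f" by transfer simp
  show "inner f f = 0 \<longleftrightarrow> f = 0"
    by transfer
      (auto simp: torus_l2_rel_def square_integrable_zero integral_nonneg_eq_0_iff_AE
          square_integrable_mult)
qed

end

text \<open>
  The bilinear pairing \<open>\<langle>f, \<phi>\<rangle>\<close> of a real-valued \<open>f \<in> L\<^sup>2\<close> with a real- or complex-valued function.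
\<close>

definition pairing ::
  "('n::finite) torus_l2 \<Rightarrow> (real ^ 'n \<Rightarrow> 'b::{banach, second_countable_topology}) \<Rightarrow> 'b" where
  "pairing f \<phi> = (\<integral>x. rep_torus_l2 f x *\<^sub>R \<phi> x \<partial>torus)"

lemma pairing_abs:
  fixes f :: "real ^ 'n \<Rightarrow> real"
    and \<phi> :: "real ^ 'n \<Rightarrow> 'b::{banach, second_countable_topology}"
  assumes f: "square_integrable torus f" and \<phi>: "\<phi> \<in> borel_measurable borel"
  shows "pairing (abs_torus_l2 f) \<phi> = (\<integral>x. f x *\<^sub>R \<phi> x \<partial>torus)"
proof -
  have "torus_l2_rel (rep_torus_l2 (abs_torus_l2 f)) f"
    using f by (intro rep_abs_rsp_left[OF Quotient3_torus_l2]) (simp add: torus_l2_rel_def)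
  then have r: "square_integrable torus (rep_torus_l2 (abs_torus_l2 f))"
      "AE x in torus. rep_torus_l2 (abs_torus_l2 f) x = f x"
    by (auto simp: torus_l2_rel_def)
  have [measurable]: "\<phi> \<in> borel_measurable torus"
    using \<phi> by (simp add: torus_def cong: measurable_cong_sets)
  have [measurable]: "f \<in> borel_measurable torus"
      "rep_torus_l2 (abs_torus_l2 f) \<in> borel_measurable torus"
    using f r by (auto simp: square_integrable_def)
  show ?thesis
    unfolding pairing_def using r(2) by (intro integral_cong_AE) auto
qed

section \<open>Smooth functions on the torus\<close>

definition partial_deriv :: "'n \<Rightarrow> (real ^ 'n \<Rightarrow> real) \<Rightarrow> real ^ 'n \<Rightarrow> real" where
  "partial_deriv i f x = frechet_derivative f (at x) (axis i 1)"

definition grad :: "(real ^ 'n \<Rightarrow> real) \<Rightarrow> real ^ 'n \<Rightarrow> real ^ 'n" where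
  "grad f x = (\<chi> i. partial_deriv i f x)"

definition laplacian :: "(real ^ 'n \<Rightarrow> real) \<Rightarrow> real ^ 'n \<Rightarrow> real" where
  "laplacian f x = (\<Sum>i\<in>UNIV. partial_deriv i (partial_deriv i f) x)"

primrec Ck :: "nat \<Rightarrow> (real ^ 'n \<Rightarrow> real) \<Rightarrow> bool" where
  "Ck 0 f \<longleftrightarrow> continuous_on UNIV f"
| "Ck (Suc m) f \<longleftrightarrow> f differentiable_on UNIV \<and> (\<forall>i. Ck m (partial_deriv i f))"

definition int_lattice :: "(real ^ 'n) set" where
  "int_lattice = {k. \<forall>i. k $ i \<in> \<int>}"

definition int_lattice0 :: "(real ^ 'n) set" where
  "int_lattice0 = int_lattice - {0}"

definition torus_smooth :: "(real ^ 'n \<Rightarrow> real) \<Rightarrow> bool" where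
  "torus_smooth f \<longleftrightarrow>
     (\<forall>m. Ck m f) \<and> (\<forall>x. \<forall>k\<in>int_lattice. f (x + (2 * pi) *\<^sub>R k) = f x)"

definition fourier_mode :: "real ^ 'n \<Rightarrow> real ^ 'n \<Rightarrow> complex" where
  "fourier_mode k x = exp (\<i> * complex_of_real (k \<bullet> x))"

definition lattice_isometry :: "(real ^ 'n \<Rightarrow> real ^ 'n) \<Rightarrow> bool" where
  "lattice_isometry R \<longleftrightarrow> orthogonal_transformation R \<and> R ` int_lattice = int_lattice"

section \<open>Filtrations and Brownian motions\<close>

text \<open>Time is \<open>[0, \<infinity>)\<close>; the values of \<open>F\<close> at negative times are irrelevant.\<close>

definition normal_filtration :: "'w measure \<Rightarrow> (real \<Rightarrow> 'w measure) \<Rightarrow> bool" where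
  "normal_filtration M F \<longleftrightarrow>
     (\<forall>t\<ge>0. subalgebra M (F t)) \<and>
     (\<forall>s t. 0 \<le> s \<longrightarrow> s \<le> t \<longrightarrow> sets (F s) \<subseteq> sets (F t)) \<and>
     complete_measure M \<and> null_sets M \<subseteq> sets (F 0) \<and>
     (\<forall>t\<ge>0. sets (F t) = (\<Inter>s\<in>{t<..}. sets (F s)))"

definition progressively_measurable ::
  "(real \<Rightarrow> 'w measure) \<Rightarrow> real \<Rightarrow> (real \<Rightarrow> 'w \<Rightarrow> 'b::topological_space) \<Rightarrow> bool" where
  "progressively_measurable F T X \<longleftrightarrow>
     (\<forall>t\<in>{0..T}. (\<lambda>(s, \<omega>). X s \<omega>) \<in> borel_measurable (restrict_space borel {0..t} \<Otimes>\<^sub>M F t))"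

definition brownian_motion ::
  "'w measure \<Rightarrow> (real \<Rightarrow> 'w measure) \<Rightarrow> (real \<Rightarrow> 'w \<Rightarrow> real) \<Rightarrow> bool" where
  "brownian_motion M F B \<longleftrightarrow>
     (\<forall>t\<ge>0. B t \<in> borel_measurable (F t)) \<and>
     (AE \<omega> in M. B 0 \<omega> = 0) \<and>
     (AE \<omega> in M. continuous_on {0..} (\<lambda>t. B t \<omega>)) \<and>
     (\<forall>s t. 0 \<le> s \<longrightarrow> s < t \<longrightarrow>
        distributed M lborel (\<lambda>\<omega>. B t \<omega> - B s \<omega>) (normal_density 0 (sqrt (t - s))) \<and>
        prob_space.indep_set M (sets (F s))
          {(\<lambda>\<omega>. B t \<omega> - B s \<omega>) -` A \<inter> space M | A. A \<in> sets borel})"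

text \<open>Independence of a family of processes, i.e. of the random paths on \<open>[0, \<infinity>)\<close>.\<close>

definition independent_processes ::
  "'w measure \<Rightarrow> ('i \<Rightarrow> real \<Rightarrow> 'w \<Rightarrow> real) \<Rightarrow> 'i set \<Rightarrow> bool" where
  "independent_processes M X I \<longleftrightarrow>
     prob_space.indep_vars M (\<lambda>_. \<Pi>\<^sub>M t\<in>{0..}. borel) (\<lambda>i \<omega>. \<lambda>t\<in>{0..}. X i t \<omega>) I"

section \<open>The Ito integral\<close>

text \<open>
  An elementary integrand is \<open>\<Sum>i<n. \<xi>\<^sub>i 1_{(\<tau>\<^sub>i, \<tau>\<^sub>i\<^sub>+\<^sub>1]}\<close> with deterministic times \<open>\<tau>\<^sub>i\<close> and
  bounded \<open>F\<^sub>\<tau>\<^sub>i\<close>-measurable \<open>\<xi>\<^sub>i\<close>.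
\<close>

definition elementary_data ::
  "'w measure \<Rightarrow> (real \<Rightarrow> 'w measure) \<Rightarrow> real \<Rightarrow> nat \<Rightarrow> (nat \<Rightarrow> real) \<Rightarrow> (nat \<Rightarrow> 'w \<Rightarrow> complex)
     \<Rightarrow> bool" where
  "elementary_data M F T n \<tau> \<xi> \<longleftrightarrow>
     (\<forall>i\<le>n. \<tau> i \<in> {0..T}) \<and> (\<forall>i<n. \<tau> i \<le> \<tau> (Suc i)) \<and>
     (\<forall>i<n. \<xi> i \<in> borel_measurable (F (\<tau> i)) \<and> bounded (\<xi> i ` space M))"

definition elementary_integrand ::
  "nat \<Rightarrow> (nat \<Rightarrow> real) \<Rightarrow> (nat \<Rightarrow> 'w \<Rightarrow> complex) \<Rightarrow> real \<Rightarrow> 'w \<Rightarrow> complex" where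
  "elementary_integrand n \<tau> \<xi> s \<omega> = (\<Sum>i<n. indicator {\<tau> i<..\<tau> (Suc i)} s * \<xi> i \<omega>)"

definition elementary_integral ::
  "nat \<Rightarrow> (nat \<Rightarrow> real) \<Rightarrow> (nat \<Rightarrow> 'w \<Rightarrow> complex) \<Rightarrow> (real \<Rightarrow> 'w \<Rightarrow> complex)
     \<Rightarrow> real \<Rightarrow> 'w \<Rightarrow> complex" where
  "elementary_integral n \<tau> \<xi> W t \<omega> =
     (\<Sum>i<n. \<xi> i \<omega> * (W (min (\<tau> (Suc i)) t) \<omega> - W (min (\<tau> i) t) \<omega>))"

text \<open>
  \<open>has_ito_integral M F T W H I\<close>: the adapted continuous process \<open>I\<close> is (a version of)
  \<open>t \<mapsto> \<integral>\<^sub>0\<^sup>t H(s) dW(s)\<close> on \<open>[0, T]\<close>, obtained by \<open>L\<^sup>2\<close>-approximation of \<open>H\<close> by elementary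
  integrands.  It is used only for integrators \<open>W\<close> whose real and imaginary parts are
  independent Brownian motions; \<open>I\<close> is then unique up to indistinguishability.
\<close>

definition has_ito_integral ::
  "'w measure \<Rightarrow> (real \<Rightarrow> 'w measure) \<Rightarrow> real \<Rightarrow> (real \<Rightarrow> 'w \<Rightarrow> complex)
     \<Rightarrow> (real \<Rightarrow> 'w \<Rightarrow> complex) \<Rightarrow> (real \<Rightarrow> 'w \<Rightarrow> complex) \<Rightarrow> bool" where
  "has_ito_integral M F T W H I \<longleftrightarrow>
     progressively_measurable F T H \<and>
     (\<integral>\<^sup>+s\<in>{0..T}. (\<integral>\<^sup>+\<omega>. ennreal ((norm (H s \<omega>))\<^sup>2) \<partial>M) \<partial>lborel) < \<infinity> \<and>
     (\<forall>t\<in>{0..T}. I t \<in> borel_measurable (F t)) \<and>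
     (AE \<omega> in M. continuous_on {0..T} (\<lambda>t. I t \<omega>)) \<and>
     (\<exists>n \<tau> \<xi>.
        (\<forall>m. elementary_data M F T (n m) (\<tau> m) (\<xi> m)) \<and>
        (\<lambda>m. \<integral>\<^sup>+s\<in>{0..T}. (\<integral>\<^sup>+\<omega>. ennreal ((norm (H s \<omega> -
            elementary_integrand (n m) (\<tau> m) (\<xi> m) s \<omega>))\<^sup>2) \<partial>M) \<partial>lborel) \<longlonglongrightarrow> 0 \<and>
        (\<forall>t\<in>{0..T}. (\<lambda>m. \<integral>\<^sup>+\<omega>. ennreal ((norm (I t \<omega> -
            elementary_integral (n m) (\<tau> m) (\<xi> m) W t \<omega>))\<^sup>2) \<partial>M) \<longlonglongrightarrow> 0))"

section \<open>Divergence free noise and weak solutions\<close>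

text \<open>
  The complex Brownian motions \<open>W\<^sup>(\<^sup>j\<^sup>)\<^sub>k\<close> for \<open>k \<in> \<Lambda> \<union> -\<Lambda>\<close>, where \<open>B (j, k)\<close> is \<open>B\<^sup>(\<^sup>j\<^sup>)\<^sub>k\<close>.
\<close>

definition complex_noise ::
  "(real ^ 'n) set \<Rightarrow> (nat \<times> (real ^ 'n) \<Rightarrow> real \<Rightarrow> 'w \<Rightarrow> real)
     \<Rightarrow> nat \<Rightarrow> real ^ 'n \<Rightarrow> real \<Rightarrow> 'w \<Rightarrow> complex" where
  "complex_noise \<Lambda> B j k t \<omega> =
     (if k \<in> \<Lambda> then Complex (B (j, k) t \<omega>) (B (j, - k) t \<omega>)
      else cnj (Complex (B (j, - k) t \<omega>) (B (j, k) t \<omega>)))"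

definition noise_index :: "(nat \<times> (real ^ 'n)) set" where
  "noise_index = {1..CARD('n) - 1} \<times> int_lattice0"

text \<open>
  \<open>has_noise_integral M F T \<theta> W H S\<close>: the continuous process \<open>S\<close> is
  \<open>t \<mapsto> \<Sum>\<^sub>j\<^sub>,\<^sub>k \<theta>\<^sub>k \<integral>\<^sub>0\<^sup>t H\<^sub>j\<^sub>,\<^sub>k(s) dW\<^sup>(\<^sup>j\<^sup>)\<^sub>k(s)\<close>, the series converging in \<open>L\<^sup>2(\<Omega>)\<close> at each time.
\<close>

definition has_noise_integral ::
  "'w measure \<Rightarrow> (real \<Rightarrow> 'w measure) \<Rightarrow> real \<Rightarrow> (real ^ 'n \<Rightarrow> real)
     \<Rightarrow> (nat \<Rightarrow> real ^ 'n \<Rightarrow> real \<Rightarrow> 'w \<Rightarrow> complex) \<Rightarrow> (nat \<Rightarrow> real ^ 'n \<Rightarrow> real \<Rightarrow> 'w \<Rightarrow> complex)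
     \<Rightarrow> (real \<Rightarrow> 'w \<Rightarrow> complex) \<Rightarrow> bool" where
  "has_noise_integral M F T \<theta> W H S \<longleftrightarrow>
     (\<forall>t\<in>{0..T}. S t \<in> borel_measurable (F t)) \<and>
     (AE \<omega> in M. continuous_on {0..T} (\<lambda>t. S t \<omega>)) \<and>
     (\<exists>I. (\<forall>(j, k)\<in>noise_index. has_ito_integral M F T (W j k) (H j k) (I j k)) \<and>
        (\<forall>t\<in>{0..T}. ((\<lambda>A. \<integral>\<^sup>+\<omega>. ennreal ((norm (S t \<omega> -
            (\<Sum>(j, k)\<in>A. complex_of_real (\<theta> k) * I j k t \<omega>)))\<^sup>2) \<partial>M)
          \<longlongrightarrow> 0) (finite_subsets_at_top noise_index)))"

text \<open>
  Weak continuity is continuity of all continuous linear functionals along the path.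
\<close>

definition weakly_continuous_on :: "real set \<Rightarrow> (real \<Rightarrow> 'b::real_normed_vector) \<Rightarrow> bool" where
  "weakly_continuous_on S f \<longleftrightarrow>
     (\<forall>l :: 'b \<Rightarrow> real. bounded_linear l \<longrightarrow> continuous_on S (\<lambda>t. l (f t)))"

definition weak_solution ::
  "'w measure \<Rightarrow> (real \<Rightarrow> 'w measure) \<Rightarrow> real \<Rightarrow> (real ^ 'n \<Rightarrow> real)
     \<Rightarrow> (nat \<Rightarrow> real ^ 'n \<Rightarrow> real ^ 'n) \<Rightarrow> (nat \<Rightarrow> real ^ 'n \<Rightarrow> real \<Rightarrow> 'w \<Rightarrow> complex) \<Rightarrow> real
     \<Rightarrow> ('n::finite) torus_l2 \<Rightarrow> (real \<Rightarrow> 'w \<Rightarrow> 'n torus_l2) \<Rightarrow> bool" where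
  "weak_solution M F T \<theta> a W c u0 u \<longleftrightarrow>
     progressively_measurable F T u \<and>
     (AE \<omega> in M. weakly_continuous_on {0..T} (\<lambda>t. u t \<omega>)) \<and>
     (\<integral>\<^sup>+t\<in>{0..T}. (\<integral>\<^sup>+\<omega>. ennreal ((norm (u t \<omega>))\<^sup>2) \<partial>M) \<partial>lborel) < \<infinity> \<and>
     (AE \<omega> in M. u 0 \<omega> = u0) \<and>
     (\<forall>\<phi>. torus_smooth \<phi> \<longrightarrow>
        (\<exists>S. has_noise_integral M F T \<theta> W
               (\<lambda>j k s \<omega>. pairing (u s \<omega>) (\<lambda>x. fourier_mode k x * complex_of_real (a j k \<bullet> grad \<phi> x))) S \<and>
             (AE \<omega> in M. \<forall>t\<in>{0..T}.
                complex_of_real (pairing (u t \<omega>) \<phi> - pairing u0 \<phi>) =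
                complex_of_real (c * (LINT s:{0..t}|lborel. pairing (u s \<omega>) (laplacian \<phi>))) - S t \<omega>)))"

end

theory Submission
  imports Defs
begin

text \<open>
  Let \<open>X\<^sub>k = \<langle>u, e\<^sub>-\<^sub>k\<rangle> - \<langle>v, e\<^sub>-\<^sub>k\<rangle>\<close> and \<open>y\<^sub>k(t) = E \<bar>X\<^sub>k(t)\<bar>\<^sup>2\<close>.  Testing the equation with \<open>cos (k \<bullet> x)\<close> and \<open>sin (k \<bullet> x)\<close>
  gives \<open>X\<^sub>k(t) = - c \<bar>k\<bar>\<^sup>2 \<integral>\<^sub>0\<^sup>t X\<^sub>k ds - S\<^sub>k(t)\<close>, where the integrand of the martingale \<open>S\<^sub>k\<close> against \<open>W\<^sup>(\<^sup>j\<^sup>)\<^sub>l\<close> is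
  \<open>- \<i> (a\<^sup>(\<^sup>j\<^sup>)\<^sub>l \<bullet> k) X\<^sub>k\<^sub>-\<^sub>l\<close>.  Since the components of the noise are orthogonal, the Ito isometry yields the closed
  linear system \<open>y\<^sub>k' = \<Sum>\<^sub>j\<^sub>,\<^sub>l 2 \<theta>\<^sub>l\<^sup>2 (a\<^sup>(\<^sup>j\<^sup>)\<^sub>l \<bullet> k)\<^sup>2 y\<^sub>k\<^sub>-\<^sub>l - 2 c \<bar>k\<bar>\<^sup>2 y\<^sub>k\<close>, and isotropy of \<open>\<theta>\<close> says exactly that the
  coefficients on the right add up to \<open>0\<close>.  Integrating twice in time, with \<open>z\<^sub>k = \<integral>\<^sub>0\<^sup>T y\<^sub>k\<close> and
  \<open>Z\<^sub>k = \<integral>\<^sub>0\<^sup>T \<integral>\<^sub>0\<^sup>s y\<^sub>k\<close>, gives \<open>z\<^sub>k = \<Sum> w\<^sub>j\<^sub>,\<^sub>l (Z\<^sub>k\<^sub>-\<^sub>l - Z\<^sub>k)\<close> with \<open>w \<ge> 0\<close>.  By Bessel's inequality \<open>Z\<close> is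
  summable, so it has a maximum; there \<open>z\<^sub>k \<le> 0\<close>, hence \<open>Z\<^sub>k = 0\<close>.  Thus \<open>Z = 0\<close>, and all Fourier
  coefficients of \<open>u\<close> and \<open>v\<close> agree almost surely.
\<close>

section \<open>Complex-valued square integrable functions\<close>

text \<open>The Laplacian in the equation is exactly the Ito correction of the transport noise. The
  mean energy balance therefore keeps no dissipation, and a solution that is only square integrable
  in space cannot serve as its own test function. Passing to second moments of Fourier modes avoids
  this: every test function is smooth, and the expectations form a closed system. One time
  integration would not suffice. At a fixed time the balance links \<open>y_k(t)\<close> to time
  integrals of the other modes, and at a maximiser of these integrals it yields only
  \<open>y_k(t) = 0\<close>, for an index that depends on \<open>t\<close>. After the second
  integration the left side contains the full integral of \<open>y_k\<close>, and its vanishing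
  forces the double integral of the same nonnegative function to vanish. The balance is kept in
  \<open>ennreal\<close> with the damping moved to the left, so that lattice sums and time integrals
  can be exchanged without prior summability estimates. Since the weak formulation admits only real
  test functions, each complex mode combines a cosine and a sine, and the isometry is needed in
  polarised form.\<close>

definition csquare_integrable :: "'a measure \<Rightarrow> ('a \<Rightarrow> complex) \<Rightarrow> bool" where
  "csquare_integrable P f \<longleftrightarrow> f \<in> borel_measurable P \<and> integrable P (\<lambda>x. (norm (f x))\<^sup>2)"

definition l2_inner :: "'a measure \<Rightarrow> ('a \<Rightarrow> complex) \<Rightarrow> ('a \<Rightarrow> complex) \<Rightarrow> complex" where
  "l2_inner P f g = (\<integral>x. f x * cnj (g x) \<partial>P)"

abbreviation l2_dist2 :: "'a measure \<Rightarrow> ('a \<Rightarrow> complex) \<Rightarrow> ('a \<Rightarrow> complex) \<Rightarrow> ennreal" where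
  "l2_dist2 P f g \<equiv> \<integral>\<^sup>+x. ennreal ((norm (f x - g x))\<^sup>2) \<partial>P"

lemma csquare_integrableD: 
  "csquare_integrable P f \<Longrightarrow> f \<in> borel_measurable P"
  "csquare_integrable P f \<Longrightarrow> integrable P (\<lambda>x. (norm (f x))\<^sup>2)"
  by (auto simp: csquare_integrable_def)

lemma csquare_integrable_iff:
  "csquare_integrable P f \<longleftrightarrow>
    f \<in> borel_measurable P \<and> (\<integral>\<^sup>+x. ennreal ((norm (f x))\<^sup>2) \<partial>P) < \<infinity>"
  by (auto simp: csquare_integrable_def integrable_iff_bounded)

lemma csquare_integrable_mult:
  assumes "csquare_integrable P f" "csquare_integrable P g"
  shows "integrable P (\<lambda>x. f x * g x)"
proof (rule Bochner_Integration.integrable_bound)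
  show "integrable P (\<lambda>x. norm (f x) * norm (g x))"
    by (rule square_integrable_mult) (use assms in \<open>auto simp: square_integrable_def csquare_integrable_def\<close>)
  show "(\<lambda>x. f x * g x) \<in> borel_measurable P" using assms by (auto simp: csquare_integrable_def)
qed (simp add: norm_mult)

lemma csquare_integrable_cnj: "csquare_integrable P f \<Longrightarrow> csquare_integrable P (\<lambda>x. cnj (f x))"
  by (auto simp: csquare_integrable_def intro: borel_measurable_continuous_on[of cnj])

lemma csquare_integrable_mult_cnj:
  assumes "csquare_integrable P f" "csquare_integrable P g"
  shows "integrable P (\<lambda>x. f x * cnj (g x))"
  using csquare_integrable_mult[OF assms(1) csquare_integrable_cnj[OF assms(2)]] .

lemma csquare_integrable_bounded_mult:
  assumes f: "csquare_integrable P f" and \<xi>: "\<xi> \<in> borel_measurable P" "\<And>x. x \<in> space P \<Longrightarrow> norm (\<xi> x) \<le> K"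
  shows "csquare_integrable P (\<lambda>x. \<xi> x * f x)"
  unfolding csquare_integrable_def
proof
  show "(\<lambda>x. \<xi> x * f x) \<in> borel_measurable P" using assms by (auto simp: csquare_integrable_def)
  show "integrable P (\<lambda>x. (norm (\<xi> x * f x))\<^sup>2)"
  proof (rule Bochner_Integration.integrable_bound)
    show "integrable P (\<lambda>x. K\<^sup>2 * (norm (f x))\<^sup>2)" using f by (auto simp: csquare_integrable_def)
    show "(\<lambda>x. (norm (\<xi> x * f x))\<^sup>2) \<in> borel_measurable P"
      using assms by (auto simp: csquare_integrable_def)
    show "AE x in P. norm ((norm (\<xi> x * f x))\<^sup>2) \<le> norm (K\<^sup>2 * (norm (f x))\<^sup>2)"
    proof (rule AE_I2)
      fix x assume "x \<in> space P"
      from power_mono[OF \<xi>(2)[OF this], of 2]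
      show "norm ((norm (\<xi> x * f x))\<^sup>2) \<le> norm (K\<^sup>2 * (norm (f x))\<^sup>2)"
        by (auto simp: norm_mult power_mult_distrib intro!: mult_right_mono)
    qed
  qed
qed

lemma csquare_integrable_scale: "csquare_integrable P f \<Longrightarrow> csquare_integrable P (\<lambda>x. c * f x)"
  by (rule csquare_integrable_bounded_mult[where K = "norm c"]) auto

lemma norm_add_square_le: "(norm (a + b :: complex))\<^sup>2 \<le> 2 * (norm a)\<^sup>2 + 2 * (norm b)\<^sup>2"
proof -
  have "(norm (a + b))\<^sup>2 \<le> (norm a + norm b)\<^sup>2" by (intro power_mono norm_triangle_ineq) auto
  moreover have "0 \<le> (norm a - norm b)\<^sup>2" by simp
  ultimately show ?thesis unfolding power2_sum power2_diff by linarith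
qed

lemma csquare_integrable_add:
  assumes "csquare_integrable P f" "csquare_integrable P g"
  shows "csquare_integrable P (\<lambda>x. f x + g x)"
  unfolding csquare_integrable_def
proof
  show "(\<lambda>x. f x + g x) \<in> borel_measurable P" using assms by (auto simp: csquare_integrable_def)
  show "integrable P (\<lambda>x. (norm (f x + g x))\<^sup>2)"
  proof (rule Bochner_Integration.integrable_bound)
    show "integrable P (\<lambda>x. 2 * (norm (f x))\<^sup>2 + 2 * (norm (g x))\<^sup>2)"
      using assms by (auto simp: csquare_integrable_def)
    show "(\<lambda>x. (norm (f x + g x))\<^sup>2) \<in> borel_measurable P"
      using assms by (auto simp: csquare_integrable_def)
  qed (use norm_add_square_le in auto)
qed

lemma csquare_integrable_diff:
  assumes "csquare_integrable P f" "csquare_integrable P g"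
  shows "csquare_integrable P (\<lambda>x. f x - g x)"
  using csquare_integrable_add[OF assms(1) csquare_integrable_scale[OF assms(2), of "-1"]] by simp

lemma csquare_integrable_zero: "csquare_integrable P (\<lambda>x. 0)"
  by (simp add: csquare_integrable_def)

lemma csquare_integrable_sum:
  "(\<And>i. i \<in> A \<Longrightarrow> csquare_integrable P (f i)) \<Longrightarrow> csquare_integrable P (\<lambda>x. \<Sum>i\<in>A. f i x)"
  by (induction A rule: infinite_finite_induct)
    (auto intro: csquare_integrable_add csquare_integrable_zero)

lemma (in finite_measure) csquare_integrable_const: "csquare_integrable M (\<lambda>x. c)"
  by (simp add: csquare_integrable_def)

lemma l2_inner_add_left:
  assumes "csquare_integrable P f" "csquare_integrable P g" "csquare_integrable P h"
  shows "l2_inner P (\<lambda>x. f x + g x) h = l2_inner P f h + l2_inner P g h"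
  unfolding l2_inner_def distrib_right
  by (rule Bochner_Integration.integral_add) (use assms csquare_integrable_mult_cnj in auto)

lemma l2_inner_add_right:
  assumes "csquare_integrable P f" "csquare_integrable P g" "csquare_integrable P h"
  shows "l2_inner P h (\<lambda>x. f x + g x) = l2_inner P h f + l2_inner P h g"
  unfolding l2_inner_def complex_cnj_add distrib_left
  by (rule Bochner_Integration.integral_add) (use assms csquare_integrable_mult_cnj in auto)

lemma l2_inner_diff_left:
  assumes "csquare_integrable P f" "csquare_integrable P g" "csquare_integrable P h"
  shows "l2_inner P (\<lambda>x. f x - g x) h = l2_inner P f h - l2_inner P g h"
  unfolding l2_inner_def left_diff_distrib
  by (rule Bochner_Integration.integral_diff) (use assms csquare_integrable_mult_cnj in auto)

lemma l2_inner_diff_right: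
  assumes "csquare_integrable P f" "csquare_integrable P g" "csquare_integrable P h"
  shows "l2_inner P h (\<lambda>x. f x - g x) = l2_inner P h f - l2_inner P h g"
  unfolding l2_inner_def complex_cnj_diff right_diff_distrib
  by (rule Bochner_Integration.integral_diff) (use assms csquare_integrable_mult_cnj in auto)

lemma l2_inner_scale_left: "l2_inner P (\<lambda>x. c * f x) g = c * l2_inner P f g"
  unfolding l2_inner_def by (simp add: mult.assoc)

lemma l2_inner_scale_right: "l2_inner P f (\<lambda>x. c * g x) = cnj c * l2_inner P f g"
  unfolding l2_inner_def by (simp add: mult.left_commute)

lemma l2_inner_commute: "l2_inner P g f = cnj (l2_inner P f g)"
  unfolding l2_inner_def
  by (subst Bochner_Integration.integral_cnj[symmetric]) (simp add: mult.commute)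

lemma l2_inner_sum_left:
  assumes "\<And>i. i \<in> A \<Longrightarrow> csquare_integrable P (f i)" "csquare_integrable P g"
  shows "l2_inner P (\<lambda>x. \<Sum>i\<in>A. f i x) g = (\<Sum>i\<in>A. l2_inner P (f i) g)"
  unfolding l2_inner_def sum_distrib_right
  by (rule Bochner_Integration.integral_sum) (use assms csquare_integrable_mult_cnj in auto)

lemma l2_inner_sum_right:
  assumes "\<And>i. i \<in> A \<Longrightarrow> csquare_integrable P (f i)" "csquare_integrable P g"
  shows "l2_inner P g (\<lambda>x. \<Sum>i\<in>A. f i x) = (\<Sum>i\<in>A. l2_inner P g (f i))"
  unfolding l2_inner_def cnj_sum sum_distrib_left
  by (rule Bochner_Integration.integral_sum) (use assms csquare_integrable_mult_cnj in auto)

lemma l2_inner_self: "l2_inner P f f = of_real (\<integral>x. (norm (f x))\<^sup>2 \<partial>P)"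
  unfolding l2_inner_def complex_norm_square[symmetric] integral_complex_of_real ..

text \<open>Young's inequality with a free weight \<open>a\<close>, followed by the best weight
  \<open>q / p\<close>. Both squared norms are enlarged by \<open>e\<close> so that this weight
  makes sense even when a norm vanishes; then \<open>e\<close> tends to 0.\<close>

lemma l2_inner_Cauchy_Schwarz:
  assumes f: "csquare_integrable P f" and g: "csquare_integrable P g"
  shows "norm (l2_inner P f g) \<le> sqrt (\<integral>x. (norm (f x))\<^sup>2 \<partial>P) * sqrt (\<integral>x. (norm (g x))\<^sup>2 \<partial>P)"
    (is "?I \<le> sqrt ?A * sqrt ?B")
proof -
  have AB: "?A \<ge> 0" "?B \<ge> 0" by auto
  have key: "2 * ?I \<le> a * ?A + ?B / a" if a: "a > 0" for a
  proof -
    have "?I \<le> (\<integral>x. norm (f x * cnj (g x)) \<partial>P)" unfolding l2_inner_def by (rule integral_norm_bound)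
    also have "\<dots> \<le> (\<integral>x. (a * (norm (f x))\<^sup>2 + (norm (g x))\<^sup>2 / a) / 2 \<partial>P)"
    proof (rule integral_mono)
      show "integrable P (\<lambda>x. norm (f x * cnj (g x)))"
        using csquare_integrable_mult_cnj[OF f g] by auto
      show "integrable P (\<lambda>x. (a * (norm (f x))\<^sup>2 + (norm (g x))\<^sup>2 / a) / 2)"
        using f g by (auto simp: csquare_integrable_def)
      fix x
      have "0 \<le> (a * norm (f x) - norm (g x))\<^sup>2 / a" using a by simp
      also have "\<dots> = a * (norm (f x))\<^sup>2 + (norm (g x))\<^sup>2 / a - 2 * (norm (f x) * norm (g x))"
        using a by (simp add: power2_eq_square field_simps)
      finally show "norm (f x * cnj (g x)) \<le> (a * (norm (f x))\<^sup>2 + (norm (g x))\<^sup>2 / a) / 2"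
        by (simp add: norm_mult)
    qed
    also have "\<dots> = (a * ?A + ?B / a) / 2"
      using csquare_integrableD(2)[OF f] csquare_integrableD(2)[OF g] by simp
    finally show ?thesis by simp
  qed
  have "?I \<le> sqrt (?A + e) * sqrt (?B + e)" if e: "e > 0" for e
  proof -
    define p q where "p = sqrt (?A + e)" and "q = sqrt (?B + e)"
    have pq: "p > 0" "q > 0" "p\<^sup>2 = ?A + e" "q\<^sup>2 = ?B + e" using AB e by (auto simp: p_def q_def add_nonneg_pos)
    have "2 * ?I \<le> (q / p) * ?A + ?B / (q / p)" using key[of "q / p"] pq by simp
    also have "\<dots> \<le> (q / p) * p\<^sup>2 + q\<^sup>2 / (q / p)"
      using pq e by (intro add_mono mult_left_mono divide_right_mono) auto
    also have "\<dots> = 2 * (p * q)" using pq(1,2) by (simp add: power2_eq_square field_simps)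
    finally show ?thesis by (simp add: p_def q_def)
  qed
  moreover have "((\<lambda>e. sqrt (?A + e) * sqrt (?B + e)) \<longlongrightarrow> sqrt (?A + 0) * sqrt (?B + 0)) (at_right 0)"
    by (intro tendsto_intros)
  ultimately have "?I \<le> sqrt (?A + 0) * sqrt (?B + 0)"
    by (intro tendsto_lowerbound[where F = "at_right (0::real)"]) 
      (auto simp: eventually_at_right_less eventually_at_filter)
  then show ?thesis by simp
qed

lemma l2_dist2_eq:
  assumes "csquare_integrable P f" "csquare_integrable P g"
  shows "l2_dist2 P f g = ennreal (\<integral>x. (norm (f x - g x))\<^sup>2 \<partial>P)"
  by (rule nn_integral_eq_integral)
    (use csquare_integrableD(2)[OF csquare_integrable_diff[OF assms]] in auto)

text \<open>The filter is arbitrary because limits are taken along sequences of elementary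
  integrands and along finite subsets of the noise series. The difference of the inner products is
  expanded into three terms, each controlled by Cauchy-Schwarz.\<close>

lemma tendsto_l2_inner:
  assumes f: "csquare_integrable P f" and g: "csquare_integrable P g"
    and fi: "\<forall>\<^sub>F i in A. csquare_integrable P (f' i)" and gi: "\<forall>\<^sub>F i in A. csquare_integrable P (g' i)"
    and fl: "((\<lambda>i. l2_dist2 P f (f' i)) \<longlongrightarrow> 0) A" and gl: "((\<lambda>i. l2_dist2 P g (g' i)) \<longlongrightarrow> 0) A"
  shows "((\<lambda>i. l2_inner P (f' i) (g' i)) \<longlongrightarrow> l2_inner P f g) A"
proof -
  define a b where "a i = sqrt (\<integral>x. (norm (f x - f' i x))\<^sup>2 \<partial>P)"
    and "b i = sqrt (\<integral>x. (norm (g x - g' i x))\<^sup>2 \<partial>P)" for i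
  have lim: "((\<lambda>i. sqrt (\<integral>x. (norm (h x - h' i x))\<^sup>2 \<partial>P)) \<longlongrightarrow> 0) A"
    if h: "csquare_integrable P h" "\<forall>\<^sub>F i in A. csquare_integrable P (h' i)"
      and l: "((\<lambda>i. l2_dist2 P h (h' i)) \<longlongrightarrow> 0) A" for h h'
  proof -
    have "((\<lambda>i. ennreal (\<integral>x. (norm (h x - h' i x))\<^sup>2 \<partial>P)) \<longlongrightarrow> ennreal 0) A"
      unfolding ennreal_0
      by (rule Lim_transform_eventually[OF l eventually_mono[OF h(2) l2_dist2_eq[OF h(1)]]])
    then have "((\<lambda>i. \<integral>x. (norm (h x - h' i x))\<^sup>2 \<partial>P) \<longlongrightarrow> 0) A"
      by (subst (asm) tendsto_ennreal_iff) auto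
    then show ?thesis using tendsto_real_sqrt by fastforce
  qed
  have al: "(a \<longlongrightarrow> 0) A" and bl: "(b \<longlongrightarrow> 0) A"
    unfolding a_def b_def using lim[OF f fi fl] lim[OF g gi gl] by auto
  define p q where "p = sqrt (\<integral>x. (norm (f x))\<^sup>2 \<partial>P)" and "q = sqrt (\<integral>x. (norm (g x))\<^sup>2 \<partial>P)"
  have ev: "\<forall>\<^sub>F i in A. norm (l2_inner P (f' i) (g' i) - l2_inner P f g) \<le> a i * q + p * b i + a i * b i"
    using fi gi
  proof eventually_elim
    case (elim i)
    note df = csquare_integrable_diff[OF f elim(1)] and dg = csquare_integrable_diff[OF g elim(2)]
    have 1: "l2_inner P f g = l2_inner P (\<lambda>x. f x - f' i x) g + l2_inner P (f' i) g"
      using l2_inner_add_left[OF df elim(1) g] by simp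
    have 2: "l2_inner P (f' i) g = l2_inner P (f' i) (\<lambda>x. g x - g' i x) + l2_inner P (f' i) (g' i)"
      using l2_inner_add_right[OF dg elim(2) elim(1)] by simp
    have 3: "l2_inner P f (\<lambda>x. g x - g' i x)
        = l2_inner P (\<lambda>x. f x - f' i x) (\<lambda>x. g x - g' i x) + l2_inner P (f' i) (\<lambda>x. g x - g' i x)"
      using l2_inner_add_left[OF df elim(1) dg] by simp
    have "l2_inner P (f' i) (g' i) - l2_inner P f g
      = l2_inner P (\<lambda>x. f x - f' i x) (\<lambda>x. g x - g' i x) - l2_inner P f (\<lambda>x. g x - g' i x)
        - l2_inner P (\<lambda>x. f x - f' i x) g" (is "?d = ?d1 - ?d2 - ?d3")
      using 1 2 3 by (simp add: algebra_simps)
    then have "norm ?d = norm (?d1 - ?d2 - ?d3)" by (simp only:)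
    also have "\<dots> \<le> norm (l2_inner P (\<lambda>x. f x - f' i x) (\<lambda>x. g x - g' i x))
        + norm (l2_inner P f (\<lambda>x. g x - g' i x)) + norm (l2_inner P (\<lambda>x. f x - f' i x) g)"
      by (intro order_trans[OF norm_triangle_ineq4] add_right_mono norm_triangle_ineq4)
    also have "\<dots> \<le> a i * b i + p * b i + a i * q"
      unfolding a_def b_def p_def q_def
      by (intro add_mono l2_inner_Cauchy_Schwarz f g df dg)
    finally show ?case by simp
  qed
  have "((\<lambda>i. a i * q + p * b i + a i * b i) \<longlongrightarrow> 0 * q + p * 0 + 0 * 0) A"
    by (intro tendsto_add tendsto_mult tendsto_const al bl)
  then have "((\<lambda>i. a i * q + p * b i + a i * b i) \<longlongrightarrow> 0) A" by simp
  from Lim_null_comparison[OF ev this]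
  show ?thesis by (simp add: LIM_zero_iff)
qed

lemma csquare_integrable_if_l2_dist2_finite:
  assumes "f \<in> borel_measurable P" "csquare_integrable P g" "l2_dist2 P f g < \<infinity>"
  shows "csquare_integrable P f"
proof -
  have "csquare_integrable P (\<lambda>x. f x - g x)"
    using assms by (auto simp: csquare_integrable_iff)
  from csquare_integrable_add[OF this assms(2)] show ?thesis by simp
qed

text \<open>The definitions of the stochastic integrals provide convergence of
  \<open>l2_dist2\<close> to 0 but no finite second moment of the integral itself. One approximant
  at distance below 1 supplies it.\<close>

lemma csquare_integrable_limit:
  assumes "f \<in> borel_measurable P" "\<forall>\<^sub>F i in A. csquare_integrable P (f' i)"
    "((\<lambda>i. l2_dist2 P f (f' i)) \<longlongrightarrow> 0) A" "A \<noteq> bot"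
  shows "csquare_integrable P f"
proof -
  have "\<forall>\<^sub>F i in A. l2_dist2 P f (f' i) < 1"
    using assms(3) by (rule order_tendstoD) simp
  with assms(2) have "\<forall>\<^sub>F i in A. csquare_integrable P (f' i) \<and> l2_dist2 P f (f' i) < 1"
    by eventually_elim auto
  then obtain i where i: "csquare_integrable P (f' i)" "l2_dist2 P f (f' i) < 1"
    using eventually_happens'[OF assms(4)] by blast
  have "l2_dist2 P f (f' i) < \<infinity>"
    using i(2) by (rule order_less_trans) (simp add: infinity_ennreal_def)
  with i(1) show ?thesis by (rule csquare_integrable_if_l2_dist2_finite[OF assms(1)])
qed

section \<open>Brownian increments\<close>

locale filtered_prob_space = prob_space M for M :: "'w measure" +
  fixes F :: "real \<Rightarrow> 'w measure"
  assumes filtration: "normal_filtration M F"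
begin

lemma subalgebra_filtration: "0 \<le> t \<Longrightarrow> subalgebra M (F t)"
  using filtration by (auto simp: normal_filtration_def)

lemma space_filtration: "0 \<le> t \<Longrightarrow> space (F t) = space M"
  using subalgebra_filtration by (auto simp: subalgebra_def)

lemma measurable_filtration_mono:
  assumes "0 \<le> s" "s \<le> t" "f \<in> measurable (F s) N"
  shows "f \<in> measurable (F t) N"
proof -
  have "sets (F s) \<subseteq> sets (F t)"
    using filtration assms(1,2) unfolding normal_filtration_def by blast
  then have "subalgebra (F t) (F s)"
    using assms(1,2) space_filtration[of s] space_filtration[of t]
    by (simp add: subalgebra_def)
  then show ?thesis using assms measurable_from_subalg by blast
qed

lemma measurable_filtration: "0 \<le> t \<Longrightarrow> f \<in> measurable (F t) N \<Longrightarrow> f \<in> measurable M N"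
  using measurable_from_subalg subalgebra_filtration by blast

end

text \<open>\<open>G\<close> will be the past and \<open>D\<close> a later increment. With
  \<open>g\<close> the embedding into the complex numbers or the square, this gives the first two
  moments of the increment against past variables, without conditional expectations.\<close>

lemma (in prob_space) integral_mult_indep_subalgebra:
  fixes \<xi> :: "'a \<Rightarrow> complex" and D :: "'a \<Rightarrow> real" and g :: "real \<Rightarrow> complex"
  assumes sub: "subalgebra M G"
    and ind: "indep_set (sets G) {D -` A \<inter> space M | A. A \<in> sets borel}"
    and D: "D \<in> borel_measurable M" and \<xi>: "\<xi> \<in> borel_measurable G" "integrable M \<xi>"
    and g: "g \<in> borel_measurable borel" "integrable M (\<lambda>\<omega>. g (D \<omega>))"
  shows "integrable M (\<lambda>\<omega>. \<xi> \<omega> * g (D \<omega>))"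
    and "(\<integral>\<omega>. \<xi> \<omega> * g (D \<omega>) \<partial>M) = (\<integral>\<omega>. \<xi> \<omega> \<partial>M) * (\<integral>\<omega>. g (D \<omega>) \<partial>M)"
proof -
  have sp: "space G = space M" using sub by (auto simp: subalgebra_def)
  have iv: "indep_var borel \<xi> borel (\<lambda>\<omega>. g (D \<omega>))"
    unfolding indep_var_eq
  proof (intro conjI)
    show "random_variable borel \<xi>" using measurable_from_subalg[OF sub \<xi>(1)] .
    show "random_variable borel (\<lambda>\<omega>. g (D \<omega>))" using D g by measurable
    have 1: "sigma_sets (space M) {\<xi> -` A \<inter> space M |A. A \<in> sets borel} \<subseteq> sets G"
      unfolding sp[symmetric]
      by (rule sets.sigma_sets_subset) (use \<xi>(1) in \<open>auto intro: measurable_sets\<close>)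
    \<comment> \<open>The preimages of Borel sets under \<open>D\<close> already form a
      sigma-algebra, so the one generated by \<open>g\<close> after \<open>D\<close> lies inside
      them.\<close>
    have 2: "sigma_sets (space M) {(\<lambda>\<omega>. g (D \<omega>)) -` A \<inter> space M |A. A \<in> sets borel}
        \<subseteq> {D -` A \<inter> space M | A. A \<in> sets borel}"
    proof -
      have "{(\<lambda>\<omega>. g (D \<omega>)) -` A \<inter> space M |A. A \<in> sets borel}
          \<subseteq> {D -` A \<inter> space M | A. A \<in> sets borel}"
      proof safe
        fix A :: "complex set" assume "A \<in> sets borel"
        then have "g -` A \<in> sets borel" using g(1) measurable_sets_borel by blast
        then show "\<exists>Aa. (\<lambda>\<omega>. g (D \<omega>)) -` A \<inter> space M = D -` Aa \<inter> space M \<and> Aa \<in> sets borel"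
          by (intro exI[of _ "g -` A"]) auto
      qed
      moreover have "{D -` A \<inter> space M | A. A \<in> sets borel} = sets (vimage_algebra (space M) D borel)"
        by (simp add: sets_vimage_algebra2)
      moreover have "space (vimage_algebra (space M) D borel) = space M" by simp
      ultimately show ?thesis
        using sets.sigma_sets_subset[of _ "vimage_algebra (space M) D borel"] by (metis (no_types, lifting))
    qed
    show "indep_set (sigma_sets (space M) {\<xi> -` A \<inter> space M |A. A \<in> sets borel})
     (sigma_sets (space M) {(\<lambda>\<omega>. g (D \<omega>)) -` A \<inter> space M |A. A \<in> sets borel})"
      unfolding indep_set_def
      by (rule indep_sets_mono_sets[OF ind[unfolded indep_set_def]]) (use 1 2 in \<open>simp split: bool.split\<close>)
  qed
  show "integrable M (\<lambda>\<omega>. \<xi> \<omega> * g (D \<omega>))"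
    using indep_var_integrable[OF iv \<xi>(2) g(2)] .
  show "(\<integral>\<omega>. \<xi> \<omega> * g (D \<omega>) \<partial>M) = (\<integral>\<omega>. \<xi> \<omega> \<partial>M) * (\<integral>\<omega>. g (D \<omega>) \<partial>M)"
    using indep_var_lebesgue_integral[OF iv \<xi>(2) g(2)] .
qed

lemma integrable_bounded_mult:
  fixes f \<xi> :: "'a \<Rightarrow> complex"
  assumes "integrable M f" "\<xi> \<in> borel_measurable M" "\<And>\<omega>. \<omega> \<in> space M \<Longrightarrow> norm (\<xi> \<omega>) \<le> K"
  shows "integrable M (\<lambda>\<omega>. \<xi> \<omega> * f \<omega>)"
proof (rule Bochner_Integration.integrable_bound)
  show "integrable M (\<lambda>\<omega>. K * norm (f \<omega>))" using assms by auto
  show "(\<lambda>\<omega>. \<xi> \<omega> * f \<omega>) \<in> borel_measurable M" using assms by auto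
  show "AE \<omega> in M. norm (\<xi> \<omega> * f \<omega>) \<le> norm (K * norm (f \<omega>))"
  proof (rule AE_I2)
    fix \<omega> assume "\<omega> \<in> space M"
    then have "norm (\<xi> \<omega>) \<le> K" using assms by auto
    then show "norm (\<xi> \<omega> * f \<omega>) \<le> norm (K * norm (f \<omega>))"
      by (auto simp: norm_mult abs_mult intro!: mult_right_mono)
  qed
qed

context filtered_prob_space
begin

lemma brownian_increment:
  assumes B: "brownian_motion M F B" and st: "0 \<le> s" "s < t"
  defines "D \<equiv> \<lambda>\<omega>. B t \<omega> - B s \<omega>"
  shows "square_integrable M D" and "integrable M D" and "(\<integral>\<omega>. D \<omega> \<partial>M) = 0"
    and "(\<integral>\<omega>. (D \<omega>)\<^sup>2 \<partial>M) = t - s"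
    and "indep_set (sets (F s)) {D -` A \<inter> space M | A. A \<in> sets borel}"
proof -
  have d: "distributed M lborel D (normal_density 0 (sqrt (t - s)))"
    and i: "indep_set (sets (F s)) {D -` A \<inter> space M | A. A \<in> sets borel}"
    using B st by (auto simp: brownian_motion_def D_def)
  have [measurable]: "D \<in> borel_measurable M" using distributed_measurable[OF d] by simp
  have pos: "sqrt (t - s) > 0" using st by simp
  have e: "expectation D = 0" using normal_distributed_expectation[OF pos d] .
  have v: "variance D = t - s" using normal_distributed_variance[OF pos d] st by simp
  have i2: "integrable M (\<lambda>\<omega>. (D \<omega>)^2)"
  proof -
    have "integrable lborel (\<lambda>x. normal_density 0 (sqrt (t - s)) x * x\<^sup>2)"
      using integrable_normal_moment[OF pos, of 0 2] by simp
    then show ?thesis using distributed_integrable[OF d, of "\<lambda>x. x^2"] by simp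
  qed
  show "square_integrable M D" using i2 by (simp add: square_integrable_def)
  show "integrable M D" by (rule square_integrable_imp_integrable[OF _ i2]) simp
  show "(\<integral>\<omega>. D \<omega> \<partial>M) = 0" by (fact e)
  show "(\<integral>\<omega>. (D \<omega>)\<^sup>2 \<partial>M) = t - s" using v e by simp
  show "indep_set (sets (F s)) {D -` A \<inter> space M | A. A \<in> sets borel}" by fact
qed

lemma brownian_increment_mean:
  assumes B: "brownian_motion M F B" and st: "0 \<le> s" "s \<le> t"
    and \<xi>: "\<xi> \<in> borel_measurable (F s)" "integrable M (\<xi> :: _ \<Rightarrow> complex)"
  shows "integrable M (\<lambda>\<omega>. \<xi> \<omega> * complex_of_real (B t \<omega> - B s \<omega>))"
    and "(\<integral>\<omega>. \<xi> \<omega> * complex_of_real (B t \<omega> - B s \<omega>) \<partial>M) = 0"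
proof -
  have "integrable M (\<lambda>\<omega>. \<xi> \<omega> * complex_of_real (B t \<omega> - B s \<omega>)) \<and>
    (\<integral>\<omega>. \<xi> \<omega> * complex_of_real (B t \<omega> - B s \<omega>) \<partial>M) = 0"
  \<comment> \<open>\<open>brownian_motion\<close> describes increments for \<open>s < t\<close>
    only; for \<open>s = t\<close> the increment is 0.\<close>
  proof (cases "s = t")
    case False
    then have st': "s < t" using st by simp
    note b = brownian_increment[OF B st(1) st']
    have m: "(\<lambda>\<omega>. B t \<omega> - B s \<omega>) \<in> borel_measurable M" using b(2) by auto
    have "integrable M (\<lambda>\<omega>. complex_of_real (B t \<omega> - B s \<omega>))" using b(2) integrable_of_real by blast
    moreover have "complex_of_real \<in> borel_measurable borel" by measurable
    ultimately show ?thesis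
      using integral_mult_indep_subalgebra[OF subalgebra_filtration[OF st(1)] b(5) m \<xi>, of complex_of_real] b(3)
      by (simp only: integral_complex_of_real) simp
  qed auto
  then show "integrable M (\<lambda>\<omega>. \<xi> \<omega> * complex_of_real (B t \<omega> - B s \<omega>))"
    "(\<integral>\<omega>. \<xi> \<omega> * complex_of_real (B t \<omega> - B s \<omega>) \<partial>M) = 0" by auto
qed

lemma brownian_increment_square:
  assumes B: "brownian_motion M F B" and st: "0 \<le> s" "s \<le> t"
    and \<xi>: "\<xi> \<in> borel_measurable (F s)" "integrable M (\<xi> :: _ \<Rightarrow> complex)"
  shows "(\<integral>\<omega>. \<xi> \<omega> * complex_of_real ((B t \<omega> - B s \<omega>) * (B t \<omega> - B s \<omega>)) \<partial>M)
    = (t - s) * (\<integral>\<omega>. \<xi> \<omega> \<partial>M)"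
proof (cases "s = t")
  case False
  then have st': "s < t" using st by simp
  note b = brownian_increment[OF B st(1) st']
  have m: "(\<lambda>\<omega>. B t \<omega> - B s \<omega>) \<in> borel_measurable M" using b(2) by auto
  have i: "integrable M (\<lambda>\<omega>. complex_of_real ((B t \<omega> - B s \<omega>)^2))"
    by (rule integrable_of_real) (use b(1) in \<open>simp add: square_integrable_def\<close>)
  have "(\<lambda>x. complex_of_real (x^2)) \<in> borel_measurable borel" by measurable
  note X = integral_mult_indep_subalgebra(2)[OF subalgebra_filtration[OF st(1)] b(5) m \<xi> this i]
  have "(\<integral>\<omega>. complex_of_real ((B t \<omega> - B s \<omega>)^2) \<partial>M) = t - s"
    using b(4) by (simp only: integral_complex_of_real)
  with X show ?thesis by (simp only: power2_eq_square mult.commute of_real_diff)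
qed auto


lemma brownian_increment_integrable_mult:
  assumes "brownian_motion M F B" "brownian_motion M F C" "0 \<le> s" "s \<le> t" "0 \<le> s'" "s' \<le> t'"
  shows "integrable M (\<lambda>\<omega>. (B t \<omega> - B s \<omega>) * (C t' \<omega> - C s' \<omega>))"
proof -
  have "square_integrable M (\<lambda>\<omega>. B t \<omega> - B s \<omega>)"
    using brownian_increment(1)[OF assms(1), of s t] assms(3,4) square_integrable_zero[of M]
    by (cases "s = t") auto
  moreover have "square_integrable M (\<lambda>\<omega>. C t' \<omega> - C s' \<omega>)"
    using brownian_increment(1)[OF assms(2), of s' t'] assms(5,6) square_integrable_zero[of M]
    by (cases "s' = t'") auto
  ultimately show ?thesis using square_integrable_mult by blast
qed

text \<open>
  Only the mutual independence of the paths and the independence of each increment from the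
  past are available, not the joint independence of two increments from the past.  Hence the
  partition into \<open>n\<close> pieces: the off-diagonal terms vanish, and the diagonal sum tends to zero
  in \<open>L\<^sup>2\<close>.
\<close>

lemma brownian_increment_cross:
  assumes B: "brownian_motion M F B" and C: "brownian_motion M F C"
    and ind: "indep_var (\<Pi>\<^sub>M t\<in>{0..}. borel) (\<lambda>\<omega>. \<lambda>t\<in>{0..}. B t \<omega>)
      (\<Pi>\<^sub>M t\<in>{0..}. borel) (\<lambda>\<omega>. \<lambda>t\<in>{0..}. C t \<omega>)"
    and st: "0 \<le> s" "s \<le> t"
    and \<xi>: "\<xi> \<in> borel_measurable (F s)" "\<And>\<omega>. \<omega> \<in> space M \<Longrightarrow> norm (\<xi> \<omega> :: complex) \<le> K"
  shows "(\<integral>\<omega>. \<xi> \<omega> * complex_of_real ((B t \<omega> - B s \<omega>) * (C t \<omega> - C s \<omega>)) \<partial>M) = 0"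
proof (cases "s = t")
  case False
  then have st': "s < t" using st by simp
  define J where "J = norm (\<integral>\<omega>. \<xi> \<omega> * complex_of_real ((B t \<omega> - B s \<omega>) * (C t \<omega> - C s \<omega>)) \<partial>M)"
  have \<xi>M: "\<xi> \<in> borel_measurable M" using measurable_filtration[OF st(1) \<xi>(1)] .
  \<comment> \<open>The bound decays like 1/n, while the left side does not depend on the number
    \<open>n\<close> of pieces.\<close>
  have bound: "J\<^sup>2 \<le> K\<^sup>2 * ((t - s)\<^sup>2 / real n)" if n: "n > 0" for n
  proof -
    define h where "h = (t - s) / real n"
    have h: "h > 0" using st' n by (simp add: h_def)
    define \<tau> where "\<tau> p = s + real p * h" for p
    have \<tau>: "0 \<le> \<tau> p" "s \<le> \<tau> p" "\<tau> p < \<tau> (Suc p)" for p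
      using st h by (auto simp: \<tau>_def)
    have \<tau>_mono: "p \<le> q \<Longrightarrow> \<tau> p \<le> \<tau> q" for p q using h by (auto simp: \<tau>_def)
    have \<tau>0: "\<tau> 0 = s" "\<tau> n = t" using n by (auto simp: \<tau>_def h_def)
    define \<beta> where "\<beta> p \<omega> = B (\<tau> (Suc p)) \<omega> - B (\<tau> p) \<omega>" for p \<omega>
    define \<gamma> where "\<gamma> p \<omega> = C (\<tau> (Suc p)) \<omega> - C (\<tau> p) \<omega>" for p \<omega>
    have dB: "B t \<omega> - B s \<omega> = (\<Sum>p<n. \<beta> p \<omega>)" for \<omega>
      using sum_lessThan_telescope[of "\<lambda>p. B (\<tau> p) \<omega>" n] by (simp add: \<beta>_def \<tau>0)
    have dC: "C t \<omega> - C s \<omega> = (\<Sum>p<n. \<gamma> p \<omega>)" for \<omega>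
      using sum_lessThan_telescope[of "\<lambda>p. C (\<tau> p) \<omega>" n] by (simp add: \<gamma>_def \<tau>0)
    have ibg: "integrable M (\<lambda>\<omega>. \<beta> p \<omega> * \<gamma> q \<omega>)" for p q
      unfolding \<beta>_def \<gamma>_def
      by (rule brownian_increment_integrable_mult[OF B C]) (use \<tau> in \<open>auto intro: less_imp_le\<close>)
    have ibb: "integrable M (\<lambda>\<omega>. \<beta> p \<omega> * \<beta> q \<omega>)" for p q
      unfolding \<beta>_def
      by (rule brownian_increment_integrable_mult[OF B B]) (use \<tau> in \<open>auto intro: less_imp_le\<close>)
    have igg: "integrable M (\<lambda>\<omega>. \<gamma> p \<omega> * \<gamma> q \<omega>)" for p q
      unfolding \<gamma>_def
      by (rule brownian_increment_integrable_mult[OF C C]) (use \<tau> in \<open>auto intro: less_imp_le\<close>)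
    have ix: "integrable M (\<lambda>\<omega>. \<xi> \<omega> * complex_of_real (\<beta> p \<omega> * \<gamma> q \<omega>))" for p q
      by (rule integrable_bounded_mult[OF integrable_of_real[OF ibg] \<xi>M \<xi>(2)])
    have Bm: "B r \<in> borel_measurable (F r')" "C r \<in> borel_measurable (F r')" if "0 \<le> r" "r \<le> r'" for r r'
      using B C that measurable_filtration_mono[of r r'] by (auto simp: brownian_motion_def)
    \<comment> \<open>For \<open>p < q\<close> the product of \<open>\<xi>\<close> and
      \<open>\<beta> p\<close> lies in the past of the increment \<open>\<gamma> q\<close>, which
      has mean zero against it; for \<open>q < p\<close> the two motions exchange roles.\<close>
    have off: "(\<integral>\<omega>. \<xi> \<omega> * complex_of_real (\<beta> p \<omega> * \<gamma> q \<omega>) \<partial>M) = 0" if "p \<noteq> q" for p q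
    proof (cases "p < q")
      case True
      then have le: "\<tau> (Suc p) \<le> \<tau> q" using \<tau>_mono by simp
      have [measurable]: "\<beta> p \<in> borel_measurable (F (\<tau> q))"
        using le \<tau>(1,3)[of p] \<tau>(1)[of "Suc p"] unfolding \<beta>_def by (intro borel_measurable_diff Bm) auto
      have [measurable]: "\<xi> \<in> borel_measurable (F (\<tau> q))"
        by (rule measurable_filtration_mono[OF st(1) _ \<xi>(1)]) (rule \<tau>)
      have m: "(\<lambda>\<omega>. \<xi> \<omega> * complex_of_real (\<beta> p \<omega>)) \<in> borel_measurable (F (\<tau> q))" by measurable
      have i: "integrable M (\<lambda>\<omega>. \<xi> \<omega> * complex_of_real (\<beta> p \<omega>))"
        by (rule integrable_bounded_mult[OF integrable_of_real \<xi>M \<xi>(2)])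
          (use brownian_increment(2)[OF B \<tau>(1) \<tau>(3)] in \<open>simp_all add: \<beta>_def\<close>)
      show ?thesis
        using brownian_increment_mean(2)[OF C \<tau>(1) less_imp_le[OF \<tau>(3)] m i]
        by (simp add: \<gamma>_def mult.assoc)
    next
      case False
      with that have "q < p" by simp
      then have le: "\<tau> (Suc q) \<le> \<tau> p" using \<tau>_mono by simp
      have [measurable]: "\<gamma> q \<in> borel_measurable (F (\<tau> p))"
        using le \<tau>(1,3)[of q] \<tau>(1)[of "Suc q"] unfolding \<gamma>_def by (intro borel_measurable_diff Bm) auto
      have [measurable]: "\<xi> \<in> borel_measurable (F (\<tau> p))"
        by (rule measurable_filtration_mono[OF st(1) _ \<xi>(1)]) (rule \<tau>)
      have m: "(\<lambda>\<omega>. \<xi> \<omega> * complex_of_real (\<gamma> q \<omega>)) \<in> borel_measurable (F (\<tau> p))" by measurable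
      have i: "integrable M (\<lambda>\<omega>. \<xi> \<omega> * complex_of_real (\<gamma> q \<omega>))"
        by (rule integrable_bounded_mult[OF integrable_of_real \<xi>M \<xi>(2)])
          (use brownian_increment(2)[OF C \<tau>(1) \<tau>(3)] in \<open>simp_all add: \<gamma>_def\<close>)
      show ?thesis
        using brownian_increment_mean(2)[OF B \<tau>(1) less_imp_le[OF \<tau>(3)] m i]
        by (simp add: \<beta>_def mult_ac)
    qed
    define R where "R \<omega> = (\<Sum>p<n. \<beta> p \<omega> * \<gamma> p \<omega>)" for \<omega>
    have "(\<integral>\<omega>. \<xi> \<omega> * complex_of_real ((B t \<omega> - B s \<omega>) * (C t \<omega> - C s \<omega>)) \<partial>M)
        = (\<integral>\<omega>. (\<Sum>p<n. \<Sum>q<n. \<xi> \<omega> * complex_of_real (\<beta> p \<omega> * \<gamma> q \<omega>)) \<partial>M)"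
      unfolding dB dC sum_product by (simp add: sum_distrib_left)
    also have "\<dots> = (\<Sum>p<n. \<Sum>q<n. \<integral>\<omega>. \<xi> \<omega> * complex_of_real (\<beta> p \<omega> * \<gamma> q \<omega>) \<partial>M)"
      by (simp only: Bochner_Integration.integral_sum Bochner_Integration.integrable_sum ix)
    also have "\<dots> = (\<Sum>p<n. \<integral>\<omega>. \<xi> \<omega> * complex_of_real (\<beta> p \<omega> * \<gamma> p \<omega>) \<partial>M)"
    proof (rule sum.cong[OF refl])
      fix p assume p: "p \<in> {..<n}"
      have "(\<Sum>q<n. \<integral>\<omega>. \<xi> \<omega> * complex_of_real (\<beta> p \<omega> * \<gamma> q \<omega>) \<partial>M)
          = (\<Sum>q<n. if q = p then \<integral>\<omega>. \<xi> \<omega> * complex_of_real (\<beta> p \<omega> * \<gamma> p \<omega>) \<partial>M else 0)"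
        by (rule sum.cong[OF refl]) (metis off)
      then show "(\<Sum>q<n. \<integral>\<omega>. \<xi> \<omega> * complex_of_real (\<beta> p \<omega> * \<gamma> q \<omega>) \<partial>M)
          = (\<integral>\<omega>. \<xi> \<omega> * complex_of_real (\<beta> p \<omega> * \<gamma> p \<omega>) \<partial>M)"
        using p by (simp only: sum.delta finite_lessThan if_True)
    qed
    also have "\<dots> = (\<integral>\<omega>. \<xi> \<omega> * complex_of_real (R \<omega>) \<partial>M)"
      by (simp only: R_def of_real_sum sum_distrib_left Bochner_Integration.integral_sum ix)
    finally have eq: "J = norm (\<integral>\<omega>. \<xi> \<omega> * complex_of_real (R \<omega>) \<partial>M)" by (simp add: J_def)
    have iR: "integrable M R" unfolding R_def by (intro Bochner_Integration.integrable_sum ibg)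
    have mR [measurable]: "R \<in> borel_measurable M" using iR by auto
    \<comment> \<open>Here the mutual independence of the paths enters: the first product is a
      functional of the path of \<open>B\<close>, the second a functional of the path of
      \<open>C\<close>.\<close>
    have indf: "indep_var borel (\<lambda>\<omega>. \<beta> p \<omega> * \<beta> q \<omega>) borel (\<lambda>\<omega>. \<gamma> p \<omega> * \<gamma> q \<omega>)" for p q
    proof -
      define G where "G f = (f (\<tau> (Suc p)) - f (\<tau> p)) * (f (\<tau> (Suc q)) - f (\<tau> q))" for f :: "real \<Rightarrow> real"
      have G: "G \<in> borel_measurable (\<Pi>\<^sub>M t\<in>{0..}. borel)"
        unfolding G_def
        by (intro borel_measurable_times borel_measurable_diff measurable_component_singleton) (use \<tau> in auto)
      show ?thesis using indep_var_compose[OF ind G G] \<tau>(1)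
        by (simp add: comp_def G_def \<beta>_def \<gamma>_def)
    qed
    have vE: "(\<integral>\<omega>. \<beta> p \<omega> * \<beta> q \<omega> \<partial>M) = (if p = q then h else 0)" for p q
    proof -
      have "(\<integral>\<omega>. \<beta> p \<omega> * \<beta> q \<omega> \<partial>M) = 0" if "p < q" for p q
      proof -
        have le: "\<tau> (Suc p) \<le> \<tau> q" using \<tau>_mono that by simp
        have [measurable]: "\<beta> p \<in> borel_measurable (F (\<tau> q))"
          using le \<tau>(1,3)[of p] \<tau>(1)[of "Suc p"] unfolding \<beta>_def by (intro borel_measurable_diff Bm) auto
        have m: "(\<lambda>\<omega>. complex_of_real (\<beta> p \<omega>)) \<in> borel_measurable (F (\<tau> q))" by measurable
        have i: "integrable M (\<lambda>\<omega>. complex_of_real (\<beta> p \<omega>))"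
          by (rule integrable_of_real) (use brownian_increment(2)[OF B \<tau>(1) \<tau>(3)] in \<open>simp_all add: \<beta>_def\<close>)
        have "(\<integral>\<omega>. complex_of_real (\<beta> p \<omega> * \<beta> q \<omega>) \<partial>M) = 0"
          using brownian_increment_mean(2)[OF B \<tau>(1) less_imp_le[OF \<tau>(3)] m i]
          unfolding \<beta>_def by (simp only: of_real_mult)
        then show ?thesis by (simp only: integral_complex_of_real of_real_eq_0_iff)
      qed
      moreover have "(\<integral>\<omega>. \<beta> p \<omega> * \<beta> p \<omega> \<partial>M) = h" for p
        using brownian_increment(4)[OF B \<tau>(1) \<tau>(3), of p] unfolding \<beta>_def power2_eq_square
        by (simp add: \<tau>_def algebra_simps)
      moreover have "(\<integral>\<omega>. \<beta> p \<omega> * \<beta> q \<omega> \<partial>M) = (\<integral>\<omega>. \<beta> q \<omega> * \<beta> p \<omega> \<partial>M)"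
        by (rule arg_cong[where f = "integral\<^sup>L M"]) (auto simp: mult.commute)
      ultimately show ?thesis
        by (cases p q rule: linorder_cases) auto
    qed
    have vEg: "(\<integral>\<omega>. \<gamma> p \<omega> * \<gamma> p \<omega> \<partial>M) = h" for p
      using brownian_increment(4)[OF C \<tau>(1) \<tau>(3), of p] unfolding \<gamma>_def power2_eq_square
      by (simp add: \<tau>_def algebra_simps)
    have R2: "(R \<omega>)\<^sup>2 = (\<Sum>p<n. \<Sum>q<n. (\<beta> p \<omega> * \<beta> q \<omega>) * (\<gamma> p \<omega> * \<gamma> q \<omega>))" for \<omega>
      unfolding R_def power2_eq_square sum_product by (simp add: mult_ac)
    have i4: "integrable M (\<lambda>\<omega>. (\<beta> p \<omega> * \<beta> q \<omega>) * (\<gamma> p \<omega> * \<gamma> q \<omega>))" for p q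
      using indep_var_integrable[OF indf ibb igg] .
    have iR2: "integrable M (\<lambda>\<omega>. (R \<omega>)\<^sup>2)"
      unfolding R2 by (intro Bochner_Integration.integrable_sum i4)
    \<comment> \<open>Only the \<open>n\<close> terms with \<open>p = q\<close> survive, each equal
      to \<open>h * h\<close>; as \<open>h\<close> is \<open>(t - s) / n\<close>, one factor 1/n
      remains.\<close>
    have "(\<integral>\<omega>. (R \<omega>)\<^sup>2 \<partial>M) = (\<Sum>p<n. \<Sum>q<n. (\<integral>\<omega>. \<beta> p \<omega> * \<beta> q \<omega> \<partial>M) * (\<integral>\<omega>. \<gamma> p \<omega> * \<gamma> q \<omega> \<partial>M))"
      unfolding R2 by (simp only: Bochner_Integration.integral_sum Bochner_Integration.integrable_sum i4 indep_var_lebesgue_integral[OF indf ibb igg])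
    also have "\<dots> = (\<Sum>p<n. \<Sum>q<n. if p = q then h * h else 0)"
      by (intro sum.cong refl) (simp add: vE vEg)
    also have "\<dots> = (t - s)\<^sup>2 / real n"
      using n by (simp add: h_def power2_eq_square field_simps)
    finally have ER2: "(\<integral>\<omega>. (R \<omega>)\<^sup>2 \<partial>M) = (t - s)\<^sup>2 / real n" .
    define Y where "Y \<omega> = K * \<bar>R \<omega>\<bar>" for \<omega>
    have iY: "integrable M Y" unfolding Y_def using iR by auto
    have iY2: "integrable M (\<lambda>\<omega>. (Y \<omega>)\<^sup>2)" unfolding Y_def power_mult_distrib power2_abs using iR2 by auto
    have K: "K \<ge> 0" using \<xi>(2) not_empty norm_ge_zero order_trans by blast
    have "J \<le> (\<integral>\<omega>. norm (\<xi> \<omega> * complex_of_real (R \<omega>)) \<partial>M)"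
      unfolding eq by (rule integral_norm_bound)
    also have "\<dots> \<le> (\<integral>\<omega>. Y \<omega> \<partial>M)"
    proof (rule integral_mono[OF _ iY])
      show "integrable M (\<lambda>\<omega>. norm (\<xi> \<omega> * complex_of_real (R \<omega>)))"
        by (intro integrable_norm integrable_bounded_mult[OF integrable_of_real[OF iR] \<xi>M \<xi>(2)])
      show "norm (\<xi> \<omega> * complex_of_real (R \<omega>)) \<le> Y \<omega>" if "\<omega> \<in> space M" for \<omega>
        using \<xi>(2)[OF that] by (auto simp: Y_def norm_mult intro!: mult_right_mono)
    qed
    finally have "J\<^sup>2 \<le> (\<integral>\<omega>. Y \<omega> \<partial>M)\<^sup>2" by (intro power_mono) (auto simp: J_def)
    \<comment> \<open>Jensen's inequality, read off from the nonnegativity of the variance.\<close>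
    also have "\<dots> \<le> (\<integral>\<omega>. (Y \<omega>)\<^sup>2 \<partial>M)"
      using variance_eq[OF iY iY2] variance_positive[of Y] by linarith
    also have "\<dots> = K\<^sup>2 * ((t - s)\<^sup>2 / real n)"
      unfolding Y_def power_mult_distrib power2_abs using ER2 by simp
    finally show ?thesis .
  qed
  have "(\<lambda>n. K\<^sup>2 * ((t - s)\<^sup>2 / real n)) \<longlonglongrightarrow> K\<^sup>2 * 0"
    by (intro tendsto_mult_left lim_const_over_n)
  then have "J\<^sup>2 \<le> K\<^sup>2 * 0"
    by (rule LIMSEQ_le_const) (use bound in \<open>auto intro!: exI[of _ 1]\<close>)
  then show ?thesis by (simp add: J_def)
qed auto

end

section \<open>Covariation of noise increments\<close>

lemma (in prob_space) indep_var_of_indep_vars: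
  assumes "indep_vars (\<lambda>_. N) X I" "x \<noteq> y" "x \<in> I" "y \<in> I"
  shows "indep_var N (X x) N (X y)"
proof -
  have "indep_var (PiM {x} (\<lambda>_. N)) (\<lambda>\<omega>. restrict (\<lambda>i. X i \<omega>) {x}) (PiM {y} (\<lambda>_. N)) (\<lambda>\<omega>. restrict (\<lambda>i. X i \<omega>) {y})"
    by (rule indep_var_restrict[OF assms(1)]) (use assms in auto)
  from indep_var_compose[OF this measurable_component_singleton[of x] measurable_component_singleton[of y]]
  show ?thesis by (simp add: comp_def)
qed

context filtered_prob_space
begin

text \<open>These are the properties of a single noise component on which the Ito theory below
  rests. The multiplier in the last clause is allowed to be unbounded, because it will be a bounded
  coefficient times an earlier increment or times a square integrable past variable.\<close>

definition martingale_noise :: "(real \<Rightarrow> 'w \<Rightarrow> complex) \<Rightarrow> bool" where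
  "martingale_noise W \<longleftrightarrow>
     (\<forall>t\<ge>0. W t \<in> borel_measurable (F t)) \<and>
     (\<forall>s t. 0 \<le> s \<longrightarrow> s \<le> t \<longrightarrow> csquare_integrable M (\<lambda>\<omega>. W t \<omega> - W s \<omega>)) \<and>
     (\<forall>s t \<xi>. 0 \<le> s \<longrightarrow> s \<le> t \<longrightarrow> \<xi> \<in> borel_measurable (F s) \<longrightarrow> integrable M \<xi> \<longrightarrow>
        integrable M (\<lambda>\<omega>. \<xi> \<omega> * (W t \<omega> - W s \<omega>)) \<and> (\<integral>\<omega>. \<xi> \<omega> * (W t \<omega> - W s \<omega>) \<partial>M) = 0)"

text \<open>The Hermitian bracket: the second increment is conjugated, which turns the bilinear
  rule, nonzero for \<open>k = - l\<close>, into orthogonality of distinct components.\<close>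

definition covariation_rate ::
  "(real \<Rightarrow> 'w \<Rightarrow> complex) \<Rightarrow> (real \<Rightarrow> 'w \<Rightarrow> complex) \<Rightarrow> complex \<Rightarrow> bool" where
  "covariation_rate W V K \<longleftrightarrow>
     (\<forall>s t \<xi>. 0 \<le> s \<longrightarrow> s \<le> t \<longrightarrow> \<xi> \<in> borel_measurable (F s) \<longrightarrow> bounded (\<xi> ` space M) \<longrightarrow>
        (\<integral>\<omega>. \<xi> \<omega> * ((W t \<omega> - W s \<omega>) * cnj (V t \<omega> - V s \<omega>)) \<partial>M) = K * (t - s) * (\<integral>\<omega>. \<xi> \<omega> \<partial>M))"

lemma integrable_bounded:
  fixes \<xi> :: "'w \<Rightarrow> complex"
  assumes "\<xi> \<in> borel_measurable M" "bounded (\<xi> ` space M)"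
  shows "integrable M \<xi>"
proof -
  obtain K where "\<And>\<omega>. \<omega> \<in> space M \<Longrightarrow> norm (\<xi> \<omega>) \<le> K"
    using assms(2) by (auto simp: bounded_iff)
  then show ?thesis
    using integrable_bounded_mult[of M "\<lambda>_. 1" \<xi> K] assms(1) by simp
qed

lemma csquare_integrable_brownian_increment:
  assumes "brownian_motion M F B" "0 \<le> s" "s \<le> t"
  shows "csquare_integrable M (\<lambda>\<omega>. complex_of_real (B t \<omega> - B s \<omega>))"
proof -
  have "square_integrable M (\<lambda>\<omega>. B t \<omega> - B s \<omega>)"
    using brownian_increment(1)[OF assms(1), of s t] assms(2,3) square_integrable_zero[of M]
    by (cases "s = t") auto
  then show ?thesis
    using measurable_compose[OF _ borel_measurable_of_real]
    by (auto simp: csquare_integrable_def square_integrable_def simp del: of_real_diff)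
qed

text \<open>The sign \<open>\<sigma>\<close> will be 1 for an index in \<open>\<Lambda>\<close> and
  -1 for its negative, so that a component and its conjugate are treated together.\<close>

lemma martingale_noise_complex_brownian:
  fixes B C :: "real \<Rightarrow> 'w \<Rightarrow> real"
  assumes B: "brownian_motion M F B" and C: "brownian_motion M F C"
  shows "martingale_noise (\<lambda>t \<omega>. Complex (B t \<omega>) (\<sigma> * C t \<omega>))"
proof -
  have d: "Complex (B t \<omega>) (\<sigma> * C t \<omega>) - Complex (B s \<omega>) (\<sigma> * C s \<omega>)
    = complex_of_real (B t \<omega> - B s \<omega>) + (\<i> * \<sigma>) * complex_of_real (C t \<omega> - C s \<omega>)" for s t \<omega>
    by (simp add: complex_eq_iff algebra_simps)
  have e: "Complex (B t \<omega>) (\<sigma> * C t \<omega>)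
    = complex_of_real (B t \<omega>) + (\<i> * \<sigma>) * complex_of_real (C t \<omega>)" for t \<omega>
    by (simp add: complex_eq_iff algebra_simps)
  show ?thesis
    unfolding martingale_noise_def d
  proof (intro conjI allI impI)
    fix t :: real assume "0 \<le> t"
    then have [measurable]: "B t \<in> borel_measurable (F t)" "C t \<in> borel_measurable (F t)"
      using B C by (auto simp: brownian_motion_def)
    show "(\<lambda>\<omega>. Complex (B t \<omega>) (\<sigma> * C t \<omega>)) \<in> borel_measurable (F t)"
      unfolding e by measurable
  next
    fix s t :: real assume "0 \<le> s" "s \<le> t"
    then show "csquare_integrable M
        (\<lambda>\<omega>. complex_of_real (B t \<omega> - B s \<omega>) + (\<i> * \<sigma>) * complex_of_real (C t \<omega> - C s \<omega>))"
      by (intro csquare_integrable_add csquare_integrable_scale csquare_integrable_brownian_increment B C)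
  next
    fix s t :: real and \<xi> :: "'w \<Rightarrow> complex"
    assume st: "0 \<le> s" "s \<le> t" and \<xi>: "\<xi> \<in> borel_measurable (F s)" "integrable M \<xi>"
    note b = brownian_increment_mean[OF B st \<xi>] and c = brownian_increment_mean[OF C st \<xi>]
    have eq: "\<xi> \<omega> * (complex_of_real (B t \<omega> - B s \<omega>) + (\<i> * \<sigma>) * complex_of_real (C t \<omega> - C s \<omega>))
      = \<xi> \<omega> * complex_of_real (B t \<omega> - B s \<omega>) + (\<i> * \<sigma>) * (\<xi> \<omega> * complex_of_real (C t \<omega> - C s \<omega>))" for \<omega>
      by (simp add: algebra_simps)
    have c': "integrable M (\<lambda>\<omega>. (\<i> * \<sigma>) * (\<xi> \<omega> * complex_of_real (C t \<omega> - C s \<omega>)))"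
      by (rule integrable_mult_right) (rule c)
    show "integrable M (\<lambda>\<omega>. \<xi> \<omega> * (complex_of_real (B t \<omega> - B s \<omega>) + (\<i> * \<sigma>) * complex_of_real (C t \<omega> - C s \<omega>)))"
      unfolding eq by (rule Bochner_Integration.integrable_add[OF b(1) c'])
    show "(\<integral>\<omega>. \<xi> \<omega> * (complex_of_real (B t \<omega> - B s \<omega>) + (\<i> * \<sigma>) * complex_of_real (C t \<omega> - C s \<omega>)) \<partial>M) = 0"
      unfolding eq Bochner_Integration.integral_add[OF b(1) c'] using b(2) c(2)
      by (simp only: integral_mult_right_zero mult_zero_right add_0)
  qed
qed

text \<open>The product of the increments splits into four real products. Each contributes a
  Kronecker symbol times the elapsed time, by \<open>brownian_increment_square\<close> on the
  diagonal and by \<open>brownian_increment_cross\<close> off it. The terms with \<i> record a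
  possible coincidence of a real part with an imaginary part.\<close>

lemma covariation_rate_complex_brownian:
  assumes BM: "\<And>i. i \<in> I \<Longrightarrow> brownian_motion M F (X i)"
    and ind: "independent_processes M X I"
    and pq: "p \<in> I" "q \<in> I" "p' \<in> I" "q' \<in> I"
  shows "covariation_rate (\<lambda>t \<omega>. Complex (X p t \<omega>) (\<sigma> * X q t \<omega>)) (\<lambda>t \<omega>. Complex (X p' t \<omega>) (\<sigma>' * X q' t \<omega>))
    (of_bool (p = p') + complex_of_real (\<sigma> * \<sigma>') * of_bool (q = q')
      + \<i> * (complex_of_real \<sigma> * of_bool (q = p') - complex_of_real \<sigma>' * of_bool (p = q')))"
  unfolding covariation_rate_def
proof (intro allI impI)
  fix s t :: real and \<xi> :: "'w \<Rightarrow> complex"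
  assume st: "0 \<le> s" "s \<le> t" and \<xi>: "\<xi> \<in> borel_measurable (F s)" and bd: "bounded (\<xi> ` space M)"
  obtain K where K: "\<And>\<omega>. \<omega> \<in> space M \<Longrightarrow> norm (\<xi> \<omega>) \<le> K"
    using bd by (auto simp: bounded_iff)
  have \<xi>M: "\<xi> \<in> borel_measurable M" using measurable_filtration[OF st(1) \<xi>] .
  define e where "e x y = (\<integral>\<omega>. \<xi> \<omega> * complex_of_real ((X x t \<omega> - X x s \<omega>) * (X y t \<omega> - X y s \<omega>)) \<partial>M)" for x y
  have i: "integrable M (\<lambda>\<omega>. \<xi> \<omega> * complex_of_real ((X x t \<omega> - X x s \<omega>) * (X y t \<omega> - X y s \<omega>)))"
    if "x \<in> I" "y \<in> I" for x y
    by (rule integrable_bounded_mult[OF integrable_of_real \<xi>M K])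
      (use brownian_increment_integrable_mult[OF BM BM st st] that in auto)
  have e: "e x y = of_bool (x = y) * (t - s) * (\<integral>\<omega>. \<xi> \<omega> \<partial>M)" if xy: "x \<in> I" "y \<in> I" for x y
  proof (cases "x = y")
    case True
    then show ?thesis using brownian_increment_square[OF BM[OF xy(1)] st \<xi> integrable_bounded[OF \<xi>M bd]]
      by (simp add: e_def)
  next
    case False
    have "indep_vars (\<lambda>_. \<Pi>\<^sub>M t\<in>{0..}. borel) (\<lambda>i \<omega>. \<lambda>t\<in>{0..}. X i t \<omega>) I"
      using ind by (simp add: independent_processes_def)
    note indep_var_of_indep_vars[OF this False xy]
    from brownian_increment_cross[OF BM[OF xy(1)] BM[OF xy(2)] this st \<xi> K]
    show ?thesis using False by (simp add: e_def)
  qed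
  define D where "D x \<omega> = X x t \<omega> - X x s \<omega>" for x \<omega>
  define f where "f x y \<omega> = \<xi> \<omega> * complex_of_real (D x \<omega> * D y \<omega>)" for x y \<omega>
  have fi: "integrable M (f x y)" and fe: "integral\<^sup>L M (f x y) = e x y" if "x \<in> I" "y \<in> I" for x y
    using i[OF that] unfolding f_def[abs_def] D_def e_def by (simp_all only:)
  have "\<xi> \<omega> * ((Complex (X p t \<omega>) (\<sigma> * X q t \<omega>) - Complex (X p s \<omega>) (\<sigma> * X q s \<omega>)) *
         cnj (Complex (X p' t \<omega>) (\<sigma>' * X q' t \<omega>) - Complex (X p' s \<omega>) (\<sigma>' * X q' s \<omega>)))
     = f p p' \<omega> + \<sigma> * \<sigma>' * f q q' \<omega> + (\<i> * \<sigma> * f q p' \<omega> - \<i> * \<sigma>' * f p q' \<omega>)" for \<omega>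
  proof -
    have 1: "Complex (X p t \<omega>) (\<sigma> * X q t \<omega>) - Complex (X p s \<omega>) (\<sigma> * X q s \<omega>)
        = complex_of_real (D p \<omega>) + \<i> * \<sigma> * complex_of_real (D q \<omega>)"
      by (simp add: complex_eq_iff algebra_simps D_def)
    have 2: "cnj (Complex (X p' t \<omega>) (\<sigma>' * X q' t \<omega>) - Complex (X p' s \<omega>) (\<sigma>' * X q' s \<omega>))
        = complex_of_real (D p' \<omega>) - \<i> * \<sigma>' * complex_of_real (D q' \<omega>)"
      by (simp add: complex_eq_iff algebra_simps D_def)
    have 3: "x * ((a + \<i> * u * b) * (a' - \<i> * v * b')) 
      = x * (a * a') + u * v * (x * (b * b')) + (\<i> * u * (x * (b * a')) - \<i> * v * (x * (a * b')))"
      for x a b u a' b' v :: complex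
    proof -
      have "\<i> * \<i> = -1" by simp
      then show ?thesis by (simp add: algebra_simps)
    qed
    show ?thesis unfolding 1 2 f_def of_real_mult by (rule 3)
  qed
  then have "(\<integral>\<omega>. \<xi> \<omega> * ((Complex (X p t \<omega>) (\<sigma> * X q t \<omega>) - Complex (X p s \<omega>) (\<sigma> * X q s \<omega>)) *
         cnj (Complex (X p' t \<omega>) (\<sigma>' * X q' t \<omega>) - Complex (X p' s \<omega>) (\<sigma>' * X q' s \<omega>))) \<partial>M)
     = (\<integral>\<omega>. f p p' \<omega> + \<sigma> * \<sigma>' * f q q' \<omega> + (\<i> * \<sigma> * f q p' \<omega> - \<i> * \<sigma>' * f p q' \<omega>) \<partial>M)"
    by (simp only:)
  also have "\<dots> = e p p' + \<sigma> * \<sigma>' * e q q' + (\<i> * \<sigma> * e q p' - \<i> * \<sigma>' * e p q')"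
    using pq by (simp only: Bochner_Integration.integral_add Bochner_Integration.integral_diff
      Bochner_Integration.integrable_add Bochner_Integration.integrable_diff
      integrable_mult_right fi integral_mult_right_zero fe simp_thms)
  also have "\<dots> = (of_bool (p = p') + complex_of_real (\<sigma> * \<sigma>') * of_bool (q = q')
      + \<i> * (complex_of_real \<sigma> * of_bool (q = p') - complex_of_real \<sigma>' * of_bool (p = q')))
      * complex_of_real (t - s) * (\<integral>\<omega>. \<xi> \<omega> \<partial>M)"
    unfolding e[OF pq(1,3)] e[OF pq(2,4)] e[OF pq(2,3)] e[OF pq(1,4)] by (simp add: algebra_simps)
  finally show "(\<integral>\<omega>. \<xi> \<omega> * ((Complex (X p t \<omega>) (\<sigma> * X q t \<omega>) - Complex (X p s \<omega>) (\<sigma> * X q s \<omega>)) *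
         cnj (Complex (X p' t \<omega>) (\<sigma>' * X q' t \<omega>) - Complex (X p' s \<omega>) (\<sigma>' * X q' s \<omega>))) \<partial>M)
    = (of_bool (p = p') + complex_of_real (\<sigma> * \<sigma>') * of_bool (q = q')
      + \<i> * (complex_of_real \<sigma> * of_bool (q = p') - complex_of_real \<sigma>' * of_bool (p = q')))
      * complex_of_real (t - s) * (\<integral>\<omega>. \<xi> \<omega> \<partial>M)" .
qed

text \<open>Both intervals are cut at the ends \<open>p\<close> and \<open>q\<close> of their
  overlap. A later piece is orthogonal to an earlier one by the martingale property, so only the
  common piece contributes, at rate \<open>K\<close>.\<close>

lemma l2_inner_increments:
  assumes W: "martingale_noise W" and V: "martingale_noise V" and K: "covariation_rate W V K"
    and ab: "0 \<le> a" "a \<le> b" and cd: "0 \<le> c" "c \<le> d"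
    and \<xi>: "\<xi> \<in> borel_measurable (F a)" "bounded (\<xi> ` space M)"
    and \<eta>: "\<eta> \<in> borel_measurable (F c)" "bounded (\<eta> ` space M)"
  shows "l2_inner M (\<lambda>\<omega>. \<xi> \<omega> * (W b \<omega> - W a \<omega>)) (\<lambda>\<omega>. \<eta> \<omega> * (V d \<omega> - V c \<omega>))
    = K * max 0 (min b d - max a c) * l2_inner M \<xi> \<eta>"
proof -
  define f g where "f x y \<omega> = \<xi> \<omega> * (W y \<omega> - W x \<omega>)" and "g x y \<omega> = \<eta> \<omega> * (V y \<omega> - V x \<omega>)" for x y \<omega>
  obtain k1 k2 where k: "\<And>\<omega>. \<omega> \<in> space M \<Longrightarrow> norm (\<xi> \<omega>) \<le> k1" "\<And>\<omega>. \<omega> \<in> space M \<Longrightarrow> norm (\<eta> \<omega>) \<le> k2"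
    using \<xi>(2) \<eta>(2) unfolding bounded_iff by auto
  have \<xi>m: "\<xi> \<in> borel_measurable (F x)" if "a \<le> x" for x
    using measurable_filtration_mono[OF ab(1) that \<xi>(1)] .
  have \<eta>m: "\<eta> \<in> borel_measurable (F x)" if "c \<le> x" for x
    using measurable_filtration_mono[OF cd(1) that \<eta>(1)] .
  have Wm: "W x \<in> borel_measurable (F y)" and Vm: "V x \<in> borel_measurable (F y)" if "0 \<le> x" "x \<le> y" for x y
    using W V measurable_filtration_mono[OF that] that(1) by (auto simp: martingale_noise_def)
  have f2: "csquare_integrable M (f x y)" if "a \<le> x" "x \<le> y" for x y
    unfolding f_def using W that ab measurable_filtration[OF ab(1) \<xi>(1)]
    by (intro csquare_integrable_bounded_mult[OF _ _ k(1)]) (auto simp: martingale_noise_def)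
  have g2: "csquare_integrable M (g x y)" if "c \<le> x" "x \<le> y" for x y
    unfolding g_def using V that cd measurable_filtration[OF cd(1) \<eta>(1)]
    by (intro csquare_integrable_bounded_mult[OF _ _ k(2)]) (auto simp: martingale_noise_def)
  have fm: "f x y \<in> borel_measurable (F z)" if "a \<le> x" "x \<le> y" "y \<le> z" for x y z
    unfolding f_def using that ab by (intro borel_measurable_times borel_measurable_diff \<xi>m Wm) auto
  have gm: "g x y \<in> borel_measurable (F z)" if "c \<le> x" "x \<le> y" "y \<le> z" for x y z
    unfolding g_def using that cd by (intro borel_measurable_times borel_measurable_diff \<eta>m Vm) auto
  have \<xi>2: "csquare_integrable M \<xi>" and \<eta>2: "csquare_integrable M \<eta>"
    using csquare_integrable_bounded_mult[OF csquare_integrable_const[of 1] _ k(1)]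
      csquare_integrable_bounded_mult[OF csquare_integrable_const[of 1] _ k(2)]
      measurable_filtration[OF ab(1) \<xi>(1)] measurable_filtration[OF cd(1) \<eta>(1)] by auto
  \<comment> \<open>The earlier increment and both coefficients form an integrable variable known at
    time \<open>z\<close>, hence orthogonal to the increment of \<open>V\<close> from
    \<open>z\<close> on.\<close>
  have past: "l2_inner M (f x y) (g z w) = 0" if "a \<le> x" "x \<le> y" "y \<le> z" "c \<le> z" "z \<le> w" for x y z w
  proof -
    have z: "0 \<le> z" using that cd by simp
    have m: "(\<lambda>\<omega>. cnj (f x y \<omega>) * \<eta> \<omega>) \<in> borel_measurable (F z)"
      by (intro borel_measurable_times \<eta>m that(4) borel_measurable_continuous_on[OF _ fm] 
          continuous_intros that(1,2,3))
    have i: "integrable M (\<lambda>\<omega>. cnj (f x y \<omega>) * \<eta> \<omega>)"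
      using csquare_integrable_mult[OF csquare_integrable_cnj[OF f2[OF that(1,2)]] \<eta>2] .
    have "(\<integral>\<omega>. (cnj (f x y \<omega>) * \<eta> \<omega>) * (V w \<omega> - V z \<omega>) \<partial>M) = 0"
      using V z that(5) m i unfolding martingale_noise_def by blast
    then have "l2_inner M (g z w) (f x y) = 0"
      unfolding l2_inner_def g_def by (simp add: mult_ac)
    then show ?thesis by (subst l2_inner_commute) simp
  qed
  have past': "l2_inner M (f x y) (g z w) = 0" if "c \<le> z" "z \<le> w" "w \<le> x" "a \<le> x" "x \<le> y" for x y z w
  proof -
    have x: "0 \<le> x" using that ab by simp
    have m: "(\<lambda>\<omega>. cnj (g z w \<omega>) * \<xi> \<omega>) \<in> borel_measurable (F x)"
      by (intro borel_measurable_times \<xi>m that(4) borel_measurable_continuous_on[OF _ gm]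
          continuous_intros that(1,2,3))
    have i: "integrable M (\<lambda>\<omega>. cnj (g z w \<omega>) * \<xi> \<omega>)"
      using csquare_integrable_mult[OF csquare_integrable_cnj[OF g2[OF that(1,2)]] \<xi>2] .
    have "(\<integral>\<omega>. (cnj (g z w \<omega>) * \<xi> \<omega>) * (W y \<omega> - W x \<omega>) \<partial>M) = 0"
      using W x that(5) m i unfolding martingale_noise_def by blast
    then show ?thesis
      unfolding l2_inner_def f_def by (simp add: mult_ac)
  qed
  have same: "l2_inner M (f x y) (g x y) = K * (y - x) * l2_inner M \<xi> \<eta>" if "a \<le> x" "c \<le> x" "x \<le> y" for x y
  proof -
    have x: "0 \<le> x" using that ab by simp
    have m: "(\<lambda>\<omega>. \<xi> \<omega> * cnj (\<eta> \<omega>)) \<in> borel_measurable (F x)"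
      by (intro borel_measurable_times \<xi>m that borel_measurable_continuous_on[OF _ \<eta>m] continuous_intros)
    have b: "bounded ((\<lambda>\<omega>. \<xi> \<omega> * cnj (\<eta> \<omega>)) ` space M)"
      unfolding bounded_iff using k
      by (intro exI[of _ "k1 * k2"]) (auto simp: norm_mult intro!: mult_mono order_trans[OF norm_ge_zero])
    have "(\<integral>\<omega>. (\<xi> \<omega> * cnj (\<eta> \<omega>)) * ((W y \<omega> - W x \<omega>) * cnj (V y \<omega> - V x \<omega>)) \<partial>M)
        = K * (y - x) * (\<integral>\<omega>. \<xi> \<omega> * cnj (\<eta> \<omega>) \<partial>M)"
      using K x that(3) m b unfolding covariation_rate_def by blast
    then show ?thesis
      unfolding l2_inner_def f_def g_def by (simp add: mult_ac)
  qed
  have f_split: "f x z = (\<lambda>\<omega>. f x y \<omega> + f y z \<omega>)" and g_split: "g x z = (\<lambda>\<omega>. g x y \<omega> + g y z \<omega>)" for x y z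
    by (auto simp: f_def g_def algebra_simps)
  have f0: "f x x = (\<lambda>\<omega>. 0)" and g0: "g x x = (\<lambda>\<omega>. 0)" for x by (auto simp: f_def g_def)
  have z0: "l2_inner M (\<lambda>\<omega>. 0) h = 0" "l2_inner M h (\<lambda>\<omega>. 0) = 0" for h by (auto simp: l2_inner_def)
  have fg: "(\<lambda>\<omega>. \<xi> \<omega> * (W b \<omega> - W a \<omega>)) = f a b" "(\<lambda>\<omega>. \<eta> \<omega> * (V d \<omega> - V c \<omega>)) = g c d"
    by (auto simp: f_def g_def)
  define p q where "p = max a c" and "q = min b d"
  show ?thesis
  proof (cases "p \<le> q")
    case False
    then consider "b \<le> c" | "d \<le> a" using ab cd by (auto simp: p_def q_def max_def min_def split: if_splits)
    then have "l2_inner M (f a b) (g c d) = 0"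
      using past[of a b c d] past'[of c d a b] ab cd by cases auto
    moreover have "max 0 (q - p) = 0" using False by simp
    ultimately show ?thesis unfolding fg p_def q_def by (simp only: of_real_0 mult_zero_right mult_zero_left)
  next
    case True
    have le: "a \<le> p" "c \<le> p" "q \<le> b" "q \<le> d" by (auto simp: p_def q_def)
    have 1: "l2_inner M (f a b) h = l2_inner M (f a p) h + (l2_inner M (f p q) h + l2_inner M (f q b) h)"
      if "csquare_integrable M h" for h
      unfolding f_split[of a b p] f_split[of p b q] using le True that
      by (simp add: l2_inner_add_left f2 csquare_integrable_add)
    have 2: "l2_inner M h (g c d) = l2_inner M h (g c p) + (l2_inner M h (g p q) + l2_inner M h (g q d))"
      if "csquare_integrable M h" for h
      unfolding g_split[of c d p] g_split[of p d q] using le True that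
      by (simp add: l2_inner_add_right g2 csquare_integrable_add)
    \<comment> \<open>One of the two left overhangs is empty, since \<open>p\<close> is
      \<open>a\<close> or \<open>c\<close>; the next line uses the same for \<open>q\<close> on the
      right.\<close>
    have e1: "l2_inner M (f a p) (g c p) = 0" using f0 g0 z0 by (cases "a = p") (auto simp: p_def max_def)
    have e2: "l2_inner M (f q b) (g q d) = 0" using f0 g0 z0 by (cases "b = q") (auto simp: q_def min_def)
    have "l2_inner M (f a b) (g c d) = l2_inner M (f p q) (g p q)"
      using le True ab cd
      by (simp add: 1 2 f2 g2 e1 e2 past past')
    moreover have "max 0 (q - p) = q - p" using True by simp
    ultimately show ?thesis using same[of p q] le True unfolding fg p_def q_def by (simp only:)
  qed
qed

end

section \<open>The Ito isometry\<close>

context filtered_prob_space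
begin

text \<open>A single finite measure on time and probability: the right side of the Ito isometry
  becomes an \<open>l2_inner\<close> as well, and \<open>tendsto_l2_inner\<close> serves both
  sides.\<close>

definition time_space :: "real \<Rightarrow> (real \<times> 'w) measure" where
  "time_space t = restrict_space lborel {0..t} \<Otimes>\<^sub>M M"

lemma finite_measure_time: "finite_measure (restrict_space lborel {0..t::real})"
  by (rule finite_measureI) (auto simp: emeasure_restrict_space space_restrict_space emeasure_lborel_Icc_eq)

lemma finite_measure_time_space: "finite_measure (time_space t)"
  unfolding time_space_def
  by (rule finite_measure_pair_measure[OF finite_measure_axioms finite_measure_time])

lemma measurable_time_space:
  assumes "f \<in> measurable (restrict_space borel {0..t} \<Otimes>\<^sub>M F t) N" "0 \<le> t"
  shows "f \<in> measurable (time_space t) N"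
proof -
  have id: "id \<in> measurable M (F t)"
    using measurable_filtration[OF assms(2), of id "F t"] by (simp add: measurable_ident)
  have "(\<lambda>x. (fst x, id (snd x))) \<in> measurable (time_space t) (restrict_space borel {0..t} \<Otimes>\<^sub>M F t)"
    unfolding time_space_def
  proof (rule measurable_Pair)
    show "fst \<in> restrict_space lborel {0..t} \<Otimes>\<^sub>M M \<rightarrow>\<^sub>M restrict_space borel {0..t}"
    proof -
      have "sets (restrict_space lborel {0..t}) = sets (restrict_space borel {0..t})"
        by (simp add: sets_restrict_space)
      then show ?thesis using measurable_fst[of "restrict_space lborel {0..t}" M]
        by (simp cong: measurable_cong_sets)
    qed
    show "(\<lambda>x. id (snd x)) \<in> restrict_space lborel {0..t} \<Otimes>\<^sub>M M \<rightarrow>\<^sub>M F t"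
      using measurable_compose[OF measurable_snd id] .
  qed
  then have "(\<lambda>x. x) \<in> measurable (time_space t) (restrict_space borel {0..t} \<Otimes>\<^sub>M F t)" by simp
  from measurable_compose[OF this assms(1)] show ?thesis by simp
qed

lemma progressively_measurable_time_space:
  assumes "progressively_measurable F T H" "t \<in> {0..T}"
  shows "(\<lambda>(s, \<omega>). H s \<omega>) \<in> borel_measurable (time_space t)"
  by (rule measurable_time_space) (use assms in \<open>auto simp: progressively_measurable_def\<close>)

lemma progressively_measurable_adapted:
  assumes "progressively_measurable F T H" "t \<in> {0..T}"
  shows "H t \<in> borel_measurable (F t)"
proof -
  have "(\<lambda>\<omega>. (t, \<omega>)) \<in> measurable (F t) (restrict_space borel {0..t} \<Otimes>\<^sub>M F t)"
    using assms(2) by (intro measurable_Pair1') (simp add: space_restrict_space)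
  from measurable_compose[OF this, of "\<lambda>(s, \<omega>). H s \<omega>" borel] assms
  show ?thesis by (simp add: progressively_measurable_def)
qed

lemma nn_integral_time_space:
  assumes "f \<in> borel_measurable (time_space t)"
  shows "(\<integral>\<^sup>+x. f x \<partial>time_space t) = (\<integral>\<^sup>+s\<in>{0..t}. (\<integral>\<^sup>+\<omega>. f (s, \<omega>) \<partial>M) \<partial>lborel)"
  using nn_integral_fst[of f "restrict_space lborel {0..t}"] assms
  by (simp add: time_space_def nn_integral_restrict_space)

lemma nn_integral_time_space_le:
  fixes t T :: real
  assumes "0 \<le> t" "t \<le> T"
  shows "(\<integral>\<^sup>+s\<in>{0..t}. f s \<partial>lborel) \<le> (\<integral>\<^sup>+s\<in>{0..T}. f s \<partial>lborel)"
  using assms by (intro nn_integral_mono mult_left_mono) (auto simp: indicator_def dest: order_trans[of _ t T])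

lemma measurable_snd_time_space:
  "f \<in> measurable M N \<Longrightarrow> (\<lambda>x. f (snd x)) \<in> measurable (time_space t) N"
  unfolding time_space_def using measurable_compose[OF measurable_snd] .

lemma borel_measurable_indicator_fst_time_space:
  "A \<in> sets borel \<Longrightarrow> (\<lambda>x. indicator A (fst x) :: complex) \<in> borel_measurable (time_space t)"
  unfolding time_space_def
  by (rule measurable_compose[OF measurable_fst]) (auto intro!: measurable_restrict_space1)

lemma csquare_integrable_indicator_time_space:
  assumes "\<xi> \<in> borel_measurable M" "bounded (\<xi> ` space M)"
  shows "csquare_integrable (time_space t) (\<lambda>(s, \<omega>). indicator {a<..b} s * \<xi> \<omega>)"
proof -
  interpret ts: finite_measure "time_space t" by (rule finite_measure_time_space)
  obtain K where K: "\<And>\<omega>. \<omega> \<in> space M \<Longrightarrow> norm (\<xi> \<omega>) \<le> K"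
    using assms(2) by (auto simp: bounded_iff)
  have m: "(\<lambda>x. \<xi> (snd x) * indicator {a<..b} (fst x)) \<in> borel_measurable (time_space t)"
    by (intro borel_measurable_times measurable_snd_time_space assms(1) borel_measurable_indicator_fst_time_space) simp
  have b: "norm (\<xi> (snd x) * indicator {a<..b} (fst x)) \<le> K" if "x \<in> space (time_space t)" for x
  proof -
    have "snd x \<in> space M" using that by (auto simp: time_space_def space_pair_measure)
    from K[OF this] show ?thesis
      by (auto simp: indicator_def intro: order_trans[OF norm_ge_zero])
  qed
  from csquare_integrable_bounded_mult[OF ts.csquare_integrable_const[of 1] m b]
  show ?thesis by (simp add: split_beta' mult.commute)
qed

text \<open>The endpoints are truncated at \<open>t\<close> so that the overlap has literally the
  form that \<open>l2_inner_increments\<close> gives for increments stopped at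
  \<open>t\<close>.\<close>

lemma l2_inner_indicator_time_space:
  assumes t: "0 \<le> t" and ab: "0 \<le> a" "a \<le> b" and cd: "0 \<le> c" "c \<le> d"
    and \<xi>: "\<xi> \<in> borel_measurable M" "bounded (\<xi> ` space M)"
    and \<eta>: "\<eta> \<in> borel_measurable M" "bounded (\<eta> ` space M)"
  shows "l2_inner (time_space t) (\<lambda>(s, \<omega>). indicator {a<..b} s * \<xi> \<omega>) (\<lambda>(s, \<omega>). indicator {c<..d} s * \<eta> \<omega>)
    = complex_of_real (max 0 (min (min b t) (min d t) - max (min a t) (min c t))) * l2_inner M \<xi> \<eta>"
proof -
  interpret tm: finite_measure "restrict_space lborel {0..t}" by (rule finite_measure_time)
  interpret pair_sigma_finite "restrict_space lborel {0..t}" M ..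
  let ?h = "\<lambda>x. (case x of (s, \<omega>) \<Rightarrow> indicator {a<..b} s * \<xi> \<omega>) * cnj (case x of (s, \<omega>) \<Rightarrow> indicator {c<..d} s * \<eta> \<omega>)"
  let ?A = "{a<..b} \<inter> {c<..d}"
  define p q where "p = max (min a t) (min c t)" and "q = min (min b t) (min d t)"
  have i: "integrable (restrict_space lborel {0..t} \<Otimes>\<^sub>M M) ?h"
    using csquare_integrable_mult_cnj[OF csquare_integrable_indicator_time_space[OF \<xi>] csquare_integrable_indicator_time_space[OF \<eta>]]
    unfolding time_space_def .
  have "l2_inner (time_space t) (\<lambda>(s, \<omega>). indicator {a<..b} s * \<xi> \<omega>) (\<lambda>(s, \<omega>). indicator {c<..d} s * \<eta> \<omega>)
     = (\<integral>s. (\<integral>\<omega>. ?h (s, \<omega>) \<partial>M) \<partial>restrict_space lborel {0..t})"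
    unfolding l2_inner_def time_space_def using integral_fst'[OF i] by simp
  also have "\<dots> = (\<integral>s. indicat_real ?A s *\<^sub>R l2_inner M \<xi> \<eta> \<partial>restrict_space lborel {0..t})"
    by (rule arg_cong[where f = "integral\<^sup>L _"]) (auto simp: l2_inner_def indicator_def fun_eq_iff)
  also have "\<dots> = (\<integral>s. indicat_real {p<..q} s *\<^sub>R l2_inner M \<xi> \<eta> \<partial>lborel)"
  proof (subst integral_restrict_space)
    have "indicat_real {0..t} s *\<^sub>R indicat_real ?A s *\<^sub>R z = indicat_real {p<..q} s *\<^sub>R z" for s and z :: complex
      using ab cd t by (auto simp: indicator_def p_def q_def min_less_iff_disj)
    then show "(\<integral>s. indicat_real {0..t} s *\<^sub>R indicat_real ?A s *\<^sub>R l2_inner M \<xi> \<eta> \<partial>lborel)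
      = (\<integral>s. indicat_real {p<..q} s *\<^sub>R l2_inner M \<xi> \<eta> \<partial>lborel)" by (simp only:)
  qed simp
  also have "\<dots> = (\<integral>s. indicat_real {p<..q} s \<partial>lborel) *\<^sub>R l2_inner M \<xi> \<eta>"
    by (cases "p \<le> q") (auto intro!: integral_scaleR_left)
  also have "(\<integral>s. indicat_real {p<..q} s \<partial>lborel) = max 0 (q - p)"
    by (cases "p \<le> q") auto
  finally show ?thesis by (simp add: p_def q_def scaleR_conv_of_real)
qed

lemma elementary_dataD:
  assumes "elementary_data M F T n \<tau> \<xi>" "i < n"
  shows "0 \<le> \<tau> i" "\<tau> i \<le> \<tau> (Suc i)" "\<tau> (Suc i) \<le> T"
    "\<xi> i \<in> borel_measurable (F (\<tau> i))" "bounded (\<xi> i ` space M)" "\<xi> i \<in> borel_measurable M"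
proof -
  show 1: "0 \<le> \<tau> i" "\<tau> i \<le> \<tau> (Suc i)" "\<tau> (Suc i) \<le> T"
    "\<xi> i \<in> borel_measurable (F (\<tau> i))" "bounded (\<xi> i ` space M)"
    using assms unfolding elementary_data_def by (auto simp: Suc_le_eq)
  show "\<xi> i \<in> borel_measurable M" using measurable_filtration[OF 1(1,4)] .
qed

lemma csquare_integrable_bounded_increment:
  assumes "martingale_noise W" "0 \<le> s" "s \<le> t" "\<xi> \<in> borel_measurable M" "bounded (\<xi> ` space M)"
  shows "csquare_integrable M (\<lambda>\<omega>. \<xi> \<omega> * (W t \<omega> - W s \<omega>))"
proof -
  obtain K where K: "\<And>\<omega>. \<omega> \<in> space M \<Longrightarrow> norm (\<xi> \<omega>) \<le> K"
    using assms(5) by (auto simp: bounded_iff)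
  show ?thesis
    by (rule csquare_integrable_bounded_mult[OF _ assms(4) K])
      (use assms in \<open>auto simp: martingale_noise_def\<close>)
qed

lemma csquare_integrable_elementary_integrand:
  assumes "elementary_data M F T n \<tau> \<xi>"
  shows "csquare_integrable (time_space t) (\<lambda>(s, \<omega>). elementary_integrand n \<tau> \<xi> s \<omega>)"
proof -
  have "(\<lambda>(s, \<omega>). elementary_integrand n \<tau> \<xi> s \<omega>)
    = (\<lambda>x. \<Sum>i<n. (\<lambda>(s, \<omega>). indicator {\<tau> i<..\<tau> (Suc i)} s * \<xi> i \<omega>) x)"
    unfolding elementary_integrand_def by (simp only: split_beta')
  then show ?thesis
    by (simp only:) (intro csquare_integrable_sum csquare_integrable_indicator_time_space elementary_dataD[OF assms], auto)
qed

lemma csquare_integrable_elementary_integral: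
  assumes "martingale_noise W" "elementary_data M F T n \<tau> \<xi>" "0 \<le> t"
  shows "csquare_integrable M (elementary_integral n \<tau> \<xi> W t)"
  unfolding elementary_integral_def
proof (rule csquare_integrable_sum)
  fix i assume "i \<in> {..<n}"
  then have i: "i < n" by simp
  show "csquare_integrable M (\<lambda>\<omega>. \<xi> i \<omega> * (W (min (\<tau> (Suc i)) t) \<omega> - W (min (\<tau> i) t) \<omega>))"
    using elementary_dataD[OF assms(2) i] assms(3)
    by (intro csquare_integrable_bounded_increment assms(1)) (auto simp: min_def)
qed

lemma l2_inner_elementary_integral:
  assumes W: "martingale_noise W" and V: "martingale_noise V" and K: "covariation_rate W V K"
    and e: "elementary_data M F T n \<tau> \<xi>" and e': "elementary_data M F T n' \<tau>' \<xi>'" and t: "0 \<le> t"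
  shows "l2_inner M (elementary_integral n \<tau> \<xi> W t) (elementary_integral n' \<tau>' \<xi>' V t)
    = K * l2_inner (time_space t) (\<lambda>(s, \<omega>). elementary_integrand n \<tau> \<xi> s \<omega>)
        (\<lambda>(s, \<omega>). elementary_integrand n' \<tau>' \<xi>' s \<omega>)"
proof -
  note d = elementary_dataD[OF e] and d' = elementary_dataD[OF e']
  define f where "f i \<omega> = \<xi> i \<omega> * (W (min (\<tau> (Suc i)) t) \<omega> - W (min (\<tau> i) t) \<omega>)" for i \<omega>
  define g where "g i \<omega> = \<xi>' i \<omega> * (V (min (\<tau>' (Suc i)) t) \<omega> - V (min (\<tau>' i) t) \<omega>)" for i \<omega>
  define \<phi> where "\<phi> i = (\<lambda>(s, \<omega>). indicator {\<tau> i<..\<tau> (Suc i)} s * \<xi> i \<omega>)" for i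
  define \<psi> where "\<psi> i = (\<lambda>(s, \<omega>). indicator {\<tau>' i<..\<tau>' (Suc i)} s * \<xi>' i \<omega>)" for i
  have f2: "csquare_integrable M (f i)" if "i < n" for i
    unfolding f_def using d[OF that] t
    by (intro csquare_integrable_bounded_increment W) (auto simp: min_def)
  have g2: "csquare_integrable M (g i)" if "i < n'" for i
    unfolding g_def using d'[OF that] t
    by (intro csquare_integrable_bounded_increment V) (auto simp: min_def)
  have \<phi>2: "csquare_integrable (time_space t) (\<phi> i)" if "i < n" for i
    unfolding \<phi>_def by (intro csquare_integrable_indicator_time_space d that)
  have \<psi>2: "csquare_integrable (time_space t) (\<psi> i)" if "i < n'" for i
    unfolding \<psi>_def by (intro csquare_integrable_indicator_time_space d' that)
  have ee: "elementary_integral n \<tau> \<xi> W t = (\<lambda>\<omega>. \<Sum>i<n. f i \<omega>)"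
    "elementary_integral n' \<tau>' \<xi>' V t = (\<lambda>\<omega>. \<Sum>i<n'. g i \<omega>)"
    by (auto simp: elementary_integral_def f_def g_def fun_eq_iff)
  have ei: "(\<lambda>(s, \<omega>). elementary_integrand n \<tau> \<xi> s \<omega>) = (\<lambda>x. \<Sum>i<n. \<phi> i x)"
    "(\<lambda>(s, \<omega>). elementary_integrand n' \<tau>' \<xi>' s \<omega>) = (\<lambda>x. \<Sum>i<n'. \<psi> i x)"
    by (auto simp: elementary_integrand_def \<phi>_def \<psi>_def fun_eq_iff)
  have term_eq: "l2_inner M (f i) (g j) = K * l2_inner (time_space t) (\<phi> i) (\<psi> j)" if ij: "i < n" "j < n'" for i j
  proof -
    note di = d[OF ij(1)] and dj = d'[OF ij(2)]
    have r: "l2_inner (time_space t) (\<phi> i) (\<psi> j)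
      = max 0 (min (min (\<tau> (Suc i)) t) (min (\<tau>' (Suc j)) t) - max (min (\<tau> i) t) (min (\<tau>' j) t)) * l2_inner M (\<xi> i) (\<xi>' j)"
      unfolding \<phi>_def \<psi>_def by (rule l2_inner_indicator_time_space[OF t di(1,2) dj(1,2) di(6,5) dj(6,5)])
    \<comment> \<open>A coefficient of an interval starting after \<open>t\<close> need not be
      measurable at the truncated start \<open>t\<close>, so \<open>l2_inner_increments\<close> does
      not apply; in that case the stopped increment and the overlap are both 0.\<close>
    consider "\<tau> i > t" | "\<tau>' j > t" | "\<tau> i \<le> t" "\<tau>' j \<le> t" by linarith
    then show ?thesis
    proof cases
      case 1
      then have "f i = (\<lambda>\<omega>. 0)" using di by (auto simp: f_def fun_eq_iff min_def)
      moreover have "max 0 (min (min (\<tau> (Suc i)) t) (min (\<tau>' (Suc j)) t) - max (min (\<tau> i) t) (min (\<tau>' j) t)) = 0"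
        using 1 by auto
      ultimately show ?thesis unfolding r by (simp add: l2_inner_def)
    next
      case 2
      then have "g j = (\<lambda>\<omega>. 0)" using dj by (auto simp: g_def fun_eq_iff min_def)
      moreover have "max 0 (min (min (\<tau> (Suc i)) t) (min (\<tau>' (Suc j)) t) - max (min (\<tau> i) t) (min (\<tau>' j) t)) = 0"
        using 2 by auto
      ultimately show ?thesis unfolding r by (simp add: l2_inner_def)
    next
      case 3
      have \<xi>i: "\<xi> i \<in> borel_measurable (F (min (\<tau> i) t))" and \<xi>j: "\<xi>' j \<in> borel_measurable (F (min (\<tau>' j) t))"
        using di dj 3 by (auto simp: min_absorb1)
      have "l2_inner M (f i) (g j)
        = K * max 0 (min (min (\<tau> (Suc i)) t) (min (\<tau>' (Suc j)) t) - max (min (\<tau> i) t) (min (\<tau>' j) t)) * l2_inner M (\<xi> i) (\<xi>' j)"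
        unfolding f_def[abs_def] g_def[abs_def]
        by (rule l2_inner_increments[OF W V K _ _ _ _ \<xi>i di(5) \<xi>j dj(5)]) (use di dj t in auto)
      then show ?thesis unfolding r by (simp only: mult.assoc)
    qed
  qed
  have "l2_inner M (elementary_integral n \<tau> \<xi> W t) (elementary_integral n' \<tau>' \<xi>' V t)
    = (\<Sum>i<n. \<Sum>j<n'. l2_inner M (f i) (g j))"
    unfolding ee by (subst l2_inner_sum_left, auto intro: f2 csquare_integrable_sum g2)
      (intro sum.cong refl l2_inner_sum_right, auto intro: f2 g2)
  also have "\<dots> = (\<Sum>i<n. \<Sum>j<n'. K * l2_inner (time_space t) (\<phi> i) (\<psi> j))"
    by (intro sum.cong refl term_eq) auto
  also have "\<dots> = K * l2_inner (time_space t) (\<lambda>x. \<Sum>i<n. \<phi> i x) (\<lambda>x. \<Sum>i<n'. \<psi> i x)"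
    by (subst l2_inner_sum_left, auto intro: \<phi>2 csquare_integrable_sum \<psi>2 simp: sum_distrib_left)
      (intro sum.cong refl, subst l2_inner_sum_right, auto intro: \<phi>2 \<psi>2 simp: sum_distrib_left)
  finally show ?thesis unfolding ei .
qed

text \<open>Each summand at time \<open>t\<close> is its value at time \<open>s\<close> plus an
  increment of the noise after \<open>s\<close>, which is orthogonal to the past. This is the
  martingale property, phrased by test variables instead of conditional expectations.\<close>

lemma l2_inner_elementary_integral_past:
  assumes W: "martingale_noise W" and e: "elementary_data M F T n \<tau> \<xi>"
    and st: "0 \<le> s" "s \<le> t" and X: "X \<in> borel_measurable (F s)" "csquare_integrable M X"
  shows "l2_inner M (elementary_integral n \<tau> \<xi> W t) X = l2_inner M (elementary_integral n \<tau> \<xi> W s) X"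
proof -
  note d = elementary_dataD[OF e]
  define f where "f r i \<omega> = \<xi> i \<omega> * (W (min (\<tau> (Suc i)) r) \<omega> - W (min (\<tau> i) r) \<omega>)" for r i \<omega>
  have f2: "csquare_integrable M (f r i)" if "i < n" "0 \<le> r" for r i
    unfolding f_def using d[OF that(1)] that(2)
    by (intro csquare_integrable_bounded_increment W) (auto simp: min_def)
  have ee: "elementary_integral n \<tau> \<xi> W r = (\<lambda>\<omega>. \<Sum>i<n. f r i \<omega>)" for r
    by (auto simp: elementary_integral_def f_def fun_eq_iff)
  have "l2_inner M (f t i) X = l2_inner M (f s i) X" if i: "i < n" for i
  proof -
    note di = d[OF i]
    \<comment> \<open>\<open>\<phi>\<close> clamps a time to the interval from \<open>s\<close> to
      \<open>t\<close>; \<open>h\<close> is then the part of the summand gained after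
      \<open>s\<close>.\<close>
    define \<phi> where "\<phi> b = max s (min b t)" for b
    define h where "h \<omega> = \<xi> i \<omega> * (W (\<phi> (\<tau> (Suc i))) \<omega> - W (\<phi> (\<tau> i)) \<omega>)" for \<omega>
    have split: "f t i = (\<lambda>\<omega>. f s i \<omega> + h \<omega>)"
    proof
      fix \<omega>
      have e: "W (min b t) \<omega> = W (min b s) \<omega> + (W (\<phi> b) \<omega> - W s \<omega>)" for b
        using st by (auto simp: \<phi>_def min_def max_def)
      show "f t i \<omega> = f s i \<omega> + h \<omega>"
        unfolding f_def h_def e[of "\<tau> i"] e[of "\<tau> (Suc i)"] by (simp add: algebra_simps)
    qed
    have \<phi>: "0 \<le> \<phi> (\<tau> i)" "\<phi> (\<tau> i) \<le> \<phi> (\<tau> (Suc i))"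
      using st di(1,2) by (auto simp: \<phi>_def)
    have h2: "csquare_integrable M h"
      unfolding h_def by (rule csquare_integrable_bounded_increment[OF W \<phi> di(6,5)])
    have "l2_inner M h X = 0"
    \<comment> \<open>A coefficient revealed after \<open>t\<close> need not be measurable at the
      clamped time, but the clamped increment is then 0.\<close>
    proof (cases "\<tau> i \<le> t")
      case False
      then have "\<phi> (\<tau> (Suc i)) = \<phi> (\<tau> i)" using di(2) st by (auto simp: \<phi>_def min_def)
      then show ?thesis by (simp add: l2_inner_def h_def)
    next
      case True
      have le: "\<tau> i \<le> \<phi> (\<tau> i)" "s \<le> \<phi> (\<tau> i)" using True by (auto simp: \<phi>_def)
      have m: "(\<lambda>\<omega>. \<xi> i \<omega> * cnj (X \<omega>)) \<in> borel_measurable (F (\<phi> (\<tau> i)))"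
        by (intro borel_measurable_times measurable_filtration_mono[OF di(1) le(1) di(4)]
            borel_measurable_continuous_on[OF _ measurable_filtration_mono[OF st(1) le(2) X(1)]] continuous_intros)
      obtain B where B: "\<And>\<omega>. \<omega> \<in> space M \<Longrightarrow> norm (\<xi> i \<omega>) \<le> B"
        using di(5) by (auto simp: bounded_iff)
      have "csquare_integrable M (\<xi> i)"
        using csquare_integrable_bounded_mult[OF csquare_integrable_const[of 1] di(6) B] by simp
      then have "integrable M (\<lambda>\<omega>. \<xi> i \<omega> * cnj (X \<omega>))"
        using csquare_integrable_mult_cnj X(2) by blast
      with m \<phi> W have "(\<integral>\<omega>. (\<xi> i \<omega> * cnj (X \<omega>)) * (W (\<phi> (\<tau> (Suc i))) \<omega> - W (\<phi> (\<tau> i)) \<omega>) \<partial>M) = 0"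
        unfolding martingale_noise_def by blast
      then show ?thesis by (simp add: l2_inner_def h_def mult_ac)
    qed
    then show ?thesis
      unfolding split using l2_inner_add_left[OF f2[OF i st(1)] h2 X(2)] by simp
  qed
  moreover have "l2_inner M (\<lambda>\<omega>. \<Sum>i<n. f r i \<omega>) X = (\<Sum>i<n. l2_inner M (f r i) X)" if "0 \<le> r" for r
    using f2 that X(2) by (intro l2_inner_sum_left) auto
  ultimately show ?thesis
    unfolding ee using st by simp
qed

text \<open>The definition measures the error of the integrand up to the final time only. Shrinking
  the time interval decreases it, so one approximating sequence works on \<open>time_space t\<close>
  for every \<open>t\<close>.\<close>

lemma has_ito_integral_approx:
  assumes W: "martingale_noise W" and H: "has_ito_integral M F T W H I"
  shows "\<exists>n \<tau> \<xi>. (\<forall>m. elementary_data M F T (n m) (\<tau> m) (\<xi> m)) \<and>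
    (\<forall>t\<in>{0..T}. (\<lambda>m. l2_dist2 (time_space t) (\<lambda>(s, \<omega>). H s \<omega>)
       (\<lambda>(s, \<omega>). elementary_integrand (n m) (\<tau> m) (\<xi> m) s \<omega>)) \<longlonglongrightarrow> 0) \<and>
    (\<forall>t\<in>{0..T}. (\<lambda>m. l2_dist2 M (I t) (elementary_integral (n m) (\<tau> m) (\<xi> m) W t)) \<longlonglongrightarrow> 0)"
proof -
  from H obtain n \<tau> \<xi> where d: "\<And>m. elementary_data M F T (n m) (\<tau> m) (\<xi> m)"
    and l: "(\<lambda>m. \<integral>\<^sup>+s\<in>{0..T}. (\<integral>\<^sup>+\<omega>. ennreal ((norm (H s \<omega> -
            elementary_integrand (n m) (\<tau> m) (\<xi> m) s \<omega>))\<^sup>2) \<partial>M) \<partial>lborel) \<longlonglongrightarrow> 0"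
    and l2: "\<And>t. t \<in> {0..T} \<Longrightarrow> (\<lambda>m. l2_dist2 M (I t) (elementary_integral (n m) (\<tau> m) (\<xi> m) W t)) \<longlonglongrightarrow> 0"
    unfolding has_ito_integral_def by blast
  have p: "progressively_measurable F T H" using H by (simp add: has_ito_integral_def)
  have "(\<lambda>m. l2_dist2 (time_space t) (\<lambda>(s, \<omega>). H s \<omega>)
       (\<lambda>(s, \<omega>). elementary_integrand (n m) (\<tau> m) (\<xi> m) s \<omega>)) \<longlonglongrightarrow> 0" if t: "t \<in> {0..T}" for t
  proof (rule tendsto_sandwich[OF _ _ tendsto_const l])
    show "\<forall>\<^sub>F m in sequentially. l2_dist2 (time_space t) (\<lambda>(s, \<omega>). H s \<omega>)
       (\<lambda>(s, \<omega>). elementary_integrand (n m) (\<tau> m) (\<xi> m) s \<omega>)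
      \<le> (\<integral>\<^sup>+s\<in>{0..T}. (\<integral>\<^sup>+\<omega>. ennreal ((norm (H s \<omega> -
            elementary_integrand (n m) (\<tau> m) (\<xi> m) s \<omega>))\<^sup>2) \<partial>M) \<partial>lborel)"
    proof (rule always_eventually, rule allI)
      fix m
      let ?E = "\<lambda>(s, \<omega>). elementary_integrand (n m) (\<tau> m) (\<xi> m) s \<omega>"
      have "(\<lambda>x. (case x of (s, \<omega>) \<Rightarrow> H s \<omega>) - ?E x) \<in> borel_measurable (time_space t)"
        by (intro borel_measurable_diff progressively_measurable_time_space[OF p t]
            csquare_integrableD(1)[OF csquare_integrable_elementary_integrand[OF d]])
      then have "(\<lambda>x. ennreal ((norm ((case x of (s, \<omega>) \<Rightarrow> H s \<omega>) - ?E x))\<^sup>2)) \<in> borel_measurable (time_space t)"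
        by measurable
      from nn_integral_time_space[OF this] nn_integral_time_space_le[of t T] t
      show "l2_dist2 (time_space t) (\<lambda>(s, \<omega>). H s \<omega>) ?E
        \<le> (\<integral>\<^sup>+s\<in>{0..T}. (\<integral>\<^sup>+\<omega>. ennreal ((norm (H s \<omega> -
            elementary_integrand (n m) (\<tau> m) (\<xi> m) s \<omega>))\<^sup>2) \<partial>M) \<partial>lborel)"
        by simp
    qed
  qed auto
  with d l2 show ?thesis by blast
qed

lemma csquare_integrable_ito:
  assumes W: "martingale_noise W" and H: "has_ito_integral M F T W H I" and t: "t \<in> {0..T}"
  shows "csquare_integrable (time_space t) (\<lambda>(s, \<omega>). H s \<omega>)" and "csquare_integrable M (I t)"
proof -
  obtain n \<tau> \<xi> where a': "\<And>m. elementary_data M F T (n m) (\<tau> m) (\<xi> m)"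
    "\<And>t. t \<in> {0..T} \<Longrightarrow> (\<lambda>m. l2_dist2 (time_space t) (\<lambda>(s, \<omega>). H s \<omega>)
       (\<lambda>(s, \<omega>). elementary_integrand (n m) (\<tau> m) (\<xi> m) s \<omega>)) \<longlonglongrightarrow> 0"
    "\<And>t. t \<in> {0..T} \<Longrightarrow> (\<lambda>m. l2_dist2 M (I t) (elementary_integral (n m) (\<tau> m) (\<xi> m) W t)) \<longlonglongrightarrow> 0"
    using has_ito_integral_approx[OF W H] by blast
  note a = a'(1) a'(2,3)[OF t]
  have p: "progressively_measurable F T H" and Im: "I t \<in> borel_measurable (F t)"
    using H t by (auto simp: has_ito_integral_def)
  show "csquare_integrable (time_space t) (\<lambda>(s, \<omega>). H s \<omega>)"
    by (rule csquare_integrable_limit[OF progressively_measurable_time_space[OF p t] _ a(2)])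
      (auto intro!: always_eventually csquare_integrable_elementary_integrand[OF a(1)])
  show "csquare_integrable M (I t)"
    by (rule csquare_integrable_limit[OF measurable_filtration[OF _ Im] _ a(3)])
      (use t in \<open>auto intro!: always_eventually csquare_integrable_elementary_integral[OF W a(1)]\<close>)
qed

text \<open>Both sides are limits of the elementary identity, by continuity of the inner product.
  Two integrators and two integrands are kept, which gives orthogonality of distinct noise
  components and, by bilinearity, the norms of combinations.\<close>

lemma ito_isometry:
  assumes W: "martingale_noise W" and V: "martingale_noise V" and K: "covariation_rate W V K"
    and H: "has_ito_integral M F T W H I" and G: "has_ito_integral M F T V G J" and t: "t \<in> {0..T}"
  shows "l2_inner M (I t) (J t) = K * l2_inner (time_space t) (\<lambda>(s, \<omega>). H s \<omega>) (\<lambda>(s, \<omega>). G s \<omega>)"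
proof -
  obtain n \<tau> \<xi> where a': "\<And>m. elementary_data M F T (n m) (\<tau> m) (\<xi> m)"
    "\<And>t. t \<in> {0..T} \<Longrightarrow> (\<lambda>m. l2_dist2 (time_space t) (\<lambda>(s, \<omega>). H s \<omega>)
       (\<lambda>(s, \<omega>). elementary_integrand (n m) (\<tau> m) (\<xi> m) s \<omega>)) \<longlonglongrightarrow> 0"
    "\<And>t. t \<in> {0..T} \<Longrightarrow> (\<lambda>m. l2_dist2 M (I t) (elementary_integral (n m) (\<tau> m) (\<xi> m) W t)) \<longlonglongrightarrow> 0"
    using has_ito_integral_approx[OF W H] by blast
  note a = a'(1) a'(2,3)[OF t]
  obtain n' \<tau>' \<xi>' where b': "\<And>m. elementary_data M F T (n' m) (\<tau>' m) (\<xi>' m)"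
    "\<And>t. t \<in> {0..T} \<Longrightarrow> (\<lambda>m. l2_dist2 (time_space t) (\<lambda>(s, \<omega>). G s \<omega>)
       (\<lambda>(s, \<omega>). elementary_integrand (n' m) (\<tau>' m) (\<xi>' m) s \<omega>)) \<longlonglongrightarrow> 0"
    "\<And>t. t \<in> {0..T} \<Longrightarrow> (\<lambda>m. l2_dist2 M (J t) (elementary_integral (n' m) (\<tau>' m) (\<xi>' m) V t)) \<longlonglongrightarrow> 0"
    using has_ito_integral_approx[OF V G] by blast
  note b = b'(1) b'(2,3)[OF t]
  have t0: "0 \<le> t" using t by simp
  note sq = csquare_integrable_ito[OF W H t] csquare_integrable_ito[OF V G t]
  have 1: "(\<lambda>m. l2_inner M (elementary_integral (n m) (\<tau> m) (\<xi> m) W t)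
      (elementary_integral (n' m) (\<tau>' m) (\<xi>' m) V t)) \<longlonglongrightarrow> l2_inner M (I t) (J t)"
    by (rule tendsto_l2_inner[OF sq(2,4) _ _ a(3) b(3)])
      (intro always_eventually allI csquare_integrable_elementary_integral[OF W a(1) t0] csquare_integrable_elementary_integral[OF V b(1) t0])+
  have 2: "(\<lambda>m. K * l2_inner (time_space t) (\<lambda>(s, \<omega>). elementary_integrand (n m) (\<tau> m) (\<xi> m) s \<omega>)
      (\<lambda>(s, \<omega>). elementary_integrand (n' m) (\<tau>' m) (\<xi>' m) s \<omega>))
      \<longlonglongrightarrow> K * l2_inner (time_space t) (\<lambda>(s, \<omega>). H s \<omega>) (\<lambda>(s, \<omega>). G s \<omega>)"
    by (rule tendsto_mult_left, rule tendsto_l2_inner[OF sq(1,3) _ _ a(2) b(2)])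
      (intro always_eventually allI csquare_integrable_elementary_integrand[OF a(1)] csquare_integrable_elementary_integrand[OF b(1)])+
  show ?thesis
    using LIMSEQ_unique[OF 1 2[folded l2_inner_elementary_integral[OF W V K a(1) b(1) t0]]] .
qed

text \<open>Inherited from the elementary integrals, since the same approximants converge at time
  \<open>s\<close> and at time \<open>t\<close>.\<close>

lemma ito_martingale:
  assumes W: "martingale_noise W" and H: "has_ito_integral M F T W H I"
    and st: "0 \<le> s" "s \<le> t" "t \<le> T" and X: "X \<in> borel_measurable (F s)" "csquare_integrable M X"
  shows "l2_inner M (I t) X = l2_inner M (I s) X"
proof -
  have t: "t \<in> {0..T}" and s: "s \<in> {0..T}" using st by auto
  obtain n \<tau> \<xi> where a': "\<And>m. elementary_data M F T (n m) (\<tau> m) (\<xi> m)"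
    "\<And>t. t \<in> {0..T} \<Longrightarrow> (\<lambda>m. l2_dist2 (time_space t) (\<lambda>(s, \<omega>). H s \<omega>)
       (\<lambda>(s, \<omega>). elementary_integrand (n m) (\<tau> m) (\<xi> m) s \<omega>)) \<longlonglongrightarrow> 0"
    "\<And>t. t \<in> {0..T} \<Longrightarrow> (\<lambda>m. l2_dist2 M (I t) (elementary_integral (n m) (\<tau> m) (\<xi> m) W t)) \<longlonglongrightarrow> 0"
    using has_ito_integral_approx[OF W H] by blast
  note a = a'(1,3)
  have X0: "(\<lambda>m::nat. l2_dist2 M X X) \<longlonglongrightarrow> 0" by simp
  have lim: "(\<lambda>m. l2_inner M (elementary_integral (n m) (\<tau> m) (\<xi> m) W r) X) \<longlonglongrightarrow> l2_inner M (I r) X"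
    if r: "r \<in> {0..T}" for r
    by (rule tendsto_l2_inner[OF csquare_integrable_ito(2)[OF W H r] X(2) _ _ a(2)[OF r] X0])
      (use r X in \<open>auto intro!: always_eventually csquare_integrable_elementary_integral[OF W a(1)]\<close>)
  show ?thesis
    using LIMSEQ_unique[OF lim[OF t]] lim[OF s]
    unfolding l2_inner_elementary_integral_past[OF W a(1) st(1,2) X] by blast
qed

end

section \<open>Fourier analysis on the torus\<close>

lemma space_torus [simp]: "space torus = UNIV" and sets_torus [simp, measurable_cong]: "sets torus = sets borel"
  by (simp_all add: torus_def)

lemma emeasure_cell:
  "emeasure lborel (cbox 0 (\<chi> i. 2 * pi) :: (real ^ 'n) set) = ennreal ((2 * pi) ^ CARD('n))"
proof -
  have "emeasure lborel (cbox 0 (\<chi> i. 2 * pi) :: (real ^ 'n) set)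
      = ennreal (\<Prod>b\<in>Basis. ((\<chi> i. 2 * pi) - 0 :: real ^ 'n) \<bullet> b)"
    by (rule emeasure_lborel_cbox) (auto simp: Basis_vec_def inner_axis)
  also have "(\<Prod>b\<in>Basis. ((\<chi> i. 2 * pi) - 0 :: real ^ 'n) \<bullet> b) = (\<Prod>b\<in>(Basis::(real^'n) set). 2 * pi)"
    by (intro prod.cong refl) (auto simp: Basis_vec_def inner_axis)
  finally show ?thesis by simp
qed

lemma prob_space_torus: "prob_space torus"
  unfolding torus_def by (rule prob_space_uniform_measure) (simp_all add: emeasure_cell)

text \<open>The faces of the cell form a null set. They have to be removed because
  \<open>circle_embedding\<close> identifies opposite faces.\<close>

lemma AE_torus_box: "AE x in (torus :: (real ^ 'n) measure). x \<in> box 0 (\<chi> i. 2 * pi)"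
proof -
  have 1: "AE x in (lborel :: (real ^ 'n) measure). x \<notin> cbox 0 (\<chi> i. 2 * pi) - box 0 (\<chi> i. 2 * pi)"
    by (rule AE_not_in) (simp add: null_sets_cbox_Diff_box)
  have 2: "AE x in (torus :: (real ^ 'n) measure). x \<in> cbox 0 (\<chi> i. 2 * pi)"
    unfolding torus_def by (rule AE_uniform_measureI) auto
  have 3: "AE x in (torus :: (real ^ 'n) measure). x \<notin> cbox 0 (\<chi> i. 2 * pi) - box 0 (\<chi> i. 2 * pi)"
    unfolding torus_def by (rule AE_uniform_measureI) (use 1 in auto)
  from 2 3 show ?thesis by eventually_elim blast
qed

lemma integral_torus:
  fixes f :: "real ^ 'n \<Rightarrow> complex"
  assumes "f \<in> borel_measurable borel"
  shows "(\<integral>x. f x \<partial>torus) = (\<integral>x. indicator (cbox 0 (\<chi> i. 2 * pi)) x *\<^sub>R f x \<partial>lborel) / (2 * pi) ^ CARD('n)"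
proof -
  let ?c = "(2 * pi) ^ CARD('n)"
  have "torus = density lborel (\<lambda>x::real^'n. ennreal (indicator (cbox 0 (\<chi> i. 2 * pi)) x / ?c))"
    unfolding torus_def uniform_measure_def emeasure_cell
    by (auto intro!: density_cong simp: indicator_def divide_ennreal[symmetric] divide_ennreal_def)
  then have "(\<integral>x. f x \<partial>torus) = (\<integral>x. (indicator (cbox 0 (\<chi> i. 2 * pi)) x / ?c) *\<^sub>R f x \<partial>lborel)"
    using integral_density[of f lborel "\<lambda>x. indicator (cbox 0 (\<chi> i. 2 * pi)) x / ?c"] assms by simp
  also have "\<dots> = (\<integral>x. (1 / ?c) *\<^sub>R (indicator (cbox 0 (\<chi> i. 2 * pi)) x *\<^sub>R f x) \<partial>lborel)"
    by (simp add: field_simps)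
  finally show ?thesis by (simp add: scaleR_conv_of_real field_simps)
qed

lemma fourier_mode_cis: "fourier_mode k x = cis (k \<bullet> x)"
  by (simp add: fourier_mode_def cis_conv_exp)

lemma norm_fourier_mode [simp]: "norm (fourier_mode k x) = 1"
  by (simp add: fourier_mode_cis)

lemma continuous_on_fourier_mode: "continuous_on S (fourier_mode k)"
  unfolding fourier_mode_def[abs_def] by (intro continuous_intros)

lemma borel_measurable_fourier_mode [measurable]: "fourier_mode k \<in> borel_measurable borel"
  by (rule borel_measurable_continuous_onI[OF continuous_on_fourier_mode])

lemma fourier_mode_add: "fourier_mode k x * fourier_mode l x = fourier_mode (k + l) x"
  by (simp add: fourier_mode_cis cis_mult inner_add_left)

lemma cnj_fourier_mode: "cnj (fourier_mode k x) = fourier_mode (- k) x"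
  by (simp add: fourier_mode_cis cis_cnj)

lemma fourier_mode_0: "fourier_mode 0 x = 1"
  by (simp add: fourier_mode_def)

section \<open>Orthonormality of the Fourier modes\<close>

lemma integral_circle_mode:
  assumes m: "m \<in> \<int>" "m \<noteq> 0"
  shows "(\<integral>y. indicator {0..2 * pi} y *\<^sub>R exp (\<i> * complex_of_real (m * y)) \<partial>lborel) = 0"
proof -
  let ?F = "\<lambda>y::real. exp (\<i> * complex_of_real (m * y)) / (\<i> * m)"
  have "has_bochner_integral lborel (\<lambda>y. indicator {0..2 * pi} y *\<^sub>R exp (\<i> * complex_of_real (m * y))) (?F (2 * pi) - ?F 0)"
  proof (rule has_bochner_integral_FTC_Icc)
    show "(?F has_vector_derivative exp (\<i> * complex_of_real (m * y))) (at y within {0..2 * pi})" for y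
    proof -
      have "((\<lambda>z. exp (\<i> * m * z) / (\<i> * m)) has_field_derivative exp (\<i> * m * y)) (at (complex_of_real y))"
        using m by (auto intro!: derivative_eq_intros simp: field_simps)
      from has_vector_derivative_real_field[OF this, of "{0..2*pi}"]
      show ?thesis by (simp add: mult.assoc)
    qed
    show "continuous_on {0..2 * pi} (\<lambda>y. exp (\<i> * complex_of_real (m * y)))"
      by (intro continuous_intros)
  qed simp
  moreover have "exp (\<i> * complex_of_real (m * (2 * pi))) = 1"
  proof -
    obtain n where "m = of_int n" using m(1) by (auto elim: Ints_cases)
    then show ?thesis
      by (subst exp_eq_1) (auto simp: intro!: exI[of _ n])
  qed
  ultimately show ?thesis by (simp add: has_bochner_integral_integral_eq)
qed

text \<open>The cell is a box and the mode a product of one-dimensional exponentials, so the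
  integral factorises over the coordinates; a coordinate with \<open>k $ i \<noteq> 0\<close>
  contributes a full-period integral, which is 0.\<close>

lemma integral_fourier_mode:
  fixes k :: "real ^ 'n"
  assumes k: "k \<in> int_lattice"
  shows "(\<integral>x. fourier_mode k x \<partial>torus) = of_bool (k = 0)"
proof (cases "k = 0")
  case True
  interpret prob_space "torus :: (real ^ 'n) measure" by (rule prob_space_torus)
  show ?thesis using True prob_space by (simp add: fourier_mode_0)
next
  case False
  then obtain i where i: "k $ i \<noteq> 0" by (auto simp: vec_eq_iff)
  define h where "h b y = indicator {0..2 * pi} y *\<^sub>R exp (\<i> * complex_of_real ((k \<bullet> b) * y))" for b :: "real ^ 'n" and y
  have hm: "h b \<in> borel_measurable borel" for b
    unfolding h_def by measurable
  have hi: "integrable lborel (h b)" for b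
  proof -
    have "set_integrable lborel {0..2 * pi} (\<lambda>y. exp (\<i> * complex_of_real ((k \<bullet> b) * y)))"
      by (rule borel_integrable_atLeastAtMost') (intro continuous_intros)
    then show ?thesis by (simp add: h_def[abs_def] set_integrable_def)
  qed
  interpret product_sigma_finite "\<lambda>b::real ^ 'n. lborel :: real measure" ..
  have prod: "indicator (cbox 0 (\<chi> i. 2 * pi)) x *\<^sub>R fourier_mode k x = (\<Prod>b\<in>Basis. h b (x \<bullet> b))" for x :: "real ^ 'n"
  proof -
    have "indicat_real (cbox 0 (\<chi> i. 2 * pi)) x = (\<Prod>b\<in>Basis. indicat_real {0..2 * pi} (x \<bullet> b))"
    proof -
      have top: "(\<chi> i. 2 * pi) \<bullet> b = 2 * pi" if "b \<in> Basis" for b :: "real ^ 'n"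
        using that by (auto simp: Basis_vec_def inner_axis)
      show ?thesis
      proof (cases "x \<in> cbox 0 (\<chi> i. 2 * pi)")
        case True
        then have "\<And>b. b \<in> Basis \<Longrightarrow> x \<bullet> b \<in> {0..2 * pi}" by (simp add: mem_box top)
        then show ?thesis using True by (simp add: prod.neutral)
      next
        case False
        then obtain b where "b \<in> Basis" "x \<bullet> b \<notin> {0..2 * pi}" by (auto simp: mem_box top)
        then have "(\<Prod>b\<in>Basis. indicat_real {0..2 * pi} (x \<bullet> b)) = 0"
          by (intro prod_zero) (auto simp: indicator_def)
        then show ?thesis using False by simp
      qed
    qed
    moreover have "fourier_mode k x = (\<Prod>b\<in>Basis. exp (\<i> * complex_of_real ((k \<bullet> b) * (x \<bullet> b))))"
      unfolding fourier_mode_def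
      by (subst euclidean_inner) (simp add: sum_distrib_left exp_sum)
    ultimately show ?thesis
      by (simp add: h_def scaleR_conv_of_real prod.distrib)
  qed
  have "(\<integral>x. indicator (cbox 0 (\<chi> i. 2 * pi)) x *\<^sub>R fourier_mode k x \<partial>lborel)
      = (\<integral>x. (\<Prod>b\<in>Basis. h b (x \<bullet> b)) \<partial>distr (\<Pi>\<^sub>M b\<in>(Basis :: (real ^ 'n) set). lborel) borel (\<lambda>f. \<Sum>b\<in>Basis. f b *\<^sub>R b))"
    unfolding prod by (subst lborel_eq) simp
  also have "\<dots> = (\<integral>f. (\<Prod>b\<in>Basis. h b (f b)) \<partial>(\<Pi>\<^sub>M b\<in>(Basis :: (real ^ 'n) set). lborel))"
  proof (subst integral_distr)
    show "(\<lambda>x::real^'n. \<Prod>b\<in>Basis. h b (x \<bullet> b)) \<in> borel_measurable borel"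
      by (intro borel_measurable_prod measurable_compose[OF _ hm]) measurable
    show "(\<integral>f. (\<Prod>b\<in>Basis. h b ((\<Sum>b\<in>Basis. f b *\<^sub>R b) \<bullet> b)) \<partial>(\<Pi>\<^sub>M b\<in>(Basis :: (real ^ 'n) set). lborel))
      = (\<integral>f. (\<Prod>b\<in>Basis. h b (f b)) \<partial>(\<Pi>\<^sub>M b\<in>(Basis :: (real ^ 'n) set). lborel))"
      by (intro Bochner_Integration.integral_cong refl prod.cong) (simp add: inner_sum_left inner_Basis if_distrib cong: if_cong)
  qed measurable
  also have "\<dots> = (\<Prod>b\<in>(Basis :: (real ^ 'n) set). \<integral>y. h b y \<partial>lborel)"
    by (rule product_integral_prod) (auto intro: hi)
  also have "\<dots> = 0"
  proof (rule prod_zero)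
    have "k \<bullet> axis i 1 = k $ i" by (simp add: inner_axis)
    moreover have "k $ i \<in> \<int>" using k by (auto simp: int_lattice_def)
    ultimately have "(\<integral>y. h (axis i 1) y \<partial>lborel) = 0"
      unfolding h_def using integral_circle_mode i by simp
    moreover have "axis i 1 \<in> (Basis :: (real ^ 'n) set)" by (auto simp: Basis_vec_def)
    ultimately show "\<exists>b\<in>(Basis :: (real ^ 'n) set). (\<integral>y. h b y \<partial>lborel) = 0" by blast
  qed simp
  finally show ?thesis using False by (simp add: integral_torus)
qed

section \<open>Pairings as inner products, and Bessel's inequality\<close>

lemma torus_l2_rel_rep: "torus_l2_rel (rep_torus_l2 f) (rep_torus_l2 f)"
  using Quotient3_rep_reflp[OF Quotient3_torus_l2] .

lemma square_integrable_rep: "square_integrable torus (rep_torus_l2 f)"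
  using torus_l2_rel_rep[of f] by (simp add: torus_l2_rel_def)

lemma inner_abs_torus_l2:
  assumes "square_integrable torus \<phi>"
  shows "inner f (abs_torus_l2 \<phi>) = (\<integral>x. rep_torus_l2 f x * \<phi> x \<partial>torus)"
proof -
  have "torus_l2_rel \<phi> \<phi>" using assms by (simp add: torus_l2_rel_def)
  from inner_torus_l2.abs_eq[OF torus_l2_rel_rep[of f] this]
  show ?thesis by (simp add: Quotient3_abs_rep[OF Quotient3_torus_l2])
qed

lemma norm_torus_l2_square: "(norm f)\<^sup>2 = (\<integral>x. (rep_torus_l2 f x)\<^sup>2 \<partial>torus)"
proof -
  have "inner f f = (\<integral>x. rep_torus_l2 f x * rep_torus_l2 f x \<partial>torus)"
    using inner_torus_l2.abs_eq[OF torus_l2_rel_rep[of f] torus_l2_rel_rep[of f]]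
    by (simp only: Quotient3_abs_rep[OF Quotient3_torus_l2])
  then show ?thesis unfolding power2_norm_eq_inner by (simp only: power2_eq_square)
qed

lemma square_integrable_bounded_torus:
  assumes "\<phi> \<in> borel_measurable borel" "\<And>x. \<bar>\<phi> x\<bar> \<le> K"
  shows "square_integrable torus \<phi>"
proof -
  interpret prob_space "torus :: (real ^ 'a) measure" by (rule prob_space_torus)
  have [measurable]: "\<phi> \<in> borel_measurable borel" by fact
  have "integrable torus (\<lambda>x. (\<phi> x)\<^sup>2)"
  proof (rule integrable_const_bound[where B = "K\<^sup>2"])
    show "AE x in torus. norm ((\<phi> x)\<^sup>2) \<le> K\<^sup>2"
      using power_mono[OF assms(2) abs_ge_zero, of _ 2] by simp
  qed measurable
  then show ?thesis by (simp add: square_integrable_def)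
qed

lemma csquare_integrable_rep: "csquare_integrable torus (\<lambda>x. complex_of_real (rep_torus_l2 f x))"
proof -
  have [measurable]: "rep_torus_l2 f \<in> borel_measurable torus"
    using square_integrable_rep by (auto simp: square_integrable_def)
  have "(\<lambda>x. complex_of_real (rep_torus_l2 f x)) \<in> borel_measurable torus" by measurable
  then show ?thesis using square_integrable_rep[of f]
    by (simp add: csquare_integrable_def square_integrable_def)
qed

lemma csquare_integrable_bounded_torus:
  fixes \<phi> :: "real ^ 'n \<Rightarrow> complex"
  assumes "\<phi> \<in> borel_measurable borel" "\<And>x. norm (\<phi> x) \<le> K"
  shows "csquare_integrable torus \<phi>"
proof -
  interpret prob_space "torus :: (real ^ 'n) measure" by (rule prob_space_torus)
  have "\<phi> \<in> borel_measurable torus" using assms(1) by (simp cong: measurable_cong_sets)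
  from csquare_integrable_bounded_mult[OF csquare_integrable_const[of 1] this assms(2)]
  show ?thesis by simp
qed

lemma integrable_pairing:
  fixes \<phi> :: "real ^ 'n \<Rightarrow> complex"
  assumes "\<phi> \<in> borel_measurable borel" "\<And>x. norm (\<phi> x) \<le> K"
  shows "integrable torus (\<lambda>x. rep_torus_l2 f x *\<^sub>R \<phi> x)"
  using csquare_integrable_mult[OF csquare_integrable_rep csquare_integrable_bounded_torus[OF assms]]
  by (simp add: scaleR_conv_of_real)

lemma pairing_add:
  fixes \<phi> \<psi> :: "real ^ 'n \<Rightarrow> complex"
  assumes "\<phi> \<in> borel_measurable borel" "\<And>x. norm (\<phi> x) \<le> K"
    and "\<psi> \<in> borel_measurable borel" "\<And>x. norm (\<psi> x) \<le> K'"
  shows "pairing f (\<lambda>x. \<phi> x + \<psi> x) = pairing f \<phi> + pairing f \<psi>"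
  unfolding pairing_def scaleR_add_right
  by (rule Bochner_Integration.integral_add[OF integrable_pairing[OF assms(1,2)] integrable_pairing[OF assms(3,4)]])

lemma pairing_scale:
  fixes \<phi> :: "real ^ 'n \<Rightarrow> complex"
  shows "pairing f (\<lambda>x. c * \<phi> x) = c * pairing f \<phi>"
  unfolding pairing_def by (simp add: mult_scaleR_right[symmetric] del: mult_scaleR_right)

lemma pairing_of_real:
  "pairing f (\<lambda>x. complex_of_real (\<phi> x)) = complex_of_real (pairing f \<phi>)"
  unfolding pairing_def by (simp only: integral_complex_of_real[symmetric] scaleR_conv_of_real of_real_mult of_real_eq_id id_apply)

text \<open>\<open>rep_torus_l2\<close> chooses representatives and is not additive pointwise.
  Linearity and continuity of the pairing in \<open>f\<close> are therefore taken from the real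
  inner product of the quotient type.\<close>

lemma pairing_inner:
  fixes \<phi> :: "real ^ 'n \<Rightarrow> complex"
  assumes "\<phi> \<in> borel_measurable borel" "\<And>x. norm (\<phi> x) \<le> K"
  shows "pairing f \<phi> = Complex (inner f (abs_torus_l2 (\<lambda>x. Re (\<phi> x)))) (inner f (abs_torus_l2 (\<lambda>x. Im (\<phi> x))))"
proof -
  have [measurable]: "\<phi> \<in> borel_measurable borel" by fact
  have "square_integrable torus (\<lambda>x. Re (\<phi> x))" "square_integrable torus (\<lambda>x. Im (\<phi> x))"
    using assms(2) by (auto intro!: square_integrable_bounded_torus[where K = K]
      intro: order_trans[OF abs_Re_le_cmod] order_trans[OF abs_Im_le_cmod])
  then have "inner f (abs_torus_l2 (\<lambda>x. Re (\<phi> x))) = Re (pairing f \<phi>)"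
    "inner f (abs_torus_l2 (\<lambda>x. Im (\<phi> x))) = Im (pairing f \<phi>)"
    using integral_Re[OF integrable_pairing[OF assms, of f]] integral_Im[OF integrable_pairing[OF assms, of f]]
    by (simp_all add: inner_abs_torus_l2 pairing_def)
  then show ?thesis by simp
qed

lemma pairing_diff_left:
  fixes \<phi> :: "real ^ 'n \<Rightarrow> complex"
  assumes "\<phi> \<in> borel_measurable borel" "\<And>x. norm (\<phi> x) \<le> K"
  shows "pairing (f - g) \<phi> = pairing f \<phi> - pairing g \<phi>"
  unfolding pairing_inner[OF assms] by (simp add: complex_eq_iff inner_diff_left)

lemma borel_measurable_pairing:
  fixes \<phi> :: "real ^ 'n \<Rightarrow> complex"
  assumes "\<phi> \<in> borel_measurable borel" "\<And>x. norm (\<phi> x) \<le> K"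
  shows "(\<lambda>f. pairing f \<phi>) \<in> borel_measurable borel"
proof (rule borel_measurable_continuous_onI)
  have "continuous_on UNIV (\<lambda>f. complex_of_real (inner f (abs_torus_l2 (\<lambda>x. Re (\<phi> x))))
    + \<i> * complex_of_real (inner f (abs_torus_l2 (\<lambda>x. Im (\<phi> x)))))"
    by (intro continuous_intros)
  then show "continuous_on UNIV (\<lambda>f. pairing f \<phi>)"
    unfolding pairing_inner[OF assms] complex_eq[symmetric]
    by (simp add: Complex_eq)
qed

lemma l2_inner_fourier_modes:
  assumes "k \<in> int_lattice" "l \<in> int_lattice"
  shows "l2_inner torus (fourier_mode k) (fourier_mode l) = of_bool (k = l)"
proof -
  have "k - l \<in> int_lattice" using assms by (auto simp: int_lattice_def)
  then show ?thesis
    using integral_fourier_mode[of "k - l"]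
    by (simp add: l2_inner_def cnj_fourier_mode fourier_mode_add)
qed

lemma l2_inner_rep_fourier_mode:
  "l2_inner torus (\<lambda>x. complex_of_real (rep_torus_l2 f x)) (fourier_mode k) = pairing f (fourier_mode (- k))"
  by (simp add: l2_inner_def pairing_def cnj_fourier_mode scaleR_conv_of_real)

text \<open>The pairing is bilinear, so the coefficient of mode \<open>k\<close> is a pairing with
  mode \<open>- k\<close>. For the partial Fourier sum \<open>G\<close> the products of
  \<open>F\<close> with \<open>G\<close> and of \<open>G\<close> with itself agree, and the squared
  norm of \<open>F - G\<close> is nonnegative.\<close>

lemma bessel_inequality:
  fixes f :: "'n::finite torus_l2"
  assumes A: "finite A" "A \<subseteq> int_lattice"
  shows "(\<Sum>k\<in>A. (norm (pairing f (fourier_mode (- k))))\<^sup>2) \<le> (norm f)\<^sup>2"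
proof -
  define F where "F x = complex_of_real (rep_torus_l2 f x)" for x
  define c where "c k = pairing f (fourier_mode (- k))" for k
  define G where "G x = (\<Sum>k\<in>A. c k * fourier_mode k x)" for x
  have e2: "csquare_integrable torus (fourier_mode k)" for k :: "real ^ 'n"
    by (rule csquare_integrable_bounded_torus[where K = 1]) auto
  have F2: "csquare_integrable torus F" unfolding F_def by (rule csquare_integrable_rep)
  have G2: "csquare_integrable torus G"
    unfolding G_def by (intro csquare_integrable_sum csquare_integrable_scale e2)
  have FG: "l2_inner torus F G = of_real (\<Sum>k\<in>A. (norm (c k))\<^sup>2)"
  proof -
    have "l2_inner torus F (fourier_mode k) = c k" for k
      unfolding F_def[abs_def] c_def by (rule l2_inner_rep_fourier_mode)
    then have "l2_inner torus F G = (\<Sum>k\<in>A. cnj (c k) * c k)"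
      unfolding G_def
      by (subst l2_inner_sum_right) (auto intro: F2 csquare_integrable_scale e2 simp: l2_inner_scale_right)
    then show ?thesis by (simp only: of_real_sum complex_norm_square mult.commute)
  qed
  have GG: "l2_inner torus G G = of_real (\<Sum>k\<in>A. (norm (c k))\<^sup>2)"
  proof -
    have "l2_inner torus G G = (\<Sum>k\<in>A. c k * l2_inner torus (fourier_mode k) G)"
      by (subst (1) G_def[abs_def], subst l2_inner_sum_left)
        (auto intro: G2 csquare_integrable_scale e2 simp: l2_inner_scale_left)
    also have "\<dots> = (\<Sum>k\<in>A. c k * cnj (c k))"
    proof (rule sum.cong[OF refl])
      fix k assume k: "k \<in> A"
      have "l2_inner torus (fourier_mode k) G = (\<Sum>l\<in>A. cnj (c l) * l2_inner torus (fourier_mode k) (fourier_mode l))"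
        unfolding G_def
        by (subst l2_inner_sum_right) (auto intro: csquare_integrable_scale e2 simp: l2_inner_scale_right)
      also have "\<dots> = (\<Sum>l\<in>A. if l = k then cnj (c k) else 0)"
        using A k by (intro sum.cong refl) (auto simp: l2_inner_fourier_modes subset_iff)
      finally show "c k * l2_inner torus (fourier_mode k) G = c k * cnj (c k)" using A k by simp
    qed
    finally show ?thesis by (simp only: of_real_sum complex_norm_square)
  qed
  have "0 \<le> Re (l2_inner torus (\<lambda>x. F x - G x) (\<lambda>x. F x - G x))"
    unfolding l2_inner_self by simp
  also have "l2_inner torus (\<lambda>x. F x - G x) (\<lambda>x. F x - G x)
    = l2_inner torus F F - l2_inner torus F G - l2_inner torus G F + l2_inner torus G G"
    by (simp add: l2_inner_diff_left[OF F2 G2] l2_inner_diff_right[OF F2 G2] csquare_integrable_diff F2 G2)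
  also have "l2_inner torus G F = of_real (\<Sum>k\<in>A. (norm (c k))\<^sup>2)"
    by (subst l2_inner_commute) (simp add: FG)
  also have "l2_inner torus F F = of_real ((norm f)\<^sup>2)"
    unfolding l2_inner_self norm_torus_l2_square by (simp add: F_def)
  finally show ?thesis unfolding FG GG by (simp add: c_def)
qed


section \<open>Trigonometric polynomials and completeness of the Fourier modes\<close>

inductive trigonometric :: "(real ^ 'n \<Rightarrow> complex) \<Rightarrow> bool" where
  mode: "k \<in> int_lattice \<Longrightarrow> trigonometric (\<lambda>x. c * fourier_mode k x)"
| add: "trigonometric p \<Longrightarrow> trigonometric q \<Longrightarrow> trigonometric (\<lambda>x. p x + q x)"

lemma int_lattice_add: "k \<in> int_lattice \<Longrightarrow> l \<in> int_lattice \<Longrightarrow> k + l \<in> int_lattice"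
  by (auto simp: int_lattice_def)

lemma int_lattice_uminus: "k \<in> int_lattice \<Longrightarrow> - k \<in> int_lattice"
  by (auto simp: int_lattice_def)

lemma int_lattice_diff: "k \<in> int_lattice \<Longrightarrow> l \<in> int_lattice \<Longrightarrow> k - l \<in> int_lattice"
  by (auto simp: int_lattice_def)

lemma zero_int_lattice: "0 \<in> int_lattice"
  by (auto simp: int_lattice_def)

lemma axis_int_lattice: "axis i 1 \<in> int_lattice"
  by (auto simp: int_lattice_def axis_def)

lemma trigonometric_const: "trigonometric (\<lambda>x. c)"
  using trigonometric.mode[OF zero_int_lattice, of c] by (simp add: fourier_mode_0)

lemma trigonometric_mode_mult:
  assumes "trigonometric q" "k \<in> int_lattice"
  shows "trigonometric (\<lambda>x. (c * fourier_mode k x) * q x)"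
  using assms(1)
proof induction
  case (mode l d)
  have "(\<lambda>x. (c * fourier_mode k x) * (d * fourier_mode l x)) = (\<lambda>x. (c * d) * fourier_mode (k + l) x)"
    by (auto simp: fourier_mode_add[symmetric] mult_ac)
  then show ?case using trigonometric.mode[OF int_lattice_add[OF assms(2) mode]] by simp
next
  case (add p q)
  then show ?case using trigonometric.add by (simp add: distrib_left)
qed

lemma trigonometric_mult:
  assumes "trigonometric p" "trigonometric q"
  shows "trigonometric (\<lambda>x. p x * q x)"
  using assms(1)
proof induction
  case (mode k c)
  then show ?case using trigonometric_mode_mult[OF assms(2)] by simp
next
  case (add p1 p2)
  then show ?case using trigonometric.add by (simp add: distrib_right)
qed

lemma trigonometric_sum:
  "(\<And>i. i \<in> A \<Longrightarrow> trigonometric (p i)) \<Longrightarrow> trigonometric (\<lambda>x. \<Sum>i\<in>A. p i x)"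
  by (induction A rule: infinite_finite_induct) (auto intro: trigonometric_const trigonometric.add)

lemma trigonometric_cos_sin:
  fixes i :: "'n::finite"
  shows "trigonometric (\<lambda>x::real^'n. complex_of_real (cos (x $ i)))"
    and "trigonometric (\<lambda>x::real^'n. complex_of_real (sin (x $ i)))"
proof -
  have ax: "axis i 1 \<bullet> x = x $ i" for x :: "real ^ 'n" by (simp add: inner_axis')
  have c: "complex_of_real (cos (x $ i))
      = 1/2 * fourier_mode (axis i 1) x + 1/2 * fourier_mode (- axis i 1) x" for x :: "real ^ 'n"
    by (simp add: fourier_mode_cis ax complex_eq_iff)
  have s: "complex_of_real (sin (x $ i))
      = - \<i>/2 * fourier_mode (axis i 1) x + \<i>/2 * fourier_mode (- axis i 1) x" for x :: "real ^ 'n"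
    by (simp add: fourier_mode_cis ax complex_eq_iff)
  show "trigonometric (\<lambda>x::real^'n. complex_of_real (cos (x $ i)))"
    unfolding c by (intro trigonometric.intros axis_int_lattice int_lattice_uminus)
  show "trigonometric (\<lambda>x::real^'n. complex_of_real (sin (x $ i)))"
    unfolding s by (intro trigonometric.intros axis_int_lattice int_lattice_uminus)
qed

text \<open>Realises the torus as a compact subset of a Euclidean space, where Stone-Weierstrass for
  polynomial functions applies; polynomials there pull back to trigonometric polynomials.\<close>

definition circle_embedding :: "real ^ 'n \<Rightarrow> complex ^ 'n" where
  "circle_embedding x = (\<chi> i. cis (x $ i))"

text \<open>The essential case is a linear functional: the coordinates of the embedding are the
  functions cos and sin of single coordinates. Sums and products are closure properties of
  \<open>trigonometric\<close>.\<close>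

lemma trigonometric_polynomial_function:
  fixes p :: "complex ^ 'n::finite \<Rightarrow> real"
  assumes "real_polynomial_function p"
  shows "trigonometric (\<lambda>x. complex_of_real (p (circle_embedding x)))"
  using assms
proof induction
  case (linear f)
  have fz: "f z = (\<Sum>b\<in>Basis. (z \<bullet> b) * f b)" for z
  proof -
    have l: "linear f" using linear bounded_linear.linear by blast
    have "f z = f (\<Sum>b\<in>Basis. (z \<bullet> b) *\<^sub>R b)" by (simp add: euclidean_representation)
    also have "\<dots> = (\<Sum>b\<in>Basis. (z \<bullet> b) *\<^sub>R f b)" by (simp only: linear_sum[OF l] linear_scale[OF l])
    finally show ?thesis by simp
  qed
  have eq: "(\<lambda>x. complex_of_real (f (circle_embedding x)))
    = (\<lambda>x. \<Sum>b\<in>Basis. complex_of_real (circle_embedding x \<bullet> b) * complex_of_real (f b))"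
  proof
    fix x
    have "complex_of_real (f (circle_embedding x)) = complex_of_real (\<Sum>b\<in>Basis. (circle_embedding x \<bullet> b) * f b)"
      by (rule arg_cong[OF fz])
    then show "complex_of_real (f (circle_embedding x))
      = (\<Sum>b\<in>Basis. complex_of_real (circle_embedding x \<bullet> b) * complex_of_real (f b))"
      by (simp only: of_real_sum of_real_mult)
  qed
  have "trigonometric (\<lambda>x. complex_of_real (circle_embedding x \<bullet> b))" if b: "b \<in> Basis" for b :: "complex ^ 'n"
  proof -
    from b obtain i w where w: "w \<in> Basis" "b = axis i w" by (auto simp: Basis_vec_def)
    have "circle_embedding x \<bullet> b = cis (x $ i) \<bullet> w" for x
      unfolding w by (simp add: inner_axis circle_embedding_def)
    then show ?thesis using w(1) trigonometric_cos_sin[of i]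
      by (auto simp: Basis_complex_def inner_complex_def)
  qed
  then show ?case unfolding eq
    by (intro trigonometric_sum trigonometric_mult trigonometric_const)
next
  case (const c)
  then show ?case by (rule trigonometric_const)
next
  case (add f g)
  then show ?case using trigonometric.add by simp
next
  case (mult f g)
  then show ?case using trigonometric_mult by simp
qed

lemma trigonometric_bounded_measurable:
  assumes "trigonometric p"
  shows "p \<in> borel_measurable borel \<and> (\<exists>K. \<forall>x. norm (p x) \<le> K)"
  using assms
proof induction
  case (mode k c)
  have "norm (c * fourier_mode k x) \<le> norm c" for x by (simp add: norm_mult)
  then show ?case by auto
next
  case (add p q)
  then obtain K K' where "\<And>x. norm (p x) \<le> K" "\<And>x. norm (q x) \<le> K'" by auto
  then have "norm (p x + q x) \<le> K + K'" for x
    by (intro norm_triangle_le add_mono)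
  with add show ?case by auto
qed

lemma pairing_trigonometric:
  assumes "trigonometric p" and f: "\<And>k. k \<in> int_lattice \<Longrightarrow> pairing f (fourier_mode k) = 0"
  shows "pairing f p = 0"
  using assms(1)
proof induction
  case (mode k c)
  then show ?case by (simp add: pairing_scale f)
next
  case (add p q)
  obtain K K' where "\<And>x. norm (p x) \<le> K" "\<And>x. norm (q x) \<le> K'"
    using trigonometric_bounded_measurable[OF add.hyps(1)] trigonometric_bounded_measurable[OF add.hyps(2)] by auto
  then show ?case
    using pairing_add[of p K q K' f] trigonometric_bounded_measurable[OF add.hyps(1)]
      trigonometric_bounded_measurable[OF add.hyps(2)] add.IH by simp
qed

lemma continuous_on_circle_embedding: "continuous_on S circle_embedding"
  unfolding circle_embedding_def cis_conv_exp by (intro continuous_intros)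

text \<open>Coordinates with equal image differ by an integer multiple of \<open>2 * pi\<close>.
  With one point strictly inside the cell the difference has modulus below \<open>2 * pi\<close>, so
  that integer is 0.\<close>

lemma circle_embedding_inj:
  assumes "x \<in> cbox 0 (\<chi> i. 2 * pi)" "y \<in> box 0 (\<chi> i. 2 * pi)" "circle_embedding x = circle_embedding y"
  shows "x = y"
proof -
  have "x $ i = y $ i" for i
  proof -
    have "cis (x $ i) = cis (y $ i)" using assms(3) by (simp add: circle_embedding_def vec_eq_iff)
    then have "sin (x $ i) = sin (y $ i) \<and> cos (x $ i) = cos (y $ i)" by (simp add: complex_eq_iff)
    then obtain n :: int where n: "x $ i = y $ i + 2 * pi * n" by (metis sin_cos_eq_iff)
    have "0 \<le> x $ i" "x $ i \<le> 2 * pi" "0 < y $ i" "y $ i < 2 * pi"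
      using assms(1,2) by (auto simp: mem_box_cart)
    then have "2 * pi * n < 2 * pi * 1" "2 * pi * (- 1) < 2 * pi * n" using n by linarith+
    then have "n < 1" "-1 < n" using pi_gt_zero by (simp_all only: mult_less_cancel_left_pos)
    then show ?thesis using n by simp
  qed
  then show ?thesis by (simp add: vec_eq_iff)
qed

text \<open>\<open>q\<close> is uniformly close, on the compact image of the cell, to a polynomial,
  whose pairing with \<open>f\<close> vanishes; the error is at most \<open>e\<close> times the
  integral of the modulus of \<open>f\<close>.\<close>

lemma integral_mult_continuous_torus:
  fixes f :: "'n::finite torus_l2"
  assumes f: "\<And>k. k \<in> int_lattice \<Longrightarrow> pairing f (fourier_mode k) = 0"
    and q: "continuous_on UNIV q"
  shows "(\<integral>x. rep_torus_l2 f x * q (circle_embedding x) \<partial>torus) = 0"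
proof -
  interpret prob_space "torus :: (real ^ 'n) measure" by (rule prob_space_torus)
  let ?g = "rep_torus_l2 f"
  let ?C = "cbox 0 (\<chi> i. 2 * pi) :: (real ^ 'n) set"
  define S where "S = circle_embedding ` ?C"
  have S: "compact S" unfolding S_def by (intro compact_continuous_image continuous_on_circle_embedding compact_cbox)
  have g2: "square_integrable torus ?g" by (rule square_integrable_rep)
  have gi: "integrable torus ?g"
    using g2 by (auto simp: square_integrable_def intro: square_integrable_imp_integrable)
  have in_S: "AE x in torus. circle_embedding x \<in> S"
    using AE_torus_box by eventually_elim (use box_subset_cbox in \<open>auto simp: S_def\<close>)
  have qm: "(\<lambda>x. q (circle_embedding x)) \<in> borel_measurable borel"
    by (intro borel_measurable_continuous_onI continuous_on_compose2[OF q continuous_on_circle_embedding]) auto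
  have pm: "(\<lambda>x. p (circle_embedding x)) \<in> borel_measurable borel" if "real_polynomial_function p" for p :: "complex ^ 'n \<Rightarrow> real"
    using that continuous_on_polymonial_function[of p UNIV] real_polynomial_function_eq
    by (intro borel_measurable_continuous_onI continuous_on_compose2[OF _ continuous_on_circle_embedding]) auto
  have int: "integrable torus (\<lambda>x. ?g x * h x)"
    if h: "h \<in> borel_measurable borel" and b: "AE x in torus. \<bar>h x\<bar> \<le> K" for h K
  proof (rule Bochner_Integration.integrable_bound)
    show "integrable torus (\<lambda>x. K * \<bar>?g x\<bar>)" using gi by auto
    show "(\<lambda>x. ?g x * h x) \<in> borel_measurable torus" using gi h
      by (intro borel_measurable_times) (auto cong: measurable_cong_sets)
    show "AE x in torus. norm (?g x * h x) \<le> norm (K * \<bar>?g x\<bar>)"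
      using b
    proof eventually_elim
      case (elim x)
      have "\<bar>?g x\<bar> * \<bar>h x\<bar> \<le> \<bar>?g x\<bar> * \<bar>K\<bar>" using elim by (intro mult_left_mono) auto
      then show ?case by (simp add: abs_mult mult.commute)
    qed
  qed
  have bd: "\<exists>K. AE x in torus. \<bar>r (circle_embedding x)\<bar> \<le> K" if r: "continuous_on UNIV r" for r :: "complex ^ 'n \<Rightarrow> real"
  proof -
    have "bounded (r ` S)"
      by (intro compact_imp_bounded compact_continuous_image continuous_on_subset[OF r] S) auto
    then obtain K where "\<And>z. z \<in> S \<Longrightarrow> \<bar>r z\<bar> \<le> K" by (auto simp: bounded_iff)
    then have "AE x in torus. \<bar>r (circle_embedding x)\<bar> \<le> K"
      by (intro eventually_mono[OF in_S])
    then show ?thesis by blast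
  qed
  have "\<bar>\<integral>x. ?g x * q (circle_embedding x) \<partial>torus\<bar> \<le> e * (\<integral>x. \<bar>?g x\<bar> \<partial>torus)" if e: "e > 0" for e
  proof -
    obtain p where p: "real_polynomial_function p" "\<And>z. z \<in> S \<Longrightarrow> \<bar>q z - p z\<bar> < e"
      using Stone_Weierstrass_real_polynomial_function[OF S continuous_on_subset[OF q subset_UNIV] e] by blast
    have cp: "continuous_on UNIV p"
      using p(1) continuous_on_polymonial_function[of p UNIV] real_polynomial_function_eq by auto
    obtain K K' where K: "AE x in torus. \<bar>q (circle_embedding x)\<bar> \<le> K" "AE x in torus. \<bar>p (circle_embedding x)\<bar> \<le> K'"
      using bd[OF q] bd[OF cp] by blast
    note iq = int[OF qm K(1)] and ip = int[OF pm[OF p(1)] K(2)]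
    have "complex_of_real (\<integral>x. ?g x * p (circle_embedding x) \<partial>torus) = pairing f (\<lambda>x. complex_of_real (p (circle_embedding x)))"
      unfolding pairing_of_real by (simp add: pairing_def)
    also have "\<dots> = 0"
      by (rule pairing_trigonometric[OF trigonometric_polynomial_function[OF p(1)] f])
    finally have p0: "(\<integral>x. ?g x * p (circle_embedding x) \<partial>torus) = 0" by simp
    have "(\<integral>x. ?g x * q (circle_embedding x) \<partial>torus)
        = (\<integral>x. ?g x * q (circle_embedding x) - ?g x * p (circle_embedding x) \<partial>torus)"
      by (subst Bochner_Integration.integral_diff[OF iq ip]) (simp add: p0)
    also have "\<bar>\<dots>\<bar> \<le> (\<integral>x. \<bar>?g x * q (circle_embedding x) - ?g x * p (circle_embedding x)\<bar> \<partial>torus)"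
      by (rule integral_abs_bound)
    also have "\<dots> \<le> (\<integral>x. e * \<bar>?g x\<bar> \<partial>torus)"
    proof (rule integral_mono_AE)
      show "integrable torus (\<lambda>x. \<bar>?g x * q (circle_embedding x) - ?g x * p (circle_embedding x)\<bar>)"
        using iq ip by auto
      show "integrable torus (\<lambda>x. e * \<bar>?g x\<bar>)" using gi by auto
      show "AE x in torus. \<bar>?g x * q (circle_embedding x) - ?g x * p (circle_embedding x)\<bar> \<le> e * \<bar>?g x\<bar>"
        using in_S
      proof eventually_elim
        case (elim x)
        have "\<bar>?g x * q (circle_embedding x) - ?g x * p (circle_embedding x)\<bar>
          = \<bar>?g x\<bar> * \<bar>q (circle_embedding x) - p (circle_embedding x)\<bar>"
          by (simp add: abs_mult[symmetric] right_diff_distrib)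
        also have "\<dots> \<le> \<bar>?g x\<bar> * e" using p(2)[OF elim] by (intro mult_left_mono) auto
        finally show ?case by (simp add: mult.commute)
      qed
    qed
    finally show ?thesis by simp
  qed
  \<comment> \<open>Dividing by 1 plus the integral turns the family of bounds into one by
    \<open>e\<close> itself, whether or not that integral is 0.\<close>
  then have "\<bar>\<integral>x. ?g x * q (circle_embedding x) \<partial>torus\<bar> / (1 + (\<integral>x. \<bar>?g x\<bar> \<partial>torus)) \<le> e" if "e > 0" for e
    using that
  proof -
    have n: "0 \<le> (\<integral>x. \<bar>?g x\<bar> \<partial>torus)" by simp
    have "\<bar>\<integral>x. ?g x * q (circle_embedding x) \<partial>torus\<bar> \<le> e * (\<integral>x. \<bar>?g x\<bar> \<partial>torus)"
      using \<open>\<And>e. e > 0 \<Longrightarrow> _\<close>[OF that] .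
    also have "\<dots> \<le> e * (1 + (\<integral>x. \<bar>?g x\<bar> \<partial>torus))" using that by (simp add: distrib_left)
    finally show ?thesis using n by (simp add: pos_divide_le_eq add_pos_nonneg)
  qed
  then have "\<bar>\<integral>x. ?g x * q (circle_embedding x) \<partial>torus\<bar> / (1 + (\<integral>x. \<bar>?g x\<bar> \<partial>torus)) \<le> 0"
    by (rule field_le_epsilon[where y = 0, simplified]) 
  moreover have "0 \<le> (\<integral>x. \<bar>?g x\<bar> \<partial>torus)" by simp
  ultimately show ?thesis by (simp add: divide_le_0_iff)
qed

text \<open>The functions \<open>q m\<close> are continuous, equal to 1 on the image
  \<open>D\<close> of \<open>C\<close> and 0 at distance at least 1/m from it. They converge to the
  indicator of \<open>D\<close>, which pulls back to that of \<open>C\<close> because the embedding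
  is injective on the open box; dominated convergence concludes.\<close>

lemma integral_compact_torus:
  fixes f :: "'n::finite torus_l2"
  assumes f: "\<And>k. k \<in> int_lattice \<Longrightarrow> pairing f (fourier_mode k) = 0"
    and C: "compact C" "C \<subseteq> box 0 (\<chi> i. 2 * pi)"
  shows "(\<integral>x. rep_torus_l2 f x * indicator C x \<partial>torus) = 0"
proof (cases "C = {}")
  case False
  let ?g = "rep_torus_l2 f"
  define D where "D = circle_embedding ` C"
  have D: "closed D" "D \<noteq> {}"
    using False by (auto simp: D_def intro!: compact_imp_closed compact_continuous_image continuous_on_circle_embedding C)
  define q where "q m z = max 0 (1 - real m * infdist z D)" for m z
  have cq: "continuous_on UNIV (q m)" for m
    unfolding q_def by (intro continuous_intros)
  have gi: "integrable torus ?g"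
  proof -
    interpret prob_space "torus :: (real ^ 'n) measure" by (rule prob_space_torus)
    show ?thesis using square_integrable_rep[of f]
      by (auto simp: square_integrable_def intro: square_integrable_imp_integrable)
  qed
  have qm: "(\<lambda>x. q m (circle_embedding x)) \<in> borel_measurable borel" for m
    by (intro borel_measurable_continuous_onI continuous_on_compose2[OF cq continuous_on_circle_embedding]) auto
  have Cm: "C \<in> sets borel" using C(1) by (simp add: compact_imp_closed)
  have "(\<lambda>m. \<integral>x. ?g x * q m (circle_embedding x) \<partial>torus) \<longlonglongrightarrow> (\<integral>x. ?g x * indicator C x \<partial>torus)"
  proof (rule integral_dominated_convergence)
    show "(\<lambda>x. ?g x * indicator C x) \<in> borel_measurable torus"
      using gi Cm by (intro borel_measurable_times borel_measurable_indicator) auto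
    show "(\<lambda>x. ?g x * q m (circle_embedding x)) \<in> borel_measurable torus" for m
      using gi qm[of m] by (intro borel_measurable_times) (auto cong: measurable_cong_sets)
    show "integrable torus (\<lambda>x. \<bar>?g x\<bar>)" using gi by auto
    show "AE x in torus. norm (?g x * q m (circle_embedding x)) \<le> \<bar>?g x\<bar>" for m
    proof (rule AE_I2)
      fix x
      have "0 \<le> q m (circle_embedding x)" "q m (circle_embedding x) \<le> 1"
        by (auto simp: q_def infdist_nonneg)
      then have "\<bar>?g x\<bar> * \<bar>q m (circle_embedding x)\<bar> \<le> \<bar>?g x\<bar> * 1" by (intro mult_left_mono) auto
      then show "norm (?g x * q m (circle_embedding x)) \<le> \<bar>?g x\<bar>" by (simp add: abs_mult)
    qed
    show "AE x in torus. (\<lambda>m. ?g x * q m (circle_embedding x)) \<longlonglongrightarrow> ?g x * indicator C x"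
      using AE_torus_box
    proof eventually_elim
      case (elim x)
      have "(\<lambda>m. q m (circle_embedding x)) \<longlonglongrightarrow> indicator C x"
      proof (cases "x \<in> C")
        case True
        then have "circle_embedding x \<in> D" by (simp add: D_def)
        then show ?thesis using True by (simp add: q_def)
      next
        case False
        have "circle_embedding x \<notin> D"
        proof
          assume "circle_embedding x \<in> D"
          then obtain y where y: "y \<in> C" "circle_embedding x = circle_embedding y" by (auto simp: D_def)
          then have "x = y" using circle_embedding_inj[of x y] elim C(2) box_subset_cbox by blast
          then show False using y False by simp
        qed
        then have pos: "infdist (circle_embedding x) D > 0"
          using in_closed_iff_infdist_zero[OF D] infdist_nonneg[of "circle_embedding x" D] by (simp add: less_le)
        obtain N :: nat where N: "1 / infdist (circle_embedding x) D < real N"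
          using reals_Archimedean2 by blast
        have "q m (circle_embedding x) = 0" if "m \<ge> N" for m
        proof -
          have "1 / infdist (circle_embedding x) D < real m" using N that by (simp add: less_le_trans)
          then have "1 < real m * infdist (circle_embedding x) D" using pos by (simp add: divide_less_eq)
          then show ?thesis by (simp add: q_def)
        qed
        then show ?thesis using False
          by (intro tendsto_eventually) (auto simp: eventually_at_top_linorder)
      qed
      then show ?case by (intro tendsto_mult_left)
    qed
  qed
  moreover have "(\<integral>x. ?g x * q m (circle_embedding x) \<partial>torus) = 0" for m
    by (rule integral_mult_continuous_torus[OF f cq])
  ultimately have "(\<lambda>m::nat. 0) \<longlonglongrightarrow> (\<integral>x. ?g x * indicator C x \<partial>torus)" by (simp only:)
  then show ?thesis by (simp add: LIMSEQ_const_iff)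
qed simp

text \<open>If \<open>f\<close> had a sign on a set of positive measure, inner regularity would
  provide a compact subset of positive measure over which the integral of \<open>f\<close> is 0 by
  \<open>integral_compact_torus\<close>, a contradiction.\<close>

theorem fourier_complete:
  fixes f :: "'n::finite torus_l2"
  assumes f: "\<And>k. k \<in> int_lattice \<Longrightarrow> pairing f (fourier_mode k) = 0"
  shows "f = 0"
proof -
  interpret prob_space "torus :: (real ^ 'n) measure" by (rule prob_space_torus)
  let ?g = "rep_torus_l2 f"
  let ?O = "box 0 (\<chi> i. 2 * pi) :: (real ^ 'n) set"
  have gi: "integrable torus ?g" using square_integrable_rep[of f]
    by (auto simp: square_integrable_def intro: square_integrable_imp_integrable)
  have gm [measurable]: "?g \<in> borel_measurable borel"
    using borel_measurable_integrable[OF gi] by (simp cong: measurable_cong_sets)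
  \<comment> \<open>The factor \<open>\<sigma>\<close>, later 1 and -1, treats the sets of positive
    and of negative values together.\<close>
  have null: "emeasure torus A = 0"
    if A: "A \<in> sets borel" "A \<subseteq> ?O" and s: "\<And>x. x \<in> A \<Longrightarrow> 0 < \<sigma> * ?g x" for A and \<sigma> :: real
  proof -
    have "emeasure torus A = (SUP K \<in> {K. K \<subseteq> A \<and> compact K}. emeasure torus K)"
      by (rule inner_regular) (use A in auto)
    also have "\<dots> \<le> 0"
    proof (rule SUP_least)
      fix K assume "K \<in> {K. K \<subseteq> A \<and> compact K}"
      then have K: "K \<subseteq> A" "compact K" by auto
      have Km: "K \<in> sets torus" using K(2) by (simp add: compact_imp_closed)
      let ?h = "\<lambda>x. \<sigma> * (?g x * indicator K x)"
      have i: "integrable torus ?h"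
        using integrable_real_mult_indicator[OF Km gi] by (simp add: mult.commute)
      have "(\<integral>x. ?h x \<partial>torus) = 0"
        using integral_compact_torus[OF f K(2) order_trans[OF K(1) A(2)]] by simp
      moreover have "AE x in torus. 0 \<le> ?h x"
        using s K(1) by (auto simp: indicator_def intro!: AE_I2 less_imp_le)
      ultimately have "AE x in torus. ?h x = 0"
        using integral_nonneg_eq_0_iff_AE[OF i] by simp
      then have "AE x in torus. x \<notin> K"
      proof eventually_elim
        case (elim x)
        show ?case
        proof
          assume x: "x \<in> K"
          then show False using elim s[of x] K(1) by auto
        qed
      qed
      then show "emeasure torus K \<le> 0"
        using Km by (subst (asm) AE_iff_measurable[OF Km]) auto
    qed
    finally show ?thesis by simp
  qed
  have "AE x in torus. ?g x = 0"
  proof -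
    have p: "emeasure torus {x \<in> ?O. 0 < ?g x} = 0"
      by (rule null[of _ 1]) auto
    have n: "emeasure torus {x \<in> ?O. ?g x < 0} = 0"
      by (rule null[of _ "-1"]) auto
    have "{x \<in> ?O. 0 < ?g x} \<in> null_sets torus" "{x \<in> ?O. ?g x < 0} \<in> null_sets torus"
      using p n by (auto simp: null_sets_def)
    from AE_torus_box AE_not_in[OF this(1)] AE_not_in[OF this(2)]
    show ?thesis by eventually_elim (auto simp: not_less)
  qed
  then have "(\<integral>x. (?g x)\<^sup>2 \<partial>torus) = (\<integral>x. 0 \<partial>(torus :: (real ^ 'n) measure))"
    by (intro integral_cong_AE) auto
  then have "(norm f)\<^sup>2 = 0" unfolding norm_torus_l2_square by simp
  then show ?thesis by simp
qed

section \<open>Plane waves and isotropy of the noise\<close>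

text \<open>Cosine and sine share one family with two coefficients, which is closed under partial
  derivatives; smoothness is then an induction with the coefficients left arbitrary.\<close>

definition wave :: "real \<Rightarrow> real \<Rightarrow> real ^ 'n \<Rightarrow> real ^ 'n \<Rightarrow> real" where
  "wave \<alpha> \<beta> k x = \<alpha> * cos (k \<bullet> x) + \<beta> * sin (k \<bullet> x)"

lemma wave_has_derivative:
  "(wave \<alpha> \<beta> k has_derivative (\<lambda>h. wave \<beta> (- \<alpha>) k x * (k \<bullet> h))) (at x within S)"
  unfolding wave_def[abs_def]
  by (auto intro!: derivative_eq_intros simp: algebra_simps)

lemma partial_deriv_wave: "partial_deriv i (wave \<alpha> \<beta> k) = wave (\<beta> * k $ i) (- \<alpha> * k $ i) k"
proof
  fix x
  have "frechet_derivative (wave \<alpha> \<beta> k) (at x) = (\<lambda>h. wave \<beta> (- \<alpha>) k x * (k \<bullet> h))"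
    using frechet_derivative_at[OF wave_has_derivative[where \<alpha> = \<alpha> and \<beta> = \<beta>], symmetric] .
  then show "partial_deriv i (wave \<alpha> \<beta> k) x = wave (\<beta> * k $ i) (- \<alpha> * k $ i) k x"
    by (simp add: partial_deriv_def inner_axis wave_def algebra_simps)
qed

lemma continuous_on_wave: "continuous_on S (wave \<alpha> \<beta> k)"
  unfolding wave_def[abs_def] by (intro continuous_intros)

lemma Ck_wave: "Ck m (wave \<alpha> \<beta> k)"
proof (induction m arbitrary: \<alpha> \<beta>)
  case (Suc m)
  have "wave \<alpha> \<beta> k differentiable_on UNIV"
    unfolding differentiable_on_def differentiable_def using wave_has_derivative by blast
  with Suc show ?case by (simp add: partial_deriv_wave)
qed (simp add: continuous_on_wave)

lemma int_lattice_inner: "k \<in> int_lattice \<Longrightarrow> l \<in> int_lattice \<Longrightarrow> k \<bullet> l \<in> \<int>"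
  by (auto simp: int_lattice_def inner_vec_def)

lemma torus_smooth_wave:
  assumes "k \<in> int_lattice"
  shows "torus_smooth (wave \<alpha> \<beta> k)"
proof -
  have "wave \<alpha> \<beta> k (x + (2 * pi) *\<^sub>R l) = wave \<alpha> \<beta> k x" if l: "l \<in> int_lattice" for x l
  proof -
    obtain n :: int where n: "k \<bullet> l = n" using int_lattice_inner[OF assms l] by (auto elim: Ints_cases)
    have "k \<bullet> (x + (2 * pi) *\<^sub>R l) = k \<bullet> x + 2 * pi * n" by (simp add: inner_add_right n)
    moreover have "sin (k \<bullet> x + 2 * pi * n) = sin (k \<bullet> x) \<and> cos (k \<bullet> x + 2 * pi * n) = cos (k \<bullet> x)"
      using sin_cos_eq_iff[of "k \<bullet> x + 2 * pi * n" "k \<bullet> x"] by blast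
    ultimately show ?thesis by (simp add: wave_def)
  qed
  then show ?thesis by (simp add: torus_smooth_def Ck_wave)
qed

lemma grad_wave: "grad (wave \<alpha> \<beta> k) x = wave \<beta> (- \<alpha>) k x *\<^sub>R k"
  by (simp add: grad_def partial_deriv_wave vec_eq_iff) (simp add: wave_def algebra_simps)

lemma laplacian_wave: "laplacian (wave \<alpha> \<beta> k) x = - (k \<bullet> k) * wave \<alpha> \<beta> k x"
proof -
  have "laplacian (wave \<alpha> \<beta> k) x = (\<Sum>i\<in>UNIV. - (k $ i * k $ i) * wave \<alpha> \<beta> k x)"
    unfolding laplacian_def partial_deriv_wave by (intro sum.cong refl) (simp add: wave_def algebra_simps)
  then show ?thesis by (simp add: inner_vec_def sum_negf sum_distrib_right)
qed

section \<open>Lattice symmetries and isotropic sums\<close>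

lemma lattice_isometry_involution_bij:
  assumes "lattice_isometry R" "\<And>x. R (R x) = x"
  shows "bij_betw R int_lattice0 int_lattice0"
proof -
  have lin: "linear R" and im: "R ` int_lattice = int_lattice"
    using assms(1) by (auto simp: lattice_isometry_def orthogonal_transformation_def)
  have R: "R x \<in> int_lattice0" if "x \<in> int_lattice0" for x
  proof -
    have "R x \<noteq> 0" using assms(2)[of x] linear_0[OF lin] that by (auto simp: int_lattice0_def)
    then show ?thesis using that im by (auto simp: int_lattice0_def)
  qed
  show ?thesis by (rule bij_betwI[where g = R]) (use R assms(2) in auto)
qed

text \<open>Of the lattice isometries only two kinds are used, both involutions: reflections make
  off-diagonal second moments vanish, and the transpositions below make the diagonal ones
  equal.\<close>

definition reflect_coord :: "'n \<Rightarrow> real ^ 'n \<Rightarrow> real ^ 'n" where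
  "reflect_coord i x = (\<chi> j. if j = i then - x $ j else x $ j)"

definition swap_coords :: "'n \<Rightarrow> 'n \<Rightarrow> real ^ 'n \<Rightarrow> real ^ 'n" where
  "swap_coords i i' x = (\<chi> j. x $ (Transposition.transpose i i' j))"

lemma reflect_coord_involution: "reflect_coord i (reflect_coord i x) = x"
  by (simp add: reflect_coord_def vec_eq_iff)

lemma swap_coords_involution: "swap_coords i i' (swap_coords i i' x) = x"
  by (simp add: swap_coords_def vec_eq_iff)

lemma lattice_isometry_reflect: "lattice_isometry (reflect_coord (i :: 'n::finite))"
proof -
  define R where "R = reflect_coord i"
  note R_def = R_def reflect_coord_def[abs_def]
  have inv: "R (R x) = x" for x unfolding R_def(1) by (rule reflect_coord_involution)
  have "linear R" by (rule linearI) (auto simp: R_def vec_eq_iff)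
  moreover have "R v \<bullet> R w = v \<bullet> w" for v w
    by (simp add: R_def inner_vec_def) (intro sum.cong refl, auto)
  moreover have "R x \<in> int_lattice" if "x \<in> int_lattice" for x
    using that by (auto simp: R_def int_lattice_def)
  then have "R ` int_lattice = int_lattice" using inv by (metis (no_types, lifting) image_subset_iff subsetI subset_antisym imageI)
  ultimately show ?thesis
    unfolding R_def(1)[symmetric] by (auto simp: lattice_isometry_def orthogonal_transformation_def)
qed

lemma lattice_isometry_swap: "lattice_isometry (swap_coords (i :: 'n::finite) i')"
proof -
  define R where "R = swap_coords i i'"
  note R_def = R_def swap_coords_def[abs_def]
  have inv: "R (R x) = x" for x unfolding R_def(1) by (rule swap_coords_involution)
  have "linear R" by (rule linearI) (auto simp: R_def vec_eq_iff)
  moreover have "R v \<bullet> R w = v \<bullet> w" for v w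
  proof -
    have "(\<Sum>j\<in>UNIV. v $ (Transposition.transpose i i' j) \<bullet> w $ (Transposition.transpose i i' j)) = (\<Sum>j\<in>UNIV. v $ j \<bullet> w $ j)"
      by (rule sum.reindex_bij_betw[of "Transposition.transpose i i'"]) (simp add: bij_betw_def)
    then show ?thesis by (simp add: R_def inner_vec_def)
  qed
  moreover have "R x \<in> int_lattice" if "x \<in> int_lattice" for x
    using that by (auto simp: R_def int_lattice_def)
  then have "R ` int_lattice = int_lattice" using inv by (metis (no_types, lifting) image_subset_iff subsetI subset_antisym imageI)
  ultimately show ?thesis
    unfolding R_def(1)[symmetric] by (auto simp: lattice_isometry_def orthogonal_transformation_def)
qed

lemma has_sum_finite_sum:
  fixes f :: "'i \<Rightarrow> 'a \<Rightarrow> real"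
  assumes "\<And>i. i \<in> I \<Longrightarrow> (f i has_sum S i) A"
  shows "((\<lambda>x. \<Sum>i\<in>I. f i x) has_sum (\<Sum>i\<in>I. S i)) A"
  using assms by (induction I rule: infinite_finite_induct) (auto intro: has_sum_add)

text \<open>The matrix \<open>Q\<close> of second moments of the directions of \<open>k\<close>,
  weighted by the squares of \<open>\<theta>\<close>, commutes with the lattice symmetries and is
  hence scalar. Its trace is the sum of the squared coefficients, which fixes the factor
  1/d.\<close>

lemma has_sum_isotropic:
  fixes \<theta> :: "real ^ 'n::finite \<Rightarrow> real"
  assumes sm: "(\<lambda>k. (\<theta> k)\<^sup>2) summable_on int_lattice0"
    and inv: "\<And>k R. k \<in> int_lattice0 \<Longrightarrow> lattice_isometry R \<Longrightarrow> \<theta> (R k) = \<theta> k"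
  shows "((\<lambda>k. (\<theta> k)\<^sup>2 * (h \<bullet> k)\<^sup>2 / (k \<bullet> k)) has_sum
    (h \<bullet> h) / real CARD('n) * (\<Sum>\<^sub>\<infinity>k\<in>int_lattice0. (\<theta> k)\<^sup>2)) int_lattice0"
proof -
  define q where "q i j k = (\<theta> k)\<^sup>2 * (k $ i * k $ j) / (k \<bullet> k)" for i j and k :: "real ^ 'n"
  define Q where "Q i j = (\<Sum>\<^sub>\<infinity>k\<in>int_lattice0. q i j k)" for i j
  have sq: "q i j summable_on int_lattice0" for i j
  proof (rule abs_summable_summable, rule summable_on_comparison_test[OF sm _ norm_ge_zero])
    fix k :: "real ^ 'n" assume "k \<in> int_lattice0"
    then have k: "k \<bullet> k > 0" by (auto simp: int_lattice0_def)
    have "\<bar>k $ i * k $ j\<bar> \<le> norm k * norm k"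
      unfolding abs_mult by (intro mult_mono component_le_norm_cart) auto
    then have "(\<theta> k)\<^sup>2 * \<bar>k $ i * k $ j\<bar> \<le> (\<theta> k)\<^sup>2 * (k \<bullet> k)"
      by (intro mult_left_mono) (auto simp: dot_square_norm power2_eq_square)
    then show "norm (q i j k) \<le> (\<theta> k)\<^sup>2"
      using k by (simp add: q_def abs_mult pos_divide_le_eq)
  qed
  have off: "Q i j = 0" if "i \<noteq> j" for i j
  proof -
    define R where "R = (reflect_coord i :: real ^ 'n \<Rightarrow> _)"
    note R = lattice_isometry_reflect[of i, folded R_def] reflect_coord_involution[of i, folded R_def]
    have "Q i j = (\<Sum>\<^sub>\<infinity>k\<in>int_lattice0. q i j (R k))"
      unfolding Q_def by (rule infsum_reindex_bij_betw[OF lattice_isometry_involution_bij[OF R], symmetric])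
    also have "\<dots> = (\<Sum>\<^sub>\<infinity>k\<in>int_lattice0. - q i j k)"
    proof (rule infsum_cong)
      fix k :: "real ^ 'n" assume k: "k \<in> int_lattice0"
      have "R k \<bullet> R k = k \<bullet> k" using R(1) by (auto simp: lattice_isometry_def orthogonal_transformation_def)
      then show "q i j (R k) = - q i j k"
        using inv[OF k R(1)] that by (simp add: q_def) (simp add: R_def reflect_coord_def)
    qed
    also have "\<dots> = - Q i j" unfolding Q_def by (rule infsum_uminus)
    finally show ?thesis by simp
  qed
  have diag: "Q i i = Q j j" for i j
  proof -
    define R where "R = (swap_coords i j :: real ^ 'n \<Rightarrow> _)"
    note R = lattice_isometry_swap[of i j, folded R_def] swap_coords_involution[of i j, folded R_def]
    have "Q i i = (\<Sum>\<^sub>\<infinity>k\<in>int_lattice0. q i i (R k))"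
      unfolding Q_def by (rule infsum_reindex_bij_betw[OF lattice_isometry_involution_bij[OF R], symmetric])
    also have "\<dots> = Q j j"
      unfolding Q_def
    proof (rule infsum_cong)
      fix k :: "real ^ 'n" assume k: "k \<in> int_lattice0"
      have "R k \<bullet> R k = k \<bullet> k" using R(1) by (auto simp: lattice_isometry_def orthogonal_transformation_def)
      then show "q i i (R k) = q j j k"
        using inv[OF k R(1)] by (simp add: q_def) (simp add: R_def swap_coords_def)
    qed
    finally show ?thesis .
  qed
  define \<Theta> where "\<Theta> = (\<Sum>\<^sub>\<infinity>k\<in>int_lattice0. (\<theta> k)\<^sup>2)"
  have hq: "(q i j has_sum Q i j) int_lattice0" for i j
    unfolding Q_def using sq by (rule has_sum_infsum)
  have tr: "(\<Sum>i\<in>UNIV. Q i i) = \<Theta>"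
  proof -
    have "((\<lambda>k. \<Sum>i\<in>UNIV. q i i k) has_sum (\<Sum>i\<in>UNIV. Q i i)) int_lattice0"
      by (intro has_sum_finite_sum hq)
    moreover have "((\<lambda>k. \<Sum>i\<in>UNIV. q i i k) has_sum \<Theta>) int_lattice0"
    proof (subst has_sum_cong)
      fix k :: "real ^ 'n" assume "k \<in> int_lattice0"
      then have k: "k \<bullet> k > 0" by (auto simp: int_lattice0_def)
      have "(\<Sum>i\<in>UNIV. q i i k) = (\<theta> k)\<^sup>2 * (\<Sum>i\<in>UNIV. k $ i * k $ i) / (k \<bullet> k)"
        by (simp add: q_def sum_divide_distrib sum_distrib_left)
      also have "\<dots> = (\<theta> k)\<^sup>2" using k by (simp add: inner_vec_def)
      finally show "(\<Sum>i\<in>UNIV. q i i k) = (\<theta> k)\<^sup>2" .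
    next
      show "((\<lambda>k. (\<theta> k)\<^sup>2) has_sum \<Theta>) int_lattice0"
        unfolding \<Theta>_def using sm by (rule has_sum_infsum)
    qed
    ultimately show ?thesis by (rule has_sum_unique)
  qed
  have Qd: "Q i i = \<Theta> / real CARD('n)" for i
  proof -
    have "(\<Sum>j\<in>UNIV. Q j j) = (\<Sum>j\<in>(UNIV :: 'n set). Q i i)" by (intro sum.cong refl diag)
    then show ?thesis using tr by (simp add: field_simps)
  qed
  have "((\<lambda>k. \<Sum>i\<in>UNIV. \<Sum>j\<in>UNIV. (h $ i * h $ j) * q i j k) has_sum
      (\<Sum>i\<in>UNIV. \<Sum>j\<in>UNIV. (h $ i * h $ j) * Q i j)) int_lattice0"
    by (intro has_sum_finite_sum has_sum_cmult_right hq)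
  moreover have "(\<Sum>i\<in>UNIV. \<Sum>j\<in>UNIV. (h $ i * h $ j) * q i j k) = (\<theta> k)\<^sup>2 * (h \<bullet> k)\<^sup>2 / (k \<bullet> k)" for k
  proof -
    have "(h \<bullet> k)\<^sup>2 = (\<Sum>i\<in>UNIV. \<Sum>j\<in>UNIV. (h $ i * h $ j) * (k $ i * k $ j))"
      unfolding power2_eq_square inner_vec_def sum_product by (simp add: mult_ac)
    then show ?thesis
      by (simp add: q_def sum_distrib_left sum_divide_distrib mult_ac)
  qed
  moreover have "(\<Sum>i\<in>UNIV. \<Sum>j\<in>UNIV. (h $ i * h $ j) * Q i j) = (h \<bullet> h) / real CARD('n) * \<Theta>"
  proof -
    have "(\<Sum>j\<in>UNIV. (h $ i * h $ j) * Q i j) = (h $ i * h $ i) * (\<Theta> / real CARD('n))" for i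
    proof -
      have "(\<Sum>j\<in>UNIV. (h $ i * h $ j) * Q i j) = (\<Sum>j\<in>UNIV. if j = i then (h $ i * h $ i) * Q i i else 0)"
        by (intro sum.cong refl) (auto simp: off)
      then show ?thesis by (simp add: Qd)
    qed
    then show ?thesis by (simp add: inner_vec_def sum_distrib_right[symmetric] sum_divide_distrib[symmetric])
  qed
  ultimately show ?thesis by (simp add: \<Theta>_def)
qed

text \<open>Parseval's identity in the hyperplane orthogonal to \<open>k\<close>, for the projection
  \<open>r\<close> of \<open>h\<close>. The remainder \<open>p\<close> lies in the span of the
  vectors and is orthogonal to all of them, hence to itself.\<close>

lemma sum_inner_orthonormal_complement:
  fixes a :: "'i \<Rightarrow> 'a::euclidean_space"
  assumes J: "finite J" and on: "\<And>i j. i \<in> J \<Longrightarrow> j \<in> J \<Longrightarrow> a i \<bullet> a j = (if i = j then 1 else 0)"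
    and sp: "span (a ` J) = {k}\<^sup>\<bottom>" and k: "k \<noteq> 0"
  shows "(\<Sum>j\<in>J. (a j \<bullet> h)\<^sup>2) = h \<bullet> h - (h \<bullet> k)\<^sup>2 / (k \<bullet> k)"
proof -
  define r where "r = h - ((h \<bullet> k) / (k \<bullet> k)) *\<^sub>R k"
  define p where "p = r - (\<Sum>j\<in>J. (a j \<bullet> r) *\<^sub>R a j)"
  have ka: "a j \<bullet> k = 0" if "j \<in> J" for j
  proof -
    have "a j \<in> {k}\<^sup>\<bottom>" using sp that by (auto intro: span_base)
    then show ?thesis by (simp add: orthogonal_comp_def orthogonal_def inner_commute)
  qed
  have rk: "k \<bullet> r = 0" using k by (simp add: r_def inner_diff_right inner_commute)
  then have rs: "r \<in> span (a ` J)" unfolding sp by (simp add: orthogonal_comp_def orthogonal_def)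
  then have ps: "p \<in> span (a ` J)"
    unfolding p_def by (intro span_diff[OF rs] span_sum span_scale span_base) auto
  have "p \<bullet> a i = 0" if i: "i \<in> J" for i
  proof -
    have "(\<Sum>j\<in>J. (a j \<bullet> r) * (a j \<bullet> a i)) = (\<Sum>j\<in>J. if j = i then a i \<bullet> r else 0)"
      by (intro sum.cong refl) (auto simp: on i)
    moreover have "p \<bullet> a i = r \<bullet> a i - (\<Sum>j\<in>J. (a j \<bullet> r) * (a j \<bullet> a i))"
      by (simp add: p_def inner_diff_left inner_sum_left)
    ultimately show ?thesis using i J by (simp add: inner_commute[of r])
  qed
  then have "orthogonal p p"
    by (intro orthogonal_to_span[OF ps]) (auto simp: orthogonal_def)
  then have "p = 0" by (simp add: orthogonal_def)
  then have r: "r = (\<Sum>j\<in>J. (a j \<bullet> r) *\<^sub>R a j)" by (simp add: p_def)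
  have "r \<bullet> r = (\<Sum>j\<in>J. (a j \<bullet> r) *\<^sub>R a j) \<bullet> r" using r by simp
  also have "\<dots> = (\<Sum>j\<in>J. (a j \<bullet> r)\<^sup>2)" by (simp add: inner_sum_left power2_eq_square)
  also have "\<dots> = (\<Sum>j\<in>J. (a j \<bullet> h)\<^sup>2)"
    by (intro sum.cong refl) (simp add: r_def inner_diff_right ka)
  finally have "(\<Sum>j\<in>J. (a j \<bullet> h)\<^sup>2) = r \<bullet> r" by simp
  also have "\<dots> = h \<bullet> r" using rk by (simp add: r_def inner_diff_left)
  also have "\<dots> = h \<bullet> h - (h \<bullet> k)\<^sup>2 / (k \<bullet> k)" by (simp add: r_def inner_diff_right power2_eq_square)
  finally show ?thesis .
qed

text \<open>The origin of the constant in the equation: summing over \<open>j\<close> leaves the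
  squared length of \<open>h\<close> minus its part along \<open>k\<close>, and by isotropy the
  latter accounts on average for the fraction 1/d. What remains is the factor (d - 1)/d.\<close>

lemma has_sum_noise_index:
  fixes \<theta> :: "real ^ 'n::finite \<Rightarrow> real"
  assumes \<Lambda>: "\<Lambda> \<union> uminus ` \<Lambda> = int_lattice0"
    and on: "\<And>k j m. k \<in> \<Lambda> \<Longrightarrow> j \<in> {1..CARD('n) - 1} \<Longrightarrow> m \<in> {1..CARD('n) - 1} \<Longrightarrow>
           a j k \<bullet> a m k = (if j = m then 1 else 0)"
    and sp: "\<And>k. k \<in> \<Lambda> \<Longrightarrow> span ((\<lambda>j. a j k) ` {1..CARD('n) - 1}) = {k}\<^sup>\<bottom>"
    and am: "\<And>k j. k \<in> \<Lambda> \<Longrightarrow> j \<in> {1..CARD('n) - 1} \<Longrightarrow> a j (- k) = a j k"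
    and sm: "(\<lambda>k. (\<theta> k)\<^sup>2) summable_on int_lattice0"
    and inv: "\<And>k R. k \<in> int_lattice0 \<Longrightarrow> lattice_isometry R \<Longrightarrow> \<theta> (R k) = \<theta> k"
  shows "((\<lambda>(j, k). (\<theta> k)\<^sup>2 * (a j k \<bullet> h)\<^sup>2) has_sum
    (real CARD('n) - 1) / real CARD('n) * (\<Sum>\<^sub>\<infinity>k\<in>int_lattice0. (\<theta> k)\<^sup>2) * (h \<bullet> h)) noise_index"
proof -
  define \<Theta> where "\<Theta> = (\<Sum>\<^sub>\<infinity>k\<in>int_lattice0. (\<theta> k)\<^sup>2)"
  define g where "g k = (\<theta> k)\<^sup>2 * (h \<bullet> h) - (\<theta> k)\<^sup>2 * (h \<bullet> k)\<^sup>2 / (k \<bullet> k)" for k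
  have f: "((\<lambda>j. (\<theta> k)\<^sup>2 * (a j k \<bullet> h)\<^sup>2) has_sum g k) {1..CARD('n) - 1}" if k: "k \<in> int_lattice0" for k
  proof -
    have "(\<Sum>j\<in>{1..CARD('n) - 1}. (a j k \<bullet> h)\<^sup>2) = h \<bullet> h - (h \<bullet> k)\<^sup>2 / (k \<bullet> k)"
    proof -
      have base: "(\<Sum>j\<in>{1..CARD('n) - 1}. (a j l \<bullet> h)\<^sup>2) = h \<bullet> h - (h \<bullet> l)\<^sup>2 / (l \<bullet> l)" if l: "l \<in> \<Lambda>" for l
      proof -
        have "l \<noteq> 0" using l \<Lambda> by (auto simp: int_lattice0_def)
        from sum_inner_orthonormal_complement[OF _ on[OF l] sp[OF l] this, of h] show ?thesis by simp
      qed
      from k \<Lambda> consider "k \<in> \<Lambda>" | l where "l \<in> \<Lambda>" "k = - l" by auto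
      then show ?thesis
      proof cases
        case 2
        have "(\<Sum>j\<in>{1..CARD('n) - 1}. (a j k \<bullet> h)\<^sup>2) = (\<Sum>j\<in>{1..CARD('n) - 1}. (a j l \<bullet> h)\<^sup>2)"
          unfolding 2(2) by (intro sum.cong refl) (simp only: am[OF 2(1)])
        then show ?thesis using base[OF 2(1)] 2(2) by simp
      qed (rule base)
    qed
    then have "(\<Sum>j\<in>{1..CARD('n) - 1}. (\<theta> k)\<^sup>2 * (a j k \<bullet> h)\<^sup>2) = (\<theta> k)\<^sup>2 * (h \<bullet> h - (h \<bullet> k)\<^sup>2 / (k \<bullet> k))"
      by (simp only: sum_distrib_left[symmetric])
    then have "(\<Sum>j\<in>{1..CARD('n) - 1}. (\<theta> k)\<^sup>2 * (a j k \<bullet> h)\<^sup>2) = g k"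
      by (simp only: g_def right_diff_distrib times_divide_eq_right)
    then show ?thesis using has_sum_finite[of "{1..CARD('n) - 1}" "\<lambda>j. (\<theta> k)\<^sup>2 * (a j k \<bullet> h)\<^sup>2"] by simp
  qed
  have "((\<lambda>k. (\<theta> k)\<^sup>2 * (h \<bullet> h)) has_sum (\<Theta> * (h \<bullet> h))) int_lattice0"
    unfolding \<Theta>_def by (intro has_sum_cmult_left has_sum_infsum sm)
  moreover have "((\<lambda>k. - ((\<theta> k)\<^sup>2 * (h \<bullet> k)\<^sup>2 / (k \<bullet> k))) has_sum - ((h \<bullet> h) / real CARD('n) * \<Theta>)) int_lattice0"
    unfolding \<Theta>_def has_sum_uminus minus_minus by (rule has_sum_isotropic[OF sm]) (simp add: inv)
  ultimately have "((\<lambda>k. (\<theta> k)\<^sup>2 * (h \<bullet> h) + - ((\<theta> k)\<^sup>2 * (h \<bullet> k)\<^sup>2 / (k \<bullet> k))) has_sum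
      (\<Theta> * (h \<bullet> h) + - ((h \<bullet> h) / real CARD('n) * \<Theta>))) int_lattice0"
    by (rule has_sum_add)
  then
  have g: "(g has_sum (\<Theta> * (h \<bullet> h) - (h \<bullet> h) / real CARD('n) * \<Theta>)) int_lattice0"
    unfolding g_def[abs_def] by simp
  have "((\<lambda>(k, j). (\<theta> k)\<^sup>2 * (a j k \<bullet> h)\<^sup>2) has_sum (\<Theta> * (h \<bullet> h) - (h \<bullet> h) / real CARD('n) * \<Theta>))
      (int_lattice0 \<times> {1..CARD('n) - 1})"
  proof (rule has_sum_SigmaI)
    show "((\<lambda>j. case (k, j) of (k, j) \<Rightarrow> (\<theta> k)\<^sup>2 * (a j k \<bullet> h)\<^sup>2) has_sum g k) {1..CARD('n) - 1}"
      if "k \<in> int_lattice0" for k using f[OF that] by simp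
    show "(\<lambda>(k, j). (\<theta> k)\<^sup>2 * (a j k \<bullet> h)\<^sup>2) summable_on int_lattice0 \<times> {1..CARD('n) - 1}"
      by (rule summable_on_SigmaI[where g = g])
        (use f g in \<open>auto intro: has_sum_imp_summable\<close>)
  qed (rule g)
  then have "((\<lambda>(j, k). (\<theta> k)\<^sup>2 * (a j k \<bullet> h)\<^sup>2) has_sum (\<Theta> * (h \<bullet> h) - (h \<bullet> h) / real CARD('n) * \<Theta>))
      ({1..CARD('n) - 1} \<times> int_lattice0)"
    by (subst has_sum_swap) simp
  moreover have "\<Theta> * (h \<bullet> h) - (h \<bullet> h) / real CARD('n) * \<Theta> = (real CARD('n) - 1) / real CARD('n) * \<Theta> * (h \<bullet> h)"
    by (simp add: field_simps)
  ultimately show ?thesis unfolding noise_index_def \<Theta>_def by simp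
qed

section \<open>The energy identity\<close>

text \<open>Formally the real part of Y times the conjugate of Y' is half the derivative of the
  squared modulus of Y. For merely integrable \<open>g\<close> this follows from Fubini: the double
  integrals over the two triangles are conjugate to each other and add up to the squared modulus of
  the total integral.\<close>

lemma Re_integral_running_primitive:
  fixes g :: "real \<Rightarrow> complex" and t :: real
  defines "R \<equiv> restrict_space lborel {0..t}"
  assumes g: "integrable R g"
  shows "Re (\<integral>s. (\<integral>r. (if r \<le> s then g r else 0) \<partial>R) * cnj (g s) \<partial>R) = (norm (\<integral>s. g s \<partial>R))\<^sup>2 / 2"
proof -
  interpret finite_measure R
    unfolding R_def by (rule finite_measureI) (auto simp: emeasure_restrict_space space_restrict_space emeasure_lborel_Icc_eq)
  interpret RR: pair_sigma_finite R R ..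
  have [measurable]: "g \<in> borel_measurable R" using g by auto
  have [measurable]: "(\<lambda>x. x) \<in> borel_measurable R"
    unfolding R_def by (auto intro!: measurable_restrict_space1)
  define f1 where "f1 s r = (if r \<le> s then g r else 0) * cnj (g s)" for s r
  define f2 where "f2 s r = (if s \<le> r then g r else 0) * cnj (g s)" for s r
  have int1: "integrable R (\<lambda>r. if r \<le> s then g r else 0)" for s
    by (rule Bochner_Integration.integrable_bound[OF g]) (auto simp: measurable_If)
  have int2: "integrable R (\<lambda>r. if s \<le> r then g r else 0)" for s
    by (rule Bochner_Integration.integrable_bound[OF g]) (auto simp: measurable_If)
  have intp: "integrable (R \<Otimes>\<^sub>M R) (\<lambda>(s, r). g r * cnj (g s))"
  proof (rule RR.Fubini_integrable)
    show "(\<lambda>(s, r). g r * cnj (g s)) \<in> borel_measurable (R \<Otimes>\<^sub>M R)"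
      using measurable_compose[OF measurable_fst, of "\<lambda>s. cnj (g s)" R borel R]
        borel_measurable_continuous_on[OF continuous_on_cnj[OF continuous_on_id], of g R]
      by (simp add: split_beta')
    have "(\<integral>r. norm (g r * cnj (g s)) \<partial>R) = (\<integral>r. norm (g r) \<partial>R) * norm (g s)" for s
      by (simp add: norm_mult)
    then show "integrable R (\<lambda>s. \<integral>r. norm (case (s, r) of (s, r) \<Rightarrow> g r * cnj (g s)) \<partial>R)"
      using g by simp
    show "AE s in R. integrable R (\<lambda>r. case (s, r) of (s, r) \<Rightarrow> g r * cnj (g s))"
      using g by simp
  qed
  have f2i: "integrable (R \<Otimes>\<^sub>M R) (case_prod f2)"
  proof (rule Bochner_Integration.integrable_bound[OF intp])
    have "case_prod f2 = (\<lambda>p. if fst p \<le> snd p then (case p of (s, r) \<Rightarrow> g r * cnj (g s)) else 0)"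
      by (auto simp: f2_def fun_eq_iff)
    moreover have "(\<lambda>p. if fst p \<le> snd p then (case p of (s, r) \<Rightarrow> g r * cnj (g s)) else 0) \<in> borel_measurable (R \<Otimes>\<^sub>M R)"
      using borel_measurable_integrable[OF intp] by measurable
    ultimately show "case_prod f2 \<in> borel_measurable (R \<Otimes>\<^sub>M R)" by simp
  qed (auto simp: f2_def)
  define A where "A = (\<integral>s. (\<integral>r. f1 s r \<partial>R) \<partial>R)"
  define D where "D = (\<integral>s. (\<integral>r. f2 s r \<partial>R) \<partial>R)"
  have "D = (\<integral>r. (\<integral>s. f2 s r \<partial>R) \<partial>R)"
    unfolding D_def by (rule RR.Fubini_integral[OF f2i, symmetric])
  also have "\<dots> = (\<integral>r. cnj (\<integral>s. f1 r s \<partial>R) \<partial>R)"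
    unfolding Bochner_Integration.integral_cnj[symmetric]
    by (intro Bochner_Integration.integral_cong refl) (auto simp: f1_def f2_def)
  also have "\<dots> = cnj A" unfolding A_def by (rule Bochner_Integration.integral_cnj)
  finally have D: "D = cnj A" .
  \<comment> \<open>The diagonal is counted in both triangles, but it is a null set.\<close>
  have split: "(\<integral>r. (if r \<le> s then g r else 0) \<partial>R) + (\<integral>r. (if s \<le> r then g r else 0) \<partial>R) = (\<integral>r. g r \<partial>R)" for s
  proof -
    have "AE r in lborel. r \<noteq> s" by (rule AE_lborel_singleton)
    then have "AE r in R. r \<noteq> s"
      unfolding R_def by (subst AE_restrict_space_iff) auto
    then have "AE r in R. (if r \<le> s then g r else 0) + (if s \<le> r then g r else 0) = g r"
      by eventually_elim auto
    then have "(\<integral>r. (if r \<le> s then g r else 0) + (if s \<le> r then g r else 0) \<partial>R) = (\<integral>r. g r \<partial>R)"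
      by (intro integral_cong_AE borel_measurable_add borel_measurable_integrable[OF int1] borel_measurable_integrable[OF int2]) auto
    then show ?thesis
      by (simp only: Bochner_Integration.integral_add[OF int1 int2])
  qed
  have i1: "integrable R (\<lambda>s. (\<integral>r. g r \<partial>R) * cnj (g s) - (\<integral>r. f2 s r \<partial>R))"
    using g RR.integrable_fst[OF f2i] by auto
  have "A = (\<integral>s. (\<integral>r. g r \<partial>R) * cnj (g s) - (\<integral>r. f2 s r \<partial>R) \<partial>R)"
    unfolding A_def
  proof (intro Bochner_Integration.integral_cong refl)
    fix s
    have "(\<integral>r. f1 s r \<partial>R) + (\<integral>r. f2 s r \<partial>R) = (\<integral>r. g r \<partial>R) * cnj (g s)"
      unfolding f1_def f2_def by (simp add: distrib_right[symmetric] split)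
    then show "(\<integral>r. f1 s r \<partial>R) = (\<integral>r. g r \<partial>R) * cnj (g s) - (\<integral>r. f2 s r \<partial>R)"
      by (simp add: eq_diff_eq)
  qed
  also have "\<dots> = (\<integral>r. g r \<partial>R) * cnj (\<integral>s. g s \<partial>R) - D"
    using g RR.integrable_fst[OF f2i] unfolding D_def by simp
  finally have "A + cnj A = of_real ((norm (\<integral>s. g s \<partial>R))\<^sup>2)"
    unfolding D complex_norm_square by (simp only: eq_diff_eq)
  then have "2 * Re A = (norm (\<integral>s. g s \<partial>R))\<^sup>2"
    by (simp add: complex_eq_iff)
  moreover have "A = (\<integral>s. (\<integral>r. (if r \<le> s then g r else 0) \<partial>R) * cnj (g s) \<partial>R)"
    unfolding A_def f1_def by simp
  ultimately show ?thesis by simp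
qed

lemma csquare_integrable_AE_cong:
  assumes "AE x in P. f x = g x" "f \<in> borel_measurable P" "csquare_integrable P g"
  shows "csquare_integrable P f"
  unfolding csquare_integrable_def
proof
  have "integrable P (\<lambda>x. (norm (f x))\<^sup>2) \<longleftrightarrow> integrable P (\<lambda>x. (norm (g x))\<^sup>2)"
    by (rule integrable_cong_AE)
      (use assms in \<open>auto simp: csquare_integrable_def elim!: eventually_mono\<close>)
  then show "integrable P (\<lambda>x. (norm (f x))\<^sup>2)"
    using assms(3) by (auto simp: csquare_integrable_def)
qed fact

lemma (in finite_measure) csquare_integrable_imp_integrable:
  assumes "csquare_integrable M f"
  shows "integrable M f"
  using csquare_integrable_mult[OF assms csquare_integrable_const[of 1]] by simp

lemma (in finite_measure) norm_integral_square_le: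
  assumes "csquare_integrable M f"
  shows "(norm (\<integral>x. f x \<partial>M))\<^sup>2 \<le> measure M (space M) * (\<integral>x. (norm (f x))\<^sup>2 \<partial>M)"
proof -
  have "norm (l2_inner M f (\<lambda>x. 1)) \<le> sqrt (\<integral>x. (norm (f x))\<^sup>2 \<partial>M) * sqrt (\<integral>x. (norm (1::complex))\<^sup>2 \<partial>M)"
    by (rule l2_inner_Cauchy_Schwarz[OF assms csquare_integrable_const])
  then have "norm (\<integral>x. f x \<partial>M) \<le> sqrt (\<integral>x. (norm (f x))\<^sup>2 \<partial>M) * sqrt (measure M (space M))"
    by (simp add: l2_inner_def)
  from power_mono[OF this norm_ge_zero, of 2] show ?thesis
    by (simp add: power_mult_distrib mult.commute)
qed

context filtered_prob_space
begin

text \<open>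
  This is the Ito formula for \<open>\<bar>X\<bar>\<^sup>2\<close> in expectation, obtained without stochastic calculus: pathwise,
  \<open>\<bar>S\<^sub>t\<bar>\<^sup>2 = \<bar>X\<^sub>t\<bar>\<^sup>2 + 2\<lambda> \<integral>\<bar>X\<^sub>s\<bar>\<^sup>2 ds - 2\<lambda> Re \<integral> cnj X\<^sub>s (S\<^sub>t - S\<^sub>s) ds\<close>, and the last term has mean zero by
  the martingale property.
\<close>

lemma energy_identity:
  fixes X S :: "real \<Rightarrow> 'w \<Rightarrow> complex" and \<mu> T :: real
  assumes X: "progressively_measurable F T X"
    and X2: "(\<integral>\<^sup>+s\<in>{0..T}. (\<integral>\<^sup>+\<omega>. ennreal ((norm (X s \<omega>))\<^sup>2) \<partial>M) \<partial>lborel) < \<infinity>"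
    and S2: "\<And>t. t \<in> {0..T} \<Longrightarrow> csquare_integrable M (S t)"
    and eq: "AE \<omega> in M. \<forall>t\<in>{0..T}. X t \<omega> = - complex_of_real \<mu> * (LINT s:{0..t}|lborel. X s \<omega>) - S t \<omega>"
    and orth: "\<And>s t Z. 0 \<le> s \<Longrightarrow> s \<le> t \<Longrightarrow> t \<le> T \<Longrightarrow> Z \<in> borel_measurable (F s) \<Longrightarrow> csquare_integrable M Z
      \<Longrightarrow> l2_inner M (S t) Z = l2_inner M (S s) Z"
    and t: "t \<in> {0..T}"
  shows "csquare_integrable M (X t)"
    and "(\<integral>\<omega>. (norm (X t \<omega>))\<^sup>2 \<partial>M) + 2 * \<mu> * (\<integral>(s, \<omega>). (norm (X s \<omega>))\<^sup>2 \<partial>time_space t)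
      = (\<integral>\<omega>. (norm (S t \<omega>))\<^sup>2 \<partial>M)"
proof -
  define R where "R = restrict_space lborel {0..t}"
  interpret R: finite_measure R unfolding R_def by (rule finite_measure_time)
  interpret RM: pair_sigma_finite R M ..
  interpret TS: finite_measure "time_space t" by (rule finite_measure_time_space)
  have ts: "time_space t = R \<Otimes>\<^sub>M M" by (simp add: time_space_def R_def)
  have t0: "0 \<le> t" "t \<le> T" using t by auto
  have spR: "space R = {0..t}" by (simp add: R_def space_restrict_space)
  define Xp where "Xp = (\<lambda>(s, \<omega>). X s \<omega>)"
  have Xpm [measurable]: "Xp \<in> borel_measurable (R \<Otimes>\<^sub>M M)"
    using progressively_measurable_time_space[OF X t] by (simp add: ts Xp_def)
  have Xp2: "csquare_integrable (R \<Otimes>\<^sub>M M) Xp"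
    unfolding csquare_integrable_iff
  proof
    have "(\<integral>\<^sup>+x. ennreal ((norm (Xp x))\<^sup>2) \<partial>time_space t)
        = (\<integral>\<^sup>+s\<in>{0..t}. (\<integral>\<^sup>+\<omega>. ennreal ((norm (X s \<omega>))\<^sup>2) \<partial>M) \<partial>lborel)"
      by (subst nn_integral_time_space) (simp_all add: ts, simp add: Xp_def)
    also have "\<dots> < \<infinity>"
      using nn_integral_time_space_le[OF t0] X2 by (rule order_le_less_trans)
    finally show "(\<integral>\<^sup>+x. ennreal ((norm (Xp x))\<^sup>2) \<partial>(R \<Otimes>\<^sub>M M)) < \<infinity>" by (simp add: ts)
  qed (rule Xpm)
  define V where "V \<omega> = (\<integral>s. (norm (X s \<omega>))\<^sup>2 \<partial>R)" for \<omega>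
  have Xn: "integrable (R \<Otimes>\<^sub>M M) (case_prod (\<lambda>s \<omega>. (norm (X s \<omega>))\<^sup>2))"
    using csquare_integrableD(2)[OF Xp2] by (simp add: Xp_def split_beta')
  have Vi: "integrable M V" unfolding V_def using RM.integrable_snd[OF Xn] .
  have VE: "(\<integral>\<omega>. V \<omega> \<partial>M) = (\<integral>(s, \<omega>). (norm (X s \<omega>))\<^sup>2 \<partial>time_space t)"
    unfolding V_def ts using RM.integral_snd[OF Xn] .
  have V0: "0 \<le> V \<omega>" for \<omega> by (simp add: V_def)
  have sec: "(\<lambda>s. X s \<omega>) \<in> borel_measurable R" if "\<omega> \<in> space M" for \<omega>
    using measurable_compose[OF measurable_Pair2'[OF that] Xpm] by (simp add: Xp_def)
  have path: "AE \<omega> in M. csquare_integrable R (\<lambda>s. X s \<omega>)"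
    using RM.AE_integrable_snd[OF Xn] AE_space
    by eventually_elim (auto simp: csquare_integrable_def sec)
  \<comment> \<open>The running integral of the path. The truncation sits inside the integrand, so
    that joint measurability in \<open>s\<close> and \<open>\<omega>\<close> follows from that of
    \<open>X\<close>.\<close>
  define Y where "Y s \<omega> = (\<integral>r. (if r \<le> s then X r \<omega> else 0) \<partial>R)" for s \<omega>
  define Yp where "Yp = (\<lambda>(s, \<omega>). Y s \<omega>)"
  have Ypm: "Yp \<in> borel_measurable (R \<Otimes>\<^sub>M M)"
  proof -
    have idR [measurable]: "(\<lambda>x. x) \<in> borel_measurable R"
      unfolding R_def by (auto intro!: measurable_restrict_space1)
    have "(\<lambda>q. (snd q, snd (fst q))) \<in> measurable ((R \<Otimes>\<^sub>M M) \<Otimes>\<^sub>M R) (R \<Otimes>\<^sub>M M)" by measurable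
    from measurable_compose[OF this Xpm]
    have [measurable]: "(\<lambda>q. X (snd q) (snd (fst q))) \<in> borel_measurable ((R \<Otimes>\<^sub>M M) \<Otimes>\<^sub>M R)"
      by (simp add: Xp_def)
    have [measurable]: "(\<lambda>q. snd q) \<in> borel_measurable ((R \<Otimes>\<^sub>M M) \<Otimes>\<^sub>M R)"
      "(\<lambda>q. fst (fst q)) \<in> borel_measurable ((R \<Otimes>\<^sub>M M) \<Otimes>\<^sub>M R)"
      by (rule measurable_compose[OF measurable_snd idR])
        (rule measurable_compose[OF measurable_compose[OF measurable_fst measurable_fst] idR])
    have "(\<lambda>q. if snd q \<le> fst (fst q) then X (snd q) (snd (fst q)) else 0)
        \<in> borel_measurable ((R \<Otimes>\<^sub>M M) \<Otimes>\<^sub>M R)" by measurable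
    then have "case_prod (\<lambda>p r. if r \<le> fst p then X r (snd p) else 0) \<in> borel_measurable ((R \<Otimes>\<^sub>M M) \<Otimes>\<^sub>M R)"
      by (simp add: split_beta')
    from R.borel_measurable_lebesgue_integral[OF this]
    show ?thesis by (simp add: Yp_def Y_def split_beta')
  qed
  \<comment> \<open>Cauchy-Schwarz in time, with a bound that is uniform in
    \<open>s\<close>.\<close>
  have Yle: "(norm (Y s \<omega>))\<^sup>2 \<le> t * V \<omega>" if c: "csquare_integrable R (\<lambda>s. X s \<omega>)" for s \<omega>
  proof -
    have idR [measurable]: "(\<lambda>x. x) \<in> borel_measurable R"
      unfolding R_def by (auto intro!: measurable_restrict_space1)
    have [measurable]: "(\<lambda>s. X s \<omega>) \<in> borel_measurable R" using c by (simp add: csquare_integrable_def)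
    have "csquare_integrable R (\<lambda>r. (if r \<le> s then 1 else 0) * X r \<omega>)"
      by (rule csquare_integrable_bounded_mult[OF c, of _ 1]) auto
    then have c': "csquare_integrable R (\<lambda>r. if r \<le> s then X r \<omega> else 0)"
      by (rule csquare_integrable_AE_cong[rotated 2]) auto
    have "measure R (space R) = t"
      using t0 by (simp add: spR) (simp add: R_def measure_restrict_space)
    with R.norm_integral_square_le[OF c']
    have "(norm (Y s \<omega>))\<^sup>2 \<le> t * (\<integral>r. (norm (if r \<le> s then X r \<omega> else 0))\<^sup>2 \<partial>R)"
      unfolding Y_def by simp
    also have "\<dots> \<le> t * V \<omega>"
      unfolding V_def using t0 csquare_integrableD(2)[OF c] csquare_integrableD(2)[OF c']
      by (intro mult_left_mono integral_mono) auto
    finally show ?thesis .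
  qed
  have Yp2: "csquare_integrable (R \<Otimes>\<^sub>M M) Yp"
    unfolding csquare_integrable_def
  proof
    have 1: "integrable (R \<Otimes>\<^sub>M M) (\<lambda>p. t * V (snd p))"
    proof (rule RM.Fubini_integrable)
      show "(\<lambda>p. t * V (snd p)) \<in> borel_measurable (R \<Otimes>\<^sub>M M)"
        using borel_measurable_integrable[OF Vi] by measurable
    qed (use Vi in auto)
    show "integrable (R \<Otimes>\<^sub>M M) (\<lambda>p. (norm (Yp p))\<^sup>2)"
    proof (rule Bochner_Integration.integrable_bound[OF 1])
      show "(\<lambda>p. (norm (Yp p))\<^sup>2) \<in> borel_measurable (R \<Otimes>\<^sub>M M)" using Ypm by measurable
      have "AE \<omega> in M. \<forall>s. (norm (Y s \<omega>))\<^sup>2 \<le> t * V \<omega>"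
        using path by eventually_elim (use Yle in blast)
      then have "AE \<omega> in M. norm ((norm (Yp (s, \<omega>)))\<^sup>2) \<le> norm (t * V (snd (s, \<omega>)))" for s
        by eventually_elim (use t0 V0 in \<open>auto simp: Yp_def abs_mult\<close>)
      then have "AE s in R. AE \<omega> in M. norm ((norm (Yp (s, \<omega>)))\<^sup>2) \<le> norm (t * V (snd (s, \<omega>)))"
        by (rule AE_I2)
      then show "AE p in R \<Otimes>\<^sub>M M. norm ((norm (Yp p))\<^sup>2) \<le> norm (t * V (snd p))"
      proof (rule RM.AE_pair_measure[rotated])
        show "{p \<in> space (R \<Otimes>\<^sub>M M). norm ((norm (Yp p))\<^sup>2) \<le> norm (t * V (snd p))} \<in> sets (R \<Otimes>\<^sub>M M)"
          using Ypm borel_measurable_integrable[OF Vi] by measurable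
      qed
    qed
  qed (rule Ypm)
  have eq': "AE \<omega> in M. \<forall>s\<in>{0..t}. S s \<omega> = - X s \<omega> - \<mu> * Y s \<omega>"
    using eq
  proof eventually_elim
    case (elim \<omega>)
    show ?case
    proof
      fix s assume s: "s \<in> {0..t}"
      have "(LINT r:{0..s}|lborel. X r \<omega>) = Y s \<omega>"
        unfolding Y_def R_def set_lebesgue_integral_def
        by (subst integral_restrict_space)
          (use s in \<open>auto intro!: Bochner_Integration.integral_cong simp: indicator_def\<close>)
      with elim s t0 show "S s \<omega> = - X s \<omega> - \<mu> * Y s \<omega>" by auto
    qed
  qed
  have Ym: "Y s \<in> borel_measurable M" if "s \<in> {0..t}" for s
  proof -
    have "(\<lambda>\<omega>. (s, \<omega>)) \<in> measurable M (R \<Otimes>\<^sub>M M)"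
      using that by (intro measurable_Pair1') (simp add: spR)
    from measurable_compose[OF this Ypm] show ?thesis by (simp add: Yp_def)
  qed
  have Y2: "csquare_integrable M (Y s)" if s: "s \<in> {0..t}" for s
    unfolding csquare_integrable_def
  proof
    show "integrable M (\<lambda>\<omega>. (norm (Y s \<omega>))\<^sup>2)"
    proof (rule Bochner_Integration.integrable_bound[OF integrable_mult_right[OF Vi, of t]])
      show "(\<lambda>\<omega>. (norm (Y s \<omega>))\<^sup>2) \<in> borel_measurable M" using Ym[OF s] by measurable
      show "AE \<omega> in M. norm ((norm (Y s \<omega>))\<^sup>2) \<le> norm (t * V \<omega>)"
        using path by eventually_elim (use Yle t0 V0 in \<open>auto simp: abs_mult\<close>)
    qed
  qed (rule Ym[OF s])
  have Xm: "X s \<in> borel_measurable M" if "s \<in> {0..t}" for s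
    using progressively_measurable_adapted[OF X, of s] measurable_filtration[of s] that t0 by auto
  \<comment> \<open>\<open>X2\<close> bounds second moments only after integration in time. The
    equation expresses \<open>X s\<close> by \<open>S s\<close> and the running integral, which
    gives a finite second moment at every single time.\<close>
  have X2s: "csquare_integrable M (X s)" if s: "s \<in> {0..t}" for s
  proof (rule csquare_integrable_AE_cong[OF _ Xm[OF s]])
    show "AE \<omega> in M. X s \<omega> = (- \<mu>) * Y s \<omega> + (-1) * S s \<omega>"
      using eq' by eventually_elim (use s in auto)
    show "csquare_integrable M (\<lambda>\<omega>. (- \<mu>) * Y s \<omega> + (-1) * S s \<omega>)"
      using s t0 by (intro csquare_integrable_add csquare_integrable_scale Y2 S2) auto
  qed
  have tt: "t \<in> {0..t}" using t0 by simp
  show "csquare_integrable M (X t)" by (rule X2s[OF tt])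
  \<comment> \<open>By the equation this is \<open>(S t - S s) * cnj (X s)\<close>. It is written
    without \<open>S s\<close> because joint measurability of \<open>S\<close> in time and
    \<open>\<omega>\<close> is not among the hypotheses.\<close>
  define \<Psi> where "\<Psi> s \<omega> = (S t \<omega> + X s \<omega> + \<mu> * Y s \<omega>) * cnj (X s \<omega>)" for s \<omega>
  have Sp2: "csquare_integrable (R \<Otimes>\<^sub>M M) (\<lambda>p. S t (snd p))"
    unfolding csquare_integrable_def
  proof
    have Sm [measurable]: "S t \<in> borel_measurable M" and Si: "integrable M (\<lambda>\<omega>. (norm (S t \<omega>))\<^sup>2)"
      using csquare_integrableD[OF S2[OF t]] by auto
    show "(\<lambda>p. S t (snd p)) \<in> borel_measurable (R \<Otimes>\<^sub>M M)" by measurable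
    show "integrable (R \<Otimes>\<^sub>M M) (\<lambda>p. (norm (S t (snd p)))\<^sup>2)"
    proof (rule RM.Fubini_integrable)
      show "(\<lambda>p. (norm (S t (snd p)))\<^sup>2) \<in> borel_measurable (R \<Otimes>\<^sub>M M)" by measurable
    qed (use Si in auto)
  qed
  have \<Psi>i: "integrable (R \<Otimes>\<^sub>M M) (case_prod \<Psi>)"
    using csquare_integrable_mult_cnj[OF csquare_integrable_add[OF csquare_integrable_add[OF Sp2 Xp2]
        csquare_integrable_scale[OF Yp2, of \<mu>]] Xp2]
    by (simp add: \<Psi>_def[abs_def] Xp_def Yp_def split_beta')
  \<comment> \<open>The martingale property applied with \<open>X s\<close> itself as the past
    variable.\<close>
  have \<Psi>0: "(\<integral>\<omega>. \<Psi> s \<omega> \<partial>M) = 0" if s: "s \<in> {0..t}" for s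
  proof -
    have s': "0 \<le> s" "s \<le> t" "s \<in> {0..T}" using s t0 by auto
    have "(\<integral>\<omega>. \<Psi> s \<omega> \<partial>M) = l2_inner M (\<lambda>\<omega>. S t \<omega> - S s \<omega>) (X s)"
      unfolding l2_inner_def
    proof (rule integral_cong_AE)
      show "AE \<omega> in M. \<Psi> s \<omega> = (S t \<omega> - S s \<omega>) * cnj (X s \<omega>)"
        using eq' by eventually_elim (use s in \<open>auto simp: \<Psi>_def\<close>)
      show "(\<lambda>\<omega>. (S t \<omega> - S s \<omega>) * cnj (X s \<omega>)) \<in> borel_measurable M"
        using csquare_integrable_mult_cnj[OF csquare_integrable_diff[OF S2[OF t] S2[OF s'(3)]] X2s[OF s]] by auto
      show "\<Psi> s \<in> borel_measurable M"
        using csquare_integrable_mult_cnj[OF csquare_integrable_add[OF csquare_integrable_add[OF S2[OF t] X2s[OF s]]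
            csquare_integrable_scale[OF Y2[OF s], of \<mu>]] X2s[OF s]] by (auto simp: \<Psi>_def[abs_def])
    qed
    also have "\<dots> = l2_inner M (S t) (X s) - l2_inner M (S s) (X s)"
      by (rule l2_inner_diff_left[OF S2[OF t] S2[OF s'(3)] X2s[OF s]])
    also have "\<dots> = 0"
      using orth[OF s'(1,2) t0(2) progressively_measurable_adapted[OF X s'(3)] X2s[OF s]] by simp
    finally show ?thesis .
  qed
  have "(\<integral>\<omega>. (\<integral>s. \<Psi> s \<omega> \<partial>R) \<partial>M) = (\<integral>s. (\<integral>\<omega>. \<Psi> s \<omega> \<partial>M) \<partial>R)"
    by (rule RM.Fubini_integral[OF \<Psi>i])
  also have "\<dots> = (\<integral>s. 0 \<partial>R)"
    by (intro Bochner_Integration.integral_cong refl) (simp add: \<Psi>0 spR)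
  finally have \<Psi>E: "(\<integral>\<omega>. (\<integral>s. \<Psi> s \<omega> \<partial>R) \<partial>M) = 0" by simp
  have \<Psi>R: "integrable M (\<lambda>\<omega>. \<integral>s. \<Psi> s \<omega> \<partial>R)" by (rule RM.integrable_snd[OF \<Psi>i])
  have pw: "AE \<omega> in M. (norm (S t \<omega>))\<^sup>2 + 2 * \<mu> * Re (\<integral>s. \<Psi> s \<omega> \<partial>R) = (norm (X t \<omega>))\<^sup>2 + 2 * \<mu> * V \<omega>"
    using eq' path RM.AE_integrable_snd[OF \<Psi>i]
  proof eventually_elim
    case (elim \<omega>)
    define x y where "x = X t \<omega>" and "y = Y t \<omega>"
    have S: "S t \<omega> = - x - \<mu> * y" using elim(1) tt by (auto simp: x_def y_def)
    have gi: "integrable R (\<lambda>s. X s \<omega>)" by (rule R.csquare_integrable_imp_integrable[OF elim(2)])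
    have yR: "y = (\<integral>s. X s \<omega> \<partial>R)"
      unfolding y_def Y_def by (intro Bochner_Integration.integral_cong refl) (simp add: spR)
    have iA: "integrable R (\<lambda>s. S t \<omega> * cnj (X s \<omega>))" using gi by auto
    have iB: "integrable R (\<lambda>s. X s \<omega> * cnj (X s \<omega>))" by (rule csquare_integrable_mult_cnj[OF elim(2) elim(2)])
    have e: "\<Psi> s \<omega> = (S t \<omega> * cnj (X s \<omega>) + X s \<omega> * cnj (X s \<omega>)) + \<mu> * (Y s \<omega> * cnj (X s \<omega>))" for s
      by (simp add: \<Psi>_def algebra_simps)
    define z where "z = (\<integral>s. Y s \<omega> * cnj (X s \<omega>) \<partial>R)"
    have "(\<integral>s. \<Psi> s \<omega> \<partial>R) = S t \<omega> * cnj y + of_real (V \<omega>) + \<mu> * z"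
    proof (cases "\<mu> = 0")
      case True
      then show ?thesis
        unfolding e yR V_def using iA iB
        by (simp add: complex_norm_square[symmetric] del: of_real_power)
    next
      case False
      have iC: "integrable R (\<lambda>s. \<mu> * (Y s \<omega> * cnj (X s \<omega>)))"
      proof -
        have "integrable R (\<lambda>s. \<Psi> s \<omega> - (S t \<omega> * cnj (X s \<omega>) + X s \<omega> * cnj (X s \<omega>)))"
          using elim(3) iA iB by auto
        then show ?thesis by (simp add: e)
      qed
      have "(\<integral>s. \<Psi> s \<omega> \<partial>R) = (\<integral>s. S t \<omega> * cnj (X s \<omega>) \<partial>R) + (\<integral>s. X s \<omega> * cnj (X s \<omega>) \<partial>R)
          + (\<integral>s. \<mu> * (Y s \<omega> * cnj (X s \<omega>)) \<partial>R)"
        unfolding e by (simp only: Bochner_Integration.integral_add iA iB iC Bochner_Integration.integrable_add)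
      then show ?thesis
        unfolding yR V_def z_def
        by (simp add: complex_norm_square[symmetric] del: of_real_power)
    qed
    moreover have "Re z = (norm y)\<^sup>2 / 2"
      unfolding z_def Y_def yR using Re_integral_running_primitive[OF gi[unfolded R_def]] by (simp add: R_def)
    ultimately have re: "Re (\<integral>s. \<Psi> s \<omega> \<partial>R) = Re (S t \<omega> * cnj y) + V \<omega> + \<mu> * ((norm y)\<^sup>2 / 2)"
      by simp
    have "(norm (S t \<omega>))\<^sup>2 = (norm x)\<^sup>2 + 2 * \<mu> * Re (x * cnj y) + \<mu>\<^sup>2 * (norm y)\<^sup>2"
      unfolding S cmod_power2 by (simp add: power2_eq_square algebra_simps)
    moreover have "Re (S t \<omega> * cnj y) = - Re (x * cnj y) - \<mu> * (norm y)\<^sup>2"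
      unfolding S cmod_power2 by (simp add: power2_eq_square algebra_simps)
    moreover have "ns + 2 * \<mu> * (w + V \<omega> + \<mu> * (ny / 2)) = nx + 2 * \<mu> * V \<omega>"
      if "ns = nx + 2 * \<mu> * u + \<mu>\<^sup>2 * ny" "w = - u - \<mu> * ny" for ns nx u w ny
      unfolding that by (simp add: power2_eq_square algebra_simps)
    ultimately show ?case unfolding re x_def[symmetric] by blast
  qed
  have Si: "integrable M (\<lambda>\<omega>. (norm (S t \<omega>))\<^sup>2)" using csquare_integrableD(2)[OF S2[OF t]] .
  have Xi: "integrable M (\<lambda>\<omega>. (norm (X t \<omega>))\<^sup>2)" using csquare_integrableD(2)[OF X2s[OF tt]] .
  have "(\<integral>\<omega>. (norm (S t \<omega>))\<^sup>2 + 2 * \<mu> * Re (\<integral>s. \<Psi> s \<omega> \<partial>R) \<partial>M)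
      = (\<integral>\<omega>. (norm (X t \<omega>))\<^sup>2 + 2 * \<mu> * V \<omega> \<partial>M)"
    by (rule integral_cong_AE) (use pw Si Xi Vi \<Psi>R in auto)
  moreover have "(\<integral>\<omega>. (norm (S t \<omega>))\<^sup>2 + 2 * \<mu> * Re (\<integral>s. \<Psi> s \<omega> \<partial>R) \<partial>M) = (\<integral>\<omega>. (norm (S t \<omega>))\<^sup>2 \<partial>M)"
    using Si \<Psi>R \<Psi>E by (simp add: integral_Re)
  moreover have "(\<integral>\<omega>. (norm (X t \<omega>))\<^sup>2 + 2 * \<mu> * V \<omega> \<partial>M) = (\<integral>\<omega>. (norm (X t \<omega>))\<^sup>2 \<partial>M) + 2 * \<mu> * (\<integral>\<omega>. V \<omega> \<partial>M)"
    using Xi Vi by simp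
  ultimately show "(\<integral>\<omega>. (norm (X t \<omega>))\<^sup>2 \<partial>M) + 2 * \<mu> * (\<integral>(s, \<omega>). (norm (X s \<omega>))\<^sup>2 \<partial>time_space t)
      = (\<integral>\<omega>. (norm (S t \<omega>))\<^sup>2 \<partial>M)"
    by (simp only: VE)
qed

end

section \<open>Integrals against the divergence free noise\<close>

context filtered_prob_space
begin

text \<open>Replacing \<open>k\<close> by its representative \<open>l\<close> in
  \<open>\<Lambda>\<close> and a sign \<open>\<sigma>\<close> brings both branches of
  \<open>complex_noise\<close> to a common form.\<close>

lemma complex_noise_brownian_pair:
  fixes \<Lambda> :: "(real ^ 'n) set"
  assumes \<Lambda>: "\<Lambda> \<inter> uminus ` \<Lambda> = {}" "\<Lambda> \<union> uminus ` \<Lambda> = int_lattice0" and jk: "(j, k) \<in> noise_index"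
  obtains l \<sigma> where "l \<in> \<Lambda>" "(k = l \<and> \<sigma> = 1) \<or> (k = - l \<and> \<sigma> = - 1)" "(j, l) \<in> noise_index" "(j, - l) \<in> noise_index"
    "l \<noteq> - l"
    "complex_noise \<Lambda> B j k = (\<lambda>t \<omega>. Complex (B (j, l) t \<omega>) (\<sigma> * B (j, - l) t \<omega>))"
proof (cases "k \<in> \<Lambda>")
  case True
  have "- k \<in> int_lattice0" using True \<Lambda>(2) by auto
  moreover have "k \<noteq> - k"
  proof
    assume "k = - k"
    then have "k \<in> uminus ` \<Lambda>" using True by (rule image_eqI)
    then show False using True \<Lambda>(1) by blast
  qed
  ultimately show ?thesis
    using that[of k 1] True jk by (auto simp: complex_noise_def noise_index_def fun_eq_iff)
next
  case False
  have "k \<in> uminus ` \<Lambda>" using False jk \<Lambda>(2) by (auto simp: noise_index_def)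
  then have m: "- k \<in> \<Lambda>" by auto
  then have "- k \<in> int_lattice0" using \<Lambda>(2) by auto
  moreover have "k \<noteq> - k" using False m by metis
  ultimately show ?thesis
    using that[of "- k" "- 1"] False jk m
    by (auto simp: complex_noise_def noise_index_def fun_eq_iff complex_eq_iff)
qed

text \<open>For components with the same \<open>j\<close> and the same representative, real and
  imaginary parts contribute 1 and the product of the signs: 2 if the indices agree, 0 if they are
  opposite. A component is thus orthogonal to its own conjugate in the Hermitian sense.\<close>

lemma complex_noise_properties:
  fixes \<Lambda> :: "(real ^ 'n) set"
  assumes B: "\<And>i. i \<in> noise_index \<Longrightarrow> brownian_motion M F (B i)"
    and ind: "independent_processes M B noise_index"
    and \<Lambda>: "\<Lambda> \<inter> uminus ` \<Lambda> = {}" "\<Lambda> \<union> uminus ` \<Lambda> = int_lattice0"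
  shows "(j, k) \<in> noise_index \<Longrightarrow> martingale_noise (complex_noise \<Lambda> B j k)"
    and "(j, k) \<in> noise_index \<Longrightarrow> (j', k') \<in> noise_index \<Longrightarrow>
      covariation_rate (complex_noise \<Lambda> B j k) (complex_noise \<Lambda> B j' k') (if (j, k) = (j', k') then 2 else 0)"
proof -
  assume jk: "(j, k) \<in> noise_index"
  obtain l \<sigma> where l: "l \<in> \<Lambda>" "(k = l \<and> \<sigma> = 1) \<or> (k = - l \<and> \<sigma> = - 1)" "(j, l) \<in> noise_index" "(j, - l) \<in> noise_index"
    "l \<noteq> - l" "complex_noise \<Lambda> B j k = (\<lambda>t \<omega>. Complex (B (j, l) t \<omega>) (\<sigma> * B (j, - l) t \<omega>))"
    by (rule complex_noise_brownian_pair[OF \<Lambda> jk, of B])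
  show "martingale_noise (complex_noise \<Lambda> B j k)"
    unfolding l(6) by (intro martingale_noise_complex_brownian B l)
  assume jk': "(j', k') \<in> noise_index"
  obtain l' \<sigma>' where l': "l' \<in> \<Lambda>" "(k' = l' \<and> \<sigma>' = 1) \<or> (k' = - l' \<and> \<sigma>' = - 1)" "(j', l') \<in> noise_index" "(j', - l') \<in> noise_index"
    "l' \<noteq> - l'" "complex_noise \<Lambda> B j' k' = (\<lambda>t \<omega>. Complex (B (j', l') t \<omega>) (\<sigma>' * B (j', - l') t \<omega>))"
    by (rule complex_noise_brownian_pair[OF \<Lambda> jk', of B])
  have ne: "l \<noteq> - l'" "- l \<noteq> l'" using \<Lambda>(1) l(1) l'(1) by auto
  have sg: "\<sigma> = 1 \<or> \<sigma> = -1" "\<sigma>' = 1 \<or> \<sigma>' = -1" using l(2) l'(2) by auto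
  have "of_bool ((j, l) = (j', l')) + complex_of_real (\<sigma> * \<sigma>') * of_bool ((j, - l) = (j', - l'))
      + \<i> * (complex_of_real \<sigma> * of_bool ((j, - l) = (j', l')) - complex_of_real \<sigma>' * of_bool ((j, l) = (j', - l')))
    = (if (j, k) = (j', k') then 2 else 0)"
  proof (cases "(j, l) = (j', l')")
    case True
    then have "(j, k) = (j', k') \<longleftrightarrow> \<sigma> = \<sigma>'"
      using l(2) l'(2) l(5) by auto
    then show ?thesis using True ne sg by auto
  next
    case False
    then have "(j, k) \<noteq> (j', k')" using l(2) l'(2) ne by auto
    then show ?thesis using False ne by auto
  qed
  with covariation_rate_complex_brownian[OF B ind l(3,4) l'(3,4), of \<sigma> \<sigma>']
  show "covariation_rate (complex_noise \<Lambda> B j k) (complex_noise \<Lambda> B j' k') (if (j, k) = (j', k') then 2 else 0)"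
    unfolding l(6) l'(6) by (simp only:)
qed

context
  fixes W :: "nat \<Rightarrow> real ^ 'n \<Rightarrow> real \<Rightarrow> 'w \<Rightarrow> complex" and \<theta> :: "real ^ 'n \<Rightarrow> real" and T :: real
  assumes mart: "\<And>j k. (j, k) \<in> noise_index \<Longrightarrow> martingale_noise (W j k)"
    and cov: "\<And>j k j' k'. (j, k) \<in> noise_index \<Longrightarrow> (j', k') \<in> noise_index \<Longrightarrow>
      covariation_rate (W j k) (W j' k') (if (j, k) = (j', k') then 2 else 0)"
begin

lemma has_noise_integral_approx:
  assumes "has_noise_integral M F T \<theta> W H S"
  shows "\<exists>I. (\<forall>i\<in>noise_index. has_ito_integral M F T (W (fst i) (snd i)) (H (fst i) (snd i)) (I i)) \<and>
    (\<forall>t\<in>{0..T}. ((\<lambda>A. l2_dist2 M (S t) (\<lambda>\<omega>. \<Sum>i\<in>A. complex_of_real (\<theta> (snd i)) * I i t \<omega>)) \<longlongrightarrow> 0)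
      (finite_subsets_at_top noise_index))"
proof -
  obtain I where I: "\<forall>(j, k)\<in>noise_index. has_ito_integral M F T (W j k) (H j k) (I j k)"
    "\<forall>t\<in>{0..T}. ((\<lambda>A. \<integral>\<^sup>+\<omega>. ennreal ((norm (S t \<omega> -
            (\<Sum>(j, k)\<in>A. complex_of_real (\<theta> k) * I j k t \<omega>)))\<^sup>2) \<partial>M)
          \<longlongrightarrow> 0) (finite_subsets_at_top noise_index)"
    using assms unfolding has_noise_integral_def by blast
  show ?thesis
    by (rule exI[of _ "\<lambda>i. I (fst i) (snd i)"]) (use I in \<open>simp add: split_beta'\<close>)
qed

lemma csquare_integrable_partial_noise:
  assumes I: "\<forall>i\<in>noise_index. has_ito_integral M F T (W (fst i) (snd i)) (H (fst i) (snd i)) (I i)"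
    and t: "t \<in> {0..T}"
  shows "\<forall>\<^sub>F A in finite_subsets_at_top noise_index. csquare_integrable M (\<lambda>\<omega>. \<Sum>i\<in>A. complex_of_real (\<theta> (snd i)) * I i t \<omega>)"
proof (rule eventually_finite_subsets_at_top_weakI)
  fix A :: "(nat \<times> (real ^ 'n)) set" assume A: "finite A" "A \<subseteq> noise_index"
  show "csquare_integrable M (\<lambda>\<omega>. \<Sum>i\<in>A. complex_of_real (\<theta> (snd i)) * I i t \<omega>)"
  proof (intro csquare_integrable_sum csquare_integrable_scale)
    fix i assume "i \<in> A"
    then have i: "i \<in> noise_index" using A by auto
    show "csquare_integrable M (I i t)"
      by (rule csquare_integrable_ito(2)[OF mart bspec[OF I i] t]) (use i in simp)
  qed
qed

lemma csquare_integrable_noise: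
  assumes S: "has_noise_integral M F T \<theta> W H S" and t: "t \<in> {0..T}"
  shows "csquare_integrable M (S t)"
proof -
  obtain I where I: "\<forall>i\<in>noise_index. has_ito_integral M F T (W (fst i) (snd i)) (H (fst i) (snd i)) (I i)"
    "\<forall>t\<in>{0..T}. ((\<lambda>A. l2_dist2 M (S t) (\<lambda>\<omega>. \<Sum>i\<in>A. complex_of_real (\<theta> (snd i)) * I i t \<omega>)) \<longlongrightarrow> 0)
      (finite_subsets_at_top noise_index)"
    using has_noise_integral_approx[OF S] by blast
  have "S t \<in> borel_measurable (F t)" using S t by (simp add: has_noise_integral_def)
  then have "S t \<in> borel_measurable M" using measurable_filtration t by auto
  from csquare_integrable_limit[OF this csquare_integrable_partial_noise[OF I(1) t] bspec[OF I(2) t]]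
  show ?thesis by simp
qed

lemma noise_martingale:
  assumes S: "has_noise_integral M F T \<theta> W H S" and st: "0 \<le> s" "s \<le> t" "t \<le> T"
    and Z: "Z \<in> borel_measurable (F s)" "csquare_integrable M Z"
  shows "l2_inner M (S t) Z = l2_inner M (S s) Z"
proof -
  have t: "t \<in> {0..T}" and s: "s \<in> {0..T}" using st by auto
  obtain I where I: "\<forall>i\<in>noise_index. has_ito_integral M F T (W (fst i) (snd i)) (H (fst i) (snd i)) (I i)"
    "\<forall>t\<in>{0..T}. ((\<lambda>A. l2_dist2 M (S t) (\<lambda>\<omega>. \<Sum>i\<in>A. complex_of_real (\<theta> (snd i)) * I i t \<omega>)) \<longlongrightarrow> 0)
      (finite_subsets_at_top noise_index)"
    using has_noise_integral_approx[OF S] by blast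
  have lim: "((\<lambda>A. l2_inner M (\<lambda>\<omega>. \<Sum>i\<in>A. complex_of_real (\<theta> (snd i)) * I i r \<omega>) Z) \<longlongrightarrow> l2_inner M (S r) Z)
      (finite_subsets_at_top noise_index)" if r: "r \<in> {0..T}" for r
    by (rule tendsto_l2_inner[OF csquare_integrable_noise[OF S r] Z(2) csquare_integrable_partial_noise[OF I(1) r] _ bspec[OF I(2) r]])
      (simp_all add: Z)
  have "\<forall>\<^sub>F A in finite_subsets_at_top noise_index.
      l2_inner M (\<lambda>\<omega>. \<Sum>i\<in>A. complex_of_real (\<theta> (snd i)) * I i t \<omega>) Z
      = l2_inner M (\<lambda>\<omega>. \<Sum>i\<in>A. complex_of_real (\<theta> (snd i)) * I i s \<omega>) Z"
  proof (rule eventually_finite_subsets_at_top_weakI)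
    fix A :: "(nat \<times> (real ^ 'n)) set" assume A: "finite A" "A \<subseteq> noise_index"
    have m: "martingale_noise (W (fst i) (snd i))" if "i \<in> A" for i using mart A that by auto
    have e: "l2_inner M (\<lambda>\<omega>. \<Sum>i\<in>A. complex_of_real (\<theta> (snd i)) * I i r \<omega>) Z
        = (\<Sum>i\<in>A. complex_of_real (\<theta> (snd i)) * l2_inner M (I i r) Z)" if r: "r \<in> {0..T}" for r
    proof -
      have "csquare_integrable M (\<lambda>\<omega>. complex_of_real (\<theta> (snd i)) * I i r \<omega>)" if "i \<in> A" for i
        using csquare_integrable_ito(2)[OF m[OF that] _ r] I(1) A that by (intro csquare_integrable_scale) blast
      from l2_inner_sum_left[OF this Z(2)] show ?thesis by (simp add: l2_inner_scale_left)
    qed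
    have "l2_inner M (I i t) Z = l2_inner M (I i s) Z" if "i \<in> A" for i
      using ito_martingale[OF m[OF that] _ st Z] I(1) A that by blast
    then show "l2_inner M (\<lambda>\<omega>. \<Sum>i\<in>A. complex_of_real (\<theta> (snd i)) * I i t \<omega>) Z
      = l2_inner M (\<lambda>\<omega>. \<Sum>i\<in>A. complex_of_real (\<theta> (snd i)) * I i s \<omega>) Z"
      unfolding e[OF t] e[OF s] by (intro sum.cong refl) simp
  qed
  from tendsto_unique[OF _ Lim_transform_eventually[OF lim[OF t] this] lim[OF s]]
  show ?thesis by simp
qed

text \<open>For finite partial sums the mixed terms vanish by \<open>cov\<close> and the diagonal
  ones carry the covariation 2. The limit along finite subsets is by definition an unordered
  sum.\<close>

lemma noise_isometry:
  assumes S: "has_noise_integral M F T \<theta> W H S" and S': "has_noise_integral M F T \<theta> W H' S'"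
    and t: "t \<in> {0..T}"
  shows "((\<lambda>i. 2 * (\<theta> (snd i))\<^sup>2 * l2_inner (time_space t) (\<lambda>(s, \<omega>). H (fst i) (snd i) s \<omega>)
      (\<lambda>(s, \<omega>). H' (fst i) (snd i) s \<omega>)) has_sum l2_inner M (S t) (S' t)) noise_index"
proof -
  obtain I where I: "\<forall>i\<in>noise_index. has_ito_integral M F T (W (fst i) (snd i)) (H (fst i) (snd i)) (I i)"
    "\<forall>t\<in>{0..T}. ((\<lambda>A. l2_dist2 M (S t) (\<lambda>\<omega>. \<Sum>i\<in>A. complex_of_real (\<theta> (snd i)) * I i t \<omega>)) \<longlongrightarrow> 0)
      (finite_subsets_at_top noise_index)"
    using has_noise_integral_approx[OF S] by blast
  obtain J where J: "\<forall>i\<in>noise_index. has_ito_integral M F T (W (fst i) (snd i)) (H' (fst i) (snd i)) (J i)"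
    "\<forall>t\<in>{0..T}. ((\<lambda>A. l2_dist2 M (S' t) (\<lambda>\<omega>. \<Sum>i\<in>A. complex_of_real (\<theta> (snd i)) * J i t \<omega>)) \<longlongrightarrow> 0)
      (finite_subsets_at_top noise_index)"
    using has_noise_integral_approx[OF S'] by blast
  have lim: "((\<lambda>A. l2_inner M (\<lambda>\<omega>. \<Sum>i\<in>A. complex_of_real (\<theta> (snd i)) * I i t \<omega>)
      (\<lambda>\<omega>. \<Sum>i\<in>A. complex_of_real (\<theta> (snd i)) * J i t \<omega>)) \<longlongrightarrow> l2_inner M (S t) (S' t))
      (finite_subsets_at_top noise_index)"
    by (rule tendsto_l2_inner[OF csquare_integrable_noise[OF S t] csquare_integrable_noise[OF S' t]
        csquare_integrable_partial_noise[OF I(1) t] csquare_integrable_partial_noise[OF J(1) t]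
        bspec[OF I(2) t] bspec[OF J(2) t]])
  have "\<forall>\<^sub>F A in finite_subsets_at_top noise_index.
      l2_inner M (\<lambda>\<omega>. \<Sum>i\<in>A. complex_of_real (\<theta> (snd i)) * I i t \<omega>)
        (\<lambda>\<omega>. \<Sum>i\<in>A. complex_of_real (\<theta> (snd i)) * J i t \<omega>)
      = (\<Sum>i\<in>A. 2 * (\<theta> (snd i))\<^sup>2 * l2_inner (time_space t) (\<lambda>(s, \<omega>). H (fst i) (snd i) s \<omega>)
          (\<lambda>(s, \<omega>). H' (fst i) (snd i) s \<omega>))"
  proof (rule eventually_finite_subsets_at_top_weakI)
    fix A :: "(nat \<times> (real ^ 'n)) set" assume A: "finite A" "A \<subseteq> noise_index"
    have m: "martingale_noise (W (fst i) (snd i))" if "i \<in> A" for i using mart A that by auto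
    have hI: "has_ito_integral M F T (W (fst i) (snd i)) (H (fst i) (snd i)) (I i)"
      and hJ: "has_ito_integral M F T (W (fst i) (snd i)) (H' (fst i) (snd i)) (J i)" if "i \<in> A" for i
      using I(1) J(1) A that by blast+
    have i2: "csquare_integrable M (\<lambda>\<omega>. complex_of_real (\<theta> (snd i)) * I i t \<omega>)"
      and j2: "csquare_integrable M (\<lambda>\<omega>. complex_of_real (\<theta> (snd i)) * J i t \<omega>)" if "i \<in> A" for i
      using csquare_integrable_ito(2)[OF m[OF that] hI[OF that] t] csquare_integrable_ito(2)[OF m[OF that] hJ[OF that] t]
      by (auto intro: csquare_integrable_scale)
    let ?G = "\<lambda>i. l2_inner (time_space t) (\<lambda>(s, \<omega>). H (fst i) (snd i) s \<omega>) (\<lambda>(s, \<omega>). H' (fst i) (snd i) s \<omega>)"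
    have ij: "l2_inner M (\<lambda>\<omega>. complex_of_real (\<theta> (snd i)) * I i t \<omega>) (\<lambda>\<omega>. complex_of_real (\<theta> (snd i')) * J i' t \<omega>)
        = (if i' = i then 2 * (\<theta> (snd i))\<^sup>2 * ?G i else 0)" if "i \<in> A" "i' \<in> A" for i i'
    proof -
      have "covariation_rate (W (fst i) (snd i)) (W (fst i') (snd i')) (if i = i' then 2 else 0)"
      proof -
        have "i \<in> noise_index" "i' \<in> noise_index" using A(2) that by auto
        then show ?thesis using cov[of "fst i" "snd i" "fst i'" "snd i'"] by simp
      qed
      from ito_isometry[OF m[OF that(1)] m[OF that(2)] this hI[OF that(1)] hJ[OF that(2)] t]
      show ?thesis
        by (auto simp: l2_inner_scale_left l2_inner_scale_right power2_eq_square)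
    qed
    have "l2_inner M (\<lambda>\<omega>. \<Sum>i\<in>A. complex_of_real (\<theta> (snd i)) * I i t \<omega>)
        (\<lambda>\<omega>. \<Sum>i\<in>A. complex_of_real (\<theta> (snd i)) * J i t \<omega>)
      = (\<Sum>i\<in>A. l2_inner M (\<lambda>\<omega>. complex_of_real (\<theta> (snd i)) * I i t \<omega>) (\<lambda>\<omega>. \<Sum>i\<in>A. complex_of_real (\<theta> (snd i)) * J i t \<omega>))"
      by (rule l2_inner_sum_left) (intro i2 csquare_integrable_sum j2; assumption)+
    also have "\<dots> = (\<Sum>i\<in>A. \<Sum>i'\<in>A. l2_inner M (\<lambda>\<omega>. complex_of_real (\<theta> (snd i)) * I i t \<omega>) (\<lambda>\<omega>. complex_of_real (\<theta> (snd i')) * J i' t \<omega>))"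
      by (intro sum.cong refl l2_inner_sum_right) (intro i2 j2; assumption)+
    also have "\<dots> = (\<Sum>i\<in>A. \<Sum>i'\<in>A. if i' = i then 2 * (\<theta> (snd i))\<^sup>2 * ?G i else 0)"
      by (intro sum.cong refl ij)
    also have "\<dots> = (\<Sum>i\<in>A. 2 * (\<theta> (snd i))\<^sup>2 * ?G i)"
      using A(1) by (intro sum.cong refl) (simp add: sum.delta)
    finally show "l2_inner M (\<lambda>\<omega>. \<Sum>i\<in>A. complex_of_real (\<theta> (snd i)) * I i t \<omega>)
        (\<lambda>\<omega>. \<Sum>i\<in>A. complex_of_real (\<theta> (snd i)) * J i t \<omega>) = (\<Sum>i\<in>A. 2 * (\<theta> (snd i))\<^sup>2 * ?G i)" .
  qed
  from Lim_transform_eventually[OF lim this] show ?thesis unfolding has_sum_def .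
qed

lemma csquare_integrable_noise_integrand:
  assumes S: "has_noise_integral M F T \<theta> W H S" and t: "t \<in> {0..T}" and i: "i \<in> noise_index"
  shows "csquare_integrable (time_space t) (\<lambda>(s, \<omega>). H (fst i) (snd i) s \<omega>)"
proof -
  obtain I where I: "\<forall>i\<in>noise_index. has_ito_integral M F T (W (fst i) (snd i)) (H (fst i) (snd i)) (I i)"
    using has_noise_integral_approx[OF S] by blast
  show ?thesis
    by (rule csquare_integrable_ito(1)[OF mart bspec[OF I i] t]) (use i in simp)
qed

text \<open>The noise term of a complex Fourier mode of a difference of solutions is a combination
  of integrals belonging to real test functions. Expanding both squared norms by sesquilinearity
  reduces the claim to the polarised isometry for each pair.\<close>

lemma noise_isometry_combination:
  fixes c :: "'b \<Rightarrow> complex"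
  assumes A: "finite A" and S: "\<And>\<alpha>. \<alpha> \<in> A \<Longrightarrow> has_noise_integral M F T \<theta> W (H \<alpha>) (S \<alpha>)"
    and t: "t \<in> {0..T}"
  shows "((\<lambda>i. 2 * (\<theta> (snd i))\<^sup>2 * (\<integral>(s, \<omega>). (norm (\<Sum>\<alpha>\<in>A. c \<alpha> * H \<alpha> (fst i) (snd i) s \<omega>))\<^sup>2 \<partial>time_space t))
    has_sum (\<integral>\<omega>. (norm (\<Sum>\<alpha>\<in>A. c \<alpha> * S \<alpha> t \<omega>))\<^sup>2 \<partial>M)) noise_index"
proof -
  let ?h = "\<lambda>\<alpha> i. (\<lambda>(s, \<omega>). H \<alpha> (fst i) (snd i) s \<omega>)"
  have bilinear: "l2_inner P (\<lambda>x. \<Sum>\<alpha>\<in>A. c \<alpha> * f \<alpha> x) (\<lambda>x. \<Sum>\<alpha>\<in>A. c \<alpha> * f \<alpha> x)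
      = (\<Sum>\<alpha>\<in>A. \<Sum>\<beta>\<in>A. c \<alpha> * cnj (c \<beta>) * l2_inner P (f \<alpha>) (f \<beta>))"
    if f: "\<And>\<alpha>. \<alpha> \<in> A \<Longrightarrow> csquare_integrable P (f \<alpha>)" for P and f :: "'b \<Rightarrow> 'c \<Rightarrow> complex"
  proof -
    have f': "csquare_integrable P (\<lambda>x. c \<alpha> * f \<alpha> x)" if "\<alpha> \<in> A" for \<alpha>
      using csquare_integrable_scale[OF f[OF that]] .
    have "l2_inner P (\<lambda>x. \<Sum>\<alpha>\<in>A. c \<alpha> * f \<alpha> x) (\<lambda>x. \<Sum>\<alpha>\<in>A. c \<alpha> * f \<alpha> x)
      = (\<Sum>\<alpha>\<in>A. l2_inner P (\<lambda>x. c \<alpha> * f \<alpha> x) (\<lambda>x. \<Sum>\<alpha>\<in>A. c \<alpha> * f \<alpha> x))"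
      by (rule l2_inner_sum_left[OF f' csquare_integrable_sum[OF f']])
    also have "\<dots> = (\<Sum>\<alpha>\<in>A. \<Sum>\<beta>\<in>A. l2_inner P (\<lambda>x. c \<alpha> * f \<alpha> x) (\<lambda>x. c \<beta> * f \<beta> x))"
      by (intro sum.cong refl l2_inner_sum_right[OF f' f'])
    finally show ?thesis by (simp add: l2_inner_scale_left l2_inner_scale_right mult_ac)
  qed
  have fin: "((\<lambda>i. \<Sum>\<alpha>\<in>A. g \<alpha> i) has_sum (\<Sum>\<alpha>\<in>A. s \<alpha>)) N" if "\<And>\<alpha>. \<alpha> \<in> A \<Longrightarrow> (g \<alpha> has_sum s \<alpha>) N"
    for g :: "'b \<Rightarrow> 'd \<Rightarrow> complex" and s N
    using A that by (induction A rule: finite_induct) (auto intro: has_sum_add)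
  have "((\<lambda>i. \<Sum>\<alpha>\<in>A. \<Sum>\<beta>\<in>A. c \<alpha> * cnj (c \<beta>) * (2 * (\<theta> (snd i))\<^sup>2 * l2_inner (time_space t) (?h \<alpha> i) (?h \<beta> i)))
      has_sum (\<Sum>\<alpha>\<in>A. \<Sum>\<beta>\<in>A. c \<alpha> * cnj (c \<beta>) * l2_inner M (S \<alpha> t) (S \<beta> t))) noise_index"
    by (intro fin has_sum_cmult_right noise_isometry S t)
  then have "((\<lambda>i. \<Sum>\<alpha>\<in>A. \<Sum>\<beta>\<in>A. c \<alpha> * cnj (c \<beta>) * (2 * (\<theta> (snd i))\<^sup>2 * l2_inner (time_space t) (?h \<alpha> i) (?h \<beta> i)))
      has_sum l2_inner M (\<lambda>\<omega>. \<Sum>\<alpha>\<in>A. c \<alpha> * S \<alpha> t \<omega>) (\<lambda>\<omega>. \<Sum>\<alpha>\<in>A. c \<alpha> * S \<alpha> t \<omega>)) noise_index"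
    by (subst bilinear) (auto intro: csquare_integrable_noise[OF S t])
  moreover have "(\<Sum>\<alpha>\<in>A. \<Sum>\<beta>\<in>A. c \<alpha> * cnj (c \<beta>) * (2 * (\<theta> (snd i))\<^sup>2 * l2_inner (time_space t) (?h \<alpha> i) (?h \<beta> i)))
      = complex_of_real (2 * (\<theta> (snd i))\<^sup>2 * (\<integral>(s, \<omega>). (norm (\<Sum>\<alpha>\<in>A. c \<alpha> * H \<alpha> (fst i) (snd i) s \<omega>))\<^sup>2 \<partial>time_space t))"
    if i: "i \<in> noise_index" for i
  proof -
    have "(\<Sum>\<alpha>\<in>A. \<Sum>\<beta>\<in>A. c \<alpha> * cnj (c \<beta>) * (2 * (\<theta> (snd i))\<^sup>2 * l2_inner (time_space t) (?h \<alpha> i) (?h \<beta> i)))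
      = 2 * (\<theta> (snd i))\<^sup>2 * (\<Sum>\<alpha>\<in>A. \<Sum>\<beta>\<in>A. c \<alpha> * cnj (c \<beta>) * l2_inner (time_space t) (?h \<alpha> i) (?h \<beta> i))"
      by (simp add: sum_distrib_left mult_ac)
    also have "(\<Sum>\<alpha>\<in>A. \<Sum>\<beta>\<in>A. c \<alpha> * cnj (c \<beta>) * l2_inner (time_space t) (?h \<alpha> i) (?h \<beta> i))
      = l2_inner (time_space t) (\<lambda>x. \<Sum>\<alpha>\<in>A. c \<alpha> * ?h \<alpha> i x) (\<lambda>x. \<Sum>\<alpha>\<in>A. c \<alpha> * ?h \<alpha> i x)"
      by (rule bilinear[symmetric]) (intro csquare_integrable_noise_integrand[OF S t i])
    also have "\<dots> = of_real (\<integral>(s, \<omega>). (norm (\<Sum>\<alpha>\<in>A. c \<alpha> * H \<alpha> (fst i) (snd i) s \<omega>))\<^sup>2 \<partial>time_space t)"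
      unfolding l2_inner_self by (simp add: split_beta')
    finally show ?thesis by simp
  qed
  ultimately have "((\<lambda>i. complex_of_real (2 * (\<theta> (snd i))\<^sup>2 * (\<integral>(s, \<omega>). (norm (\<Sum>\<alpha>\<in>A. c \<alpha> * H \<alpha> (fst i) (snd i) s \<omega>))\<^sup>2 \<partial>time_space t)))
      has_sum l2_inner M (\<lambda>\<omega>. \<Sum>\<alpha>\<in>A. c \<alpha> * S \<alpha> t \<omega>) (\<lambda>\<omega>. \<Sum>\<alpha>\<in>A. c \<alpha> * S \<alpha> t \<omega>)) noise_index"
    by (simp cong: has_sum_cong)
  from has_sum_Re[OF this] show ?thesis unfolding l2_inner_self by simp
qed

lemma noise_martingale_combination:
  fixes c :: "'b \<Rightarrow> complex"
  assumes S: "\<And>\<alpha>. \<alpha> \<in> A \<Longrightarrow> has_noise_integral M F T \<theta> W (H \<alpha>) (S \<alpha>)"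
    and st: "0 \<le> s" "s \<le> t" "t \<le> T"
    and Z: "Z \<in> borel_measurable (F s)" "csquare_integrable M Z"
  shows "l2_inner M (\<lambda>\<omega>. \<Sum>\<alpha>\<in>A. c \<alpha> * S \<alpha> t \<omega>) Z = l2_inner M (\<lambda>\<omega>. \<Sum>\<alpha>\<in>A. c \<alpha> * S \<alpha> s \<omega>) Z"
proof -
  have ts: "t \<in> {0..T}" "s \<in> {0..T}" using st by auto
  have e: "l2_inner M (\<lambda>\<omega>. \<Sum>\<alpha>\<in>A. c \<alpha> * S \<alpha> r \<omega>) Z = (\<Sum>\<alpha>\<in>A. c \<alpha> * l2_inner M (S \<alpha> r) Z)" if r: "r \<in> {0..T}" for r
  proof -
    have "csquare_integrable M (\<lambda>\<omega>. c \<alpha> * S \<alpha> r \<omega>)" if "\<alpha> \<in> A" for \<alpha>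
      using csquare_integrable_scale[OF csquare_integrable_noise[OF S[OF that] r]] .
    from l2_inner_sum_left[OF this Z(2)] show ?thesis by (simp add: l2_inner_scale_left)
  qed
  show ?thesis
    unfolding e[OF ts(1)] e[OF ts(2)] by (intro sum.cong refl arg_cong2[where f = "(*)"] noise_martingale[OF S st Z])
qed

end

end

section \<open>The maximum principle and the Fourier modes of a weak solution\<close>

text \<open>Moves unordered real sums to integrals over a counting measure, where they can be
  exchanged with time integrals by Tonelli.\<close>

lemma nn_integral_count_space_has_sum:
  fixes f :: "'a \<Rightarrow> real"
  assumes "(f has_sum s) A" "\<And>x. x \<in> A \<Longrightarrow> 0 \<le> f x"
  shows "(\<integral>\<^sup>+x. ennreal (f x) \<partial>count_space A) = ennreal s"
proof -
  have sm: "f summable_on A" and s: "infsum f A = s"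
    using assms(1) by (auto intro: has_sum_imp_summable infsumI)
  have "(\<lambda>x. norm (f x)) summable_on A \<longleftrightarrow> f summable_on A"
    by (rule summable_on_cong) (use assms(2) in auto)
  then have abs: "Infinite_Set_Sum.abs_summable_on f A"
    using sm by (simp add: abs_summable_equivalent[symmetric])
  show ?thesis
    using nn_integral_conv_infsetsum[OF abs assms(2)] infsetsum_infsum[OF abs] s by simp
qed

text \<open>
  The second moments of the Fourier modes solve the Kolmogorov equation of a Markov chain with
  jump rates \<open>w k i\<close> from \<open>k\<close> to \<open>\<kappa> k i\<close>.  Here \<open>Z\<close> is their twofold time integral, which attains its
  maximum because it is summable.
\<close>

lemma maximum_principle:
  fixes z Z Q :: "'k \<Rightarrow> ennreal" and w :: "'k \<Rightarrow> 'i \<Rightarrow> ennreal"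
  assumes eq: "\<And>k. k \<in> L \<Longrightarrow> z k + Q k * Z k = (\<integral>\<^sup>+i. w k i * Z (\<kappa> k i) \<partial>count_space N)"
    and w: "\<And>k. k \<in> L \<Longrightarrow> (\<integral>\<^sup>+i. w k i \<partial>count_space N) = Q k" "\<And>k. k \<in> L \<Longrightarrow> Q k < \<infinity>"
    and \<kappa>: "\<And>k i. k \<in> L \<Longrightarrow> i \<in> N \<Longrightarrow> \<kappa> k i \<in> L"
    and zZ: "\<And>k. k \<in> L \<Longrightarrow> z k = 0 \<Longrightarrow> Z k = 0"
    and C: "\<And>A. finite A \<Longrightarrow> A \<subseteq> L \<Longrightarrow> (\<Sum>k\<in>A. Z k) \<le> C" "C < \<infinity>"
    and k: "k \<in> L"
  shows "z k = 0"
proof -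
  have Zfin: "Z l < \<infinity>" if "l \<in> L" for l
    using C(1)[of "{l}"] C(2) that by (simp add: order_le_less_trans)
  have Z0: "Z l = 0" if l: "l \<in> L" for l
  proof (rule ccontr)
    assume pos: "Z l \<noteq> 0"
    define G where "G = {m \<in> L. Z l \<le> Z m}"
    \<comment> \<open>Infinitely many values of size at least \<open>Z l\<close> would exceed the
      uniform bound \<open>C\<close>. So the supremum over the infinite index set is a maximum over
      the finite set \<open>G\<close>.\<close>
    have "finite G"
    proof (rule ccontr)
      assume inf: "infinite G"
      have Zl: "0 < enn2real (Z l)" using pos Zfin[OF l] by (simp add: enn2real_positive_iff less_top zero_less_iff_neq_zero)
      obtain n :: nat where n: "enn2real C / enn2real (Z l) < real n" using reals_Archimedean2 by blast
      obtain A where A: "A \<subseteq> G" "finite A" "card A = n" using infinite_arbitrarily_large[OF inf] by blast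
      have "ennreal (real n * enn2real (Z l)) = of_nat n * Z l"
        using Zfin[OF l] by (simp add: ennreal_mult ennreal_of_nat_eq_real_of_nat less_top)
      also have "\<dots> = (\<Sum>m\<in>A. Z l)" by (simp add: A(3))
      also have "\<dots> \<le> (\<Sum>m\<in>A. Z m)" by (rule sum_mono) (use A(1) in \<open>auto simp: G_def\<close>)
      also have "\<dots> \<le> C" by (rule C(1)) (use A in \<open>auto simp: G_def\<close>)
      also have "C = ennreal (enn2real C)" using C(2) by (simp add: less_top)
      finally have "real n * enn2real (Z l) \<le> enn2real C" by (simp add: ennreal_le_iff)
      then show False using n Zl by (simp add: divide_less_eq)
    qed
    moreover have "l \<in> G" using l by (simp add: G_def)
    ultimately have "Max (Z ` G) \<in> Z ` G" by (intro Max_in) auto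
    then obtain m where m: "m \<in> G" "Z m = Max (Z ` G)" by auto
    have mL: "m \<in> L" using m(1) by (simp add: G_def)
    have max: "Z p \<le> Z m" if "p \<in> L" for p
    proof (cases "p \<in> G")
      case True
      then show ?thesis unfolding m(2) using \<open>finite G\<close> by simp
    next
      case False
      then have "Z p \<le> Z l" using that by (auto simp: G_def)
      also have "\<dots> \<le> Z m" using m(1) by (simp add: G_def)
      finally show ?thesis .
    qed
    \<comment> \<open>At the maximum every value on the right is at most \<open>Z m\<close>, and the
      rates add up to \<open>Q m\<close>. The term \<open>Q m * Z m\<close> is finite, so it may be
      cancelled in \<open>ennreal\<close>.\<close>
    have "z m + Q m * Z m \<le> (\<integral>\<^sup>+i. w m i * Z m \<partial>count_space N)"
      unfolding eq[OF mL]
      by (intro nn_integral_mono mult_left_mono max \<kappa>[OF mL]) auto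
    also have "\<dots> = Q m * Z m"
      by (simp add: nn_integral_multc w(1)[OF mL])
    finally have "z m + Q m * Z m \<le> 0 + Q m * Z m" by simp
    moreover have "Q m * Z m < \<infinity>" using w(2)[OF mL] Zfin[OF mL] by (simp add: ennreal_mult_less_top)
    ultimately have "z m = 0"
      using ennreal_add_left_cancel_le[of "Q m * Z m" "z m" 0] by (auto simp: add.commute)
    then have "Z m = 0" by (rule zZ[OF mL])
    then show False using m(1) pos by (simp add: G_def)
  qed
  \<comment> \<open>With \<open>Z\<close> equal to 0 everywhere, the right side of the equation
    vanishes for every index, not only at the maximiser.\<close>
  have "z k + Q k * Z k = (\<integral>\<^sup>+i. 0 \<partial>count_space N)"
    unfolding eq[OF k] by (intro nn_integral_cong) (simp add: Z0 \<kappa>[OF k])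
  then show ?thesis by simp
qed

section \<open>Fourier modes as test functions\<close>

lemma countable_int_lattice: "countable (int_lattice :: (real ^ 'n::finite) set)"
proof -
  have "int_lattice \<subseteq> range (\<lambda>f :: 'n \<Rightarrow> int. \<chi> i. real_of_int (f i))"
  proof
    fix k :: "real ^ 'n" assume "k \<in> int_lattice"
    then have "\<forall>i. \<exists>n :: int. k $ i = n" by (auto simp: int_lattice_def elim: Ints_cases)
    then obtain f :: "'n \<Rightarrow> int" where "\<forall>i. k $ i = f i" by metis
    then show "k \<in> range (\<lambda>f :: 'n \<Rightarrow> int. \<chi> i. real_of_int (f i))"
      by (auto simp: vec_eq_iff intro!: image_eqI[of _ _ f])
  qed
  then show ?thesis by (rule countable_subset) simp
qed

lemma countable_noise_index: "countable (noise_index :: (nat \<times> (real ^ 'n::finite)) set)"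
  unfolding noise_index_def int_lattice0_def
  using countable_int_lattice by (intro countable_SIGMA) auto

lemma fourier_mode_wave:
  "fourier_mode (- k) x = complex_of_real (wave 1 0 k x) + (- \<i>) * complex_of_real (wave 0 1 k x)"
  by (simp add: fourier_mode_cis wave_def complex_eq_iff)

lemma borel_measurable_wave [measurable]: "wave \<alpha> \<beta> k \<in> borel_measurable borel"
  by (rule borel_measurable_continuous_onI[OF continuous_on_wave])

lemma abs_wave_le: "\<bar>wave \<alpha> \<beta> k x\<bar> \<le> \<bar>\<alpha>\<bar> + \<bar>\<beta>\<bar>"
proof -
  have "\<bar>\<alpha> * cos (k \<bullet> x)\<bar> \<le> \<bar>\<alpha>\<bar>" "\<bar>\<beta> * sin (k \<bullet> x)\<bar> \<le> \<bar>\<beta>\<bar>"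
    by (simp_all add: abs_mult mult_left_le)
  then show ?thesis unfolding wave_def by linarith
qed

lemma pairing_fourier_mode_wave:
  "pairing f (fourier_mode (- k)) = complex_of_real (pairing f (wave 1 0 k)) - \<i> * complex_of_real (pairing f (wave 0 1 k))"
proof -
  have 1: "norm (complex_of_real (wave 1 0 k x)) \<le> 1" and 2: "norm ((- \<i>) * complex_of_real (wave 0 1 k x)) \<le> 1" for x
    using abs_wave_le[of 1 0 k x] abs_wave_le[of 0 1 k x] by (simp_all add: norm_mult)
  have "pairing f (fourier_mode (- k)) = pairing f (\<lambda>x. complex_of_real (wave 1 0 k x) + (- \<i>) * complex_of_real (wave 0 1 k x))"
    by (simp only: fourier_mode_wave[symmetric])
  also have "\<dots> = pairing f (\<lambda>x. complex_of_real (wave 1 0 k x)) + pairing f (\<lambda>x. (- \<i>) * complex_of_real (wave 0 1 k x))"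
    by (rule pairing_add[OF _ 1 _ 2]) measurable
  finally show ?thesis by (simp only: pairing_scale pairing_of_real) simp
qed

text \<open>Differentiating \<open>fourier_mode (- k)\<close> gives a scalar factor, and
  multiplication by mode \<open>l\<close> shifts the frequency. The identity is split into two real
  waves because \<open>grad\<close> acts on real functions only.\<close>

lemma pairing_gradient_modes:
  "pairing f (\<lambda>x. fourier_mode l x * complex_of_real (b \<bullet> grad (wave 1 0 k) x))
    - \<i> * pairing f (\<lambda>x. fourier_mode l x * complex_of_real (b \<bullet> grad (wave 0 1 k) x))
   = - \<i> * complex_of_real (b \<bullet> k) * pairing f (fourier_mode (- (k - l)))"
proof -
  define A where "A x = fourier_mode l x * complex_of_real (b \<bullet> grad (wave 1 0 k) x)" for x
  define D where "D x = (- \<i>) * (fourier_mode l x * complex_of_real (b \<bullet> grad (wave 0 1 k) x))" for x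
  have Am: "A \<in> borel_measurable borel" and Dm: "D \<in> borel_measurable borel"
    unfolding A_def[abs_def] D_def[abs_def] grad_wave inner_scaleR_right by measurable
  have An: "norm (A x) \<le> \<bar>b \<bullet> k\<bar>" for x
  proof -
    have "\<bar>wave 0 (- 1) k x\<bar> \<le> 1" using abs_wave_le[of 0 "-1" k x] by simp
    then show ?thesis unfolding A_def grad_wave
      by (simp add: norm_mult abs_mult mult_left_le_one_le)
  qed
  have Dn: "norm (D x) \<le> \<bar>b \<bullet> k\<bar>" for x
  proof -
    have "\<bar>wave 1 (- 0) k x\<bar> \<le> 1" using abs_wave_le[of 1 0 k x] by simp
    then show ?thesis unfolding D_def grad_wave
      by (simp add: norm_mult abs_mult mult_left_le_one_le)
  qed
  have "A x + D x = - \<i> * complex_of_real (b \<bullet> k) * fourier_mode (- (k - l)) x" for x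
  proof -
    have "fourier_mode (- (k - l)) x = fourier_mode l x * fourier_mode (- k) x"
      by (simp add: fourier_mode_add)
    then have f: "fourier_mode (- (k - l)) x = fourier_mode l x * (complex_of_real (cos (k \<bullet> x)) + (- \<i>) * complex_of_real (sin (k \<bullet> x)))"
      unfolding fourier_mode_wave[of k] by (simp add: wave_def)
    have g: "complex_of_real (b \<bullet> grad (wave 1 0 k) x) = - complex_of_real (sin (k \<bullet> x)) * complex_of_real (b \<bullet> k)"
      "complex_of_real (b \<bullet> grad (wave 0 1 k) x) = complex_of_real (cos (k \<bullet> x)) * complex_of_real (b \<bullet> k)"
      by (simp_all add: grad_wave wave_def)
    have "E * (- s * z) + (- \<i>) * (E * (r * z)) = - \<i> * z * (E * (r + (- \<i>) * s))" for E s r z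
      by (simp add: algebra_simps)
    then show ?thesis unfolding A_def D_def f g .
  qed
  then have "pairing f (\<lambda>x. A x + D x) = - \<i> * complex_of_real (b \<bullet> k) * pairing f (fourier_mode (- (k - l)))"
    by (simp only: pairing_scale)
  moreover have "pairing f (\<lambda>x. A x + D x) = pairing f A + pairing f D"
    by (rule pairing_add[OF Am An Dm Dn])
  moreover have "pairing f D = - \<i> * pairing f (\<lambda>x. fourier_mode l x * complex_of_real (b \<bullet> grad (wave 0 1 k) x))"
    unfolding D_def by (rule pairing_scale)
  ultimately show ?thesis unfolding A_def by simp
qed

lemma progressively_measurable_compose:
  assumes "progressively_measurable F T u" "g \<in> borel_measurable borel"
  shows "progressively_measurable F T (\<lambda>s \<omega>. g (u s \<omega>))"
  unfolding progressively_measurable_def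
proof
  fix t assume "t \<in> {0..T}"
  then have "(\<lambda>(s, \<omega>). u s \<omega>) \<in> borel_measurable (restrict_space borel {0..t} \<Otimes>\<^sub>M F t)"
    using assms(1) by (simp add: progressively_measurable_def)
  from measurable_compose[OF this assms(2)]
  show "(\<lambda>(s, \<omega>). g (u s \<omega>)) \<in> borel_measurable (restrict_space borel {0..t} \<Otimes>\<^sub>M F t)"
    by (simp add: split_beta')
qed

lemma progressively_measurable_diff:
  fixes f g :: "real \<Rightarrow> 'w \<Rightarrow> complex"
  assumes "progressively_measurable F T f" "progressively_measurable F T g"
  shows "progressively_measurable F T (\<lambda>s \<omega>. f s \<omega> - g s \<omega>)"
  using assms unfolding progressively_measurable_def split_beta'
  by (auto intro: borel_measurable_diff)

lemma norm_pairing_fourier_mode_le: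
  assumes "k \<in> int_lattice"
  shows "(norm (pairing f (fourier_mode (- k))))\<^sup>2 \<le> (norm f)\<^sup>2"
  using bessel_inequality[of "{k}" f] assms by simp

context filtered_prob_space
begin

text \<open>The equation tested with the cosine minus \<i> times the equation tested with the sine.
  Integrability of the path in time is recorded as well, since it is needed to subtract the drift
  integrals of two solutions.\<close>

lemma weak_solution_fourier_mode:
  fixes u :: "real \<Rightarrow> 'w \<Rightarrow> 'n::finite torus_l2"
  assumes u: "weak_solution M F T \<theta> a W c u0 u" and k: "k \<in> int_lattice"
  shows "\<exists>S S'. has_noise_integral M F T \<theta> W
      (\<lambda>j l s \<omega>. pairing (u s \<omega>) (\<lambda>x. fourier_mode l x * complex_of_real (a j l \<bullet> grad (wave 1 0 k) x))) S \<and>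
    has_noise_integral M F T \<theta> W
      (\<lambda>j l s \<omega>. pairing (u s \<omega>) (\<lambda>x. fourier_mode l x * complex_of_real (a j l \<bullet> grad (wave 0 1 k) x))) S' \<and>
    (AE \<omega> in M. (\<forall>t\<in>{0..T}. set_integrable lborel {0..t} (\<lambda>s. pairing (u s \<omega>) (fourier_mode (- k))) \<and>
      pairing (u t \<omega>) (fourier_mode (- k)) = pairing u0 (fourier_mode (- k))
        - complex_of_real (c * (k \<bullet> k)) * (LINT s:{0..t}|lborel. pairing (u s \<omega>) (fourier_mode (- k)))
        - (S t \<omega> - \<i> * S' t \<omega>)))"
proof -
  let ?e = "fourier_mode (- k)"
  have prog: "progressively_measurable F T u"
    and u2: "(\<integral>\<^sup>+t\<in>{0..T}. (\<integral>\<^sup>+\<omega>. ennreal ((norm (u t \<omega>))\<^sup>2) \<partial>M) \<partial>lborel) < \<infinity>"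
    using u by (auto simp: weak_solution_def)
  have ex: "\<exists>S. has_noise_integral M F T \<theta> W
               (\<lambda>j l s \<omega>. pairing (u s \<omega>) (\<lambda>x. fourier_mode l x * complex_of_real (a j l \<bullet> grad \<phi> x))) S \<and>
             (AE \<omega> in M. \<forall>t\<in>{0..T}.
                complex_of_real (pairing (u t \<omega>) \<phi> - pairing u0 \<phi>) =
                complex_of_real (c * (LINT s:{0..t}|lborel. pairing (u s \<omega>) (laplacian \<phi>))) - S t \<omega>)"
    if "torus_smooth \<phi>" for \<phi>
    using u that unfolding weak_solution_def by blast
  obtain S where S: "has_noise_integral M F T \<theta> W
      (\<lambda>j l s \<omega>. pairing (u s \<omega>) (\<lambda>x. fourier_mode l x * complex_of_real (a j l \<bullet> grad (wave 1 0 k) x))) S"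
    "AE \<omega> in M. \<forall>t\<in>{0..T}. complex_of_real (pairing (u t \<omega>) (wave 1 0 k) - pairing u0 (wave 1 0 k)) =
       complex_of_real (c * (LINT s:{0..t}|lborel. pairing (u s \<omega>) (laplacian (wave 1 0 k)))) - S t \<omega>"
    using ex[OF torus_smooth_wave[OF k, of 1 0]] by blast
  obtain S' where S': "has_noise_integral M F T \<theta> W
      (\<lambda>j l s \<omega>. pairing (u s \<omega>) (\<lambda>x. fourier_mode l x * complex_of_real (a j l \<bullet> grad (wave 0 1 k) x))) S'"
    "AE \<omega> in M. \<forall>t\<in>{0..T}. complex_of_real (pairing (u t \<omega>) (wave 0 1 k) - pairing u0 (wave 0 1 k)) =
       complex_of_real (c * (LINT s:{0..t}|lborel. pairing (u s \<omega>) (laplacian (wave 0 1 k)))) - S' t \<omega>"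
    using ex[OF torus_smooth_wave[OF k, of 0 1]] by blast
  have lap: "(LINT s:{0..t}|lborel. pairing (u s \<omega>) (laplacian (wave \<alpha> \<beta> k)))
      = - (k \<bullet> k) * (LINT s:{0..t}|lborel. pairing (u s \<omega>) (wave \<alpha> \<beta> k))" for t \<omega> \<alpha> \<beta>
  proof -
    have "pairing f (laplacian (wave \<alpha> \<beta> k)) = - (k \<bullet> k) * pairing f (wave \<alpha> \<beta> k)" for f :: "'n torus_l2"
    proof -
      have "(\<lambda>x. rep_torus_l2 f x *\<^sub>R laplacian (wave \<alpha> \<beta> k) x) = (\<lambda>x. - (k \<bullet> k) * (rep_torus_l2 f x *\<^sub>R wave \<alpha> \<beta> k x))"
        by (simp add: fun_eq_iff laplacian_wave)
      then show ?thesis unfolding pairing_def by (simp only: integral_mult_right_zero)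
    qed
    then show ?thesis by (simp only: set_integral_mult_right)
  qed
  \<comment> \<open>Bessel's inequality for a single mode and the moment bound of the solution give
    joint square integrability; Fubini then gives integrable paths.\<close>
  have int: "AE \<omega> in M. set_integrable lborel {0..T} (\<lambda>s. pairing (u s \<omega>) ?e)"
  proof (cases "0 \<le> T")
    case True
    then have T: "T \<in> {0..T}" by simp
    define R where "R = restrict_space lborel {0..T}"
    interpret R: finite_measure R unfolding R_def by (rule finite_measure_time)
    interpret RM: pair_sigma_finite R M ..
    interpret TS: finite_measure "time_space T" by (rule finite_measure_time_space)
    have ts: "time_space T = R \<Otimes>\<^sub>M M" by (simp add: time_space_def R_def)
    have pm: "(\<lambda>f :: 'n torus_l2. pairing f ?e) \<in> borel_measurable borel"
      by (rule borel_measurable_pairing[where K = 1]) auto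
    have m: "(\<lambda>(s, \<omega>). pairing (u s \<omega>) ?e) \<in> borel_measurable (time_space T)"
      by (rule progressively_measurable_time_space[OF progressively_measurable_compose[OF prog pm] T])
    have "csquare_integrable (time_space T) (\<lambda>(s, \<omega>). pairing (u s \<omega>) ?e)"
      unfolding csquare_integrable_iff
    proof
      have "(\<integral>\<^sup>+x. ennreal ((norm (case x of (s, \<omega>) \<Rightarrow> pairing (u s \<omega>) ?e))\<^sup>2) \<partial>time_space T)
        = (\<integral>\<^sup>+s\<in>{0..T}. (\<integral>\<^sup>+\<omega>. ennreal ((norm (pairing (u s \<omega>) ?e))\<^sup>2) \<partial>M) \<partial>lborel)"
        using m by (subst nn_integral_time_space) auto
      also have "\<dots> \<le> (\<integral>\<^sup>+s\<in>{0..T}. (\<integral>\<^sup>+\<omega>. ennreal ((norm (u s \<omega>))\<^sup>2) \<partial>M) \<partial>lborel)"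
        by (intro nn_integral_mono mult_right_mono ennreal_leI norm_pairing_fourier_mode_le k) auto
      finally show "(\<integral>\<^sup>+x. ennreal ((norm (case x of (s, \<omega>) \<Rightarrow> pairing (u s \<omega>) ?e))\<^sup>2) \<partial>time_space T) < \<infinity>"
        using u2 by (rule order_le_less_trans)
    qed (rule m)
    then have "integrable (R \<Otimes>\<^sub>M M) (case_prod (\<lambda>s \<omega>. pairing (u s \<omega>) ?e))"
      using TS.csquare_integrable_imp_integrable by (simp add: ts)
    from RM.AE_integrable_snd[OF this] show ?thesis
      by (simp add: R_def integrable_restrict_space set_integrable_def)
  next
    case False
    then show ?thesis by (simp add: set_integrable_def)
  qed
  have "AE \<omega> in M. (\<forall>t\<in>{0..T}. set_integrable lborel {0..t} (\<lambda>s. pairing (u s \<omega>) ?e) \<and>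
      pairing (u t \<omega>) ?e = pairing u0 ?e
        - complex_of_real (c * (k \<bullet> k)) * (LINT s:{0..t}|lborel. pairing (u s \<omega>) ?e)
        - (S t \<omega> - \<i> * S' t \<omega>))"
    using S(2) S'(2) int
  proof eventually_elim
    case (elim \<omega>)
    show ?case
    proof
      fix t assume t: "t \<in> {0..T}"
      have i: "set_integrable lborel {0..t} (\<lambda>s. pairing (u s \<omega>) ?e)"
        by (rule set_integrable_subset[OF elim(3)]) (use t in auto)
      define P Q where "P s = pairing (u s \<omega>) (wave 1 0 k)" and "Q s = pairing (u s \<omega>) (wave 0 1 k)" for s
      have e: "pairing (u s \<omega>) ?e = complex_of_real (P s) - \<i> * complex_of_real (Q s)" for s
        unfolding P_def Q_def by (rule pairing_fourier_mode_wave)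
      have PQ: "P s = Re (pairing (u s \<omega>) ?e)" "Q s = - Im (pairing (u s \<omega>) ?e)" for s
        unfolding e by simp_all
      have ii: "integrable lborel (\<lambda>s. indicator {0..t} s *\<^sub>R pairing (u s \<omega>) ?e)"
        using i by (simp add: set_integrable_def)
      have "(LINT s:{0..t}|lborel. P s) = Re (LINT s:{0..t}|lborel. pairing (u s \<omega>) ?e)"
        unfolding set_lebesgue_integral_def PQ integral_Re[OF ii, symmetric] by simp
      moreover have "(LINT s:{0..t}|lborel. Q s) = - Im (LINT s:{0..t}|lborel. pairing (u s \<omega>) ?e)"
        unfolding set_lebesgue_integral_def PQ integral_Im[OF ii, symmetric] by simp
      ultimately have L: "(LINT s:{0..t}|lborel. pairing (u s \<omega>) ?e)
          = complex_of_real (LINT s:{0..t}|lborel. P s) - \<i> * complex_of_real (LINT s:{0..t}|lborel. Q s)"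
        by (simp add: complex_eq_iff)
      have "complex_of_real (P t) = complex_of_real (pairing u0 (wave 1 0 k))
          - complex_of_real (c * (k \<bullet> k)) * complex_of_real (LINT s:{0..t}|lborel. P s) - S t \<omega>"
        using bspec[OF elim(1) t] unfolding lap P_def by (simp add: algebra_simps)
      moreover have "complex_of_real (Q t) = complex_of_real (pairing u0 (wave 0 1 k))
          - complex_of_real (c * (k \<bullet> k)) * complex_of_real (LINT s:{0..t}|lborel. Q s) - S' t \<omega>"
        using bspec[OF elim(2) t] unfolding lap Q_def by (simp add: algebra_simps)
      ultimately have "pairing (u t \<omega>) ?e = pairing u0 ?e
        - complex_of_real (c * (k \<bullet> k)) * (LINT s:{0..t}|lborel. pairing (u s \<omega>) ?e)
        - (S t \<omega> - \<i> * S' t \<omega>)"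
        unfolding e[of t] L pairing_fourier_mode_wave[of u0] by (simp only:) (simp add: algebra_simps)
      with i show "set_integrable lborel {0..t} (\<lambda>s. pairing (u s \<omega>) ?e) \<and>
        pairing (u t \<omega>) ?e = pairing u0 ?e
          - complex_of_real (c * (k \<bullet> k)) * (LINT s:{0..t}|lborel. pairing (u s \<omega>) ?e)
          - (S t \<omega> - \<i> * S' t \<omega>)" by blast
    qed
  qed
  with S(1) S'(1) show ?thesis by blast
qed

end

section \<open>Uniqueness\<close>

text \<open>The initial values cancel in the difference \<open>X\<close>, so its modes satisfy a
  homogeneous integral equation. The conclusion holds at every \<open>t\<close>, not only at almost
  every one, because the balance expresses the second moment at \<open>t\<close> through time
  integrals.\<close>

lemma (in filtered_prob_space) unique_fourier_modes:
  fixes \<theta> :: "real ^ 'n::finite \<Rightarrow> real" and \<Lambda> :: "(real ^ 'n) set"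
    and u v :: "real \<Rightarrow> 'w \<Rightarrow> 'n torus_l2"
  assumes T: "T > 0"
    and B: "\<And>i. i \<in> noise_index \<Longrightarrow> brownian_motion M F (B i)"
    and ind: "independent_processes M B noise_index"
    and \<Lambda>: "\<Lambda> \<inter> uminus ` \<Lambda> = {}" "\<Lambda> \<union> uminus ` \<Lambda> = int_lattice0"
    and on: "\<And>k j m. k \<in> \<Lambda> \<Longrightarrow> j \<in> {1..CARD('n) - 1} \<Longrightarrow> m \<in> {1..CARD('n) - 1} \<Longrightarrow>
           a j k \<bullet> a m k = (if j = m then 1 else 0)"
    and sp: "\<And>k. k \<in> \<Lambda> \<Longrightarrow> span ((\<lambda>j. a j k) ` {1..CARD('n) - 1}) = {k}\<^sup>\<bottom>"
    and am: "\<And>k j. k \<in> \<Lambda> \<Longrightarrow> j \<in> {1..CARD('n) - 1} \<Longrightarrow> a j (- k) = a j k"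
    and sm: "(\<lambda>k. (\<theta> k)\<^sup>2) summable_on int_lattice0"
    and inv: "\<And>k R. k \<in> int_lattice0 \<Longrightarrow> lattice_isometry R \<Longrightarrow> \<theta> (R k) = \<theta> k"
    and c: "c = (real CARD('n) - 1) / real CARD('n) * (\<Sum>\<^sub>\<infinity>k\<in>int_lattice0. (\<theta> k)\<^sup>2)"
    and u: "weak_solution M F T \<theta> a (complex_noise \<Lambda> B) c u0 u"
    and v: "weak_solution M F T \<theta> a (complex_noise \<Lambda> B) c u0 v"
    and k: "k \<in> int_lattice" and t: "t \<in> {0..T}"
  shows "AE \<omega> in M. pairing (u t \<omega>) (fourier_mode (- k)) = pairing (v t \<omega>) (fourier_mode (- k))"
proof -
  let ?W = "complex_noise \<Lambda> B"
  note mart = complex_noise_properties(1)[OF B ind \<Lambda>]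
  note cov = complex_noise_properties(2)[OF B ind \<Lambda>]
  define X where "X k s \<omega> = pairing (u s \<omega>) (fourier_mode (- k)) - pairing (v s \<omega>) (fourier_mode (- k))" for k s \<omega>
  have pu: "progressively_measurable F T u" and pv: "progressively_measurable F T v"
    and u2: "(\<integral>\<^sup>+t\<in>{0..T}. (\<integral>\<^sup>+\<omega>. ennreal ((norm (u t \<omega>))\<^sup>2) \<partial>M) \<partial>lborel) < \<infinity>"
    and v2: "(\<integral>\<^sup>+t\<in>{0..T}. (\<integral>\<^sup>+\<omega>. ennreal ((norm (v t \<omega>))\<^sup>2) \<partial>M) \<partial>lborel) < \<infinity>"
    using u v by (auto simp: weak_solution_def)
  have Xp: "progressively_measurable F T (X k)" for k
    unfolding X_def
    by (intro progressively_measurable_diff progressively_measurable_compose[OF pu]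
        progressively_measurable_compose[OF pv] borel_measurable_pairing[where K = 1]) auto
  define R where "R = restrict_space lborel {0..T}"
  interpret R: finite_measure R unfolding R_def by (rule finite_measure_time)
  interpret RM: pair_sigma_finite R M ..
  have TT: "T \<in> {0..T}" using T by simp
  have spR: "space R = {0..T}" by (simp add: R_def space_restrict_space)
  have nnR: "(\<integral>\<^sup>+s. f s \<partial>R) = (\<integral>\<^sup>+s\<in>{0..T}. f s \<partial>lborel)" for f
    unfolding R_def by (rule nn_integral_restrict_space) simp
  have Xm: "(\<lambda>(s, \<omega>). X k s \<omega>) \<in> borel_measurable (R \<Otimes>\<^sub>M M)" for k
    using progressively_measurable_time_space[OF Xp TT] by (simp add: time_space_def R_def)
  have Xn: "(\<lambda>(s, \<omega>). ennreal ((norm (X k s \<omega>))\<^sup>2)) \<in> borel_measurable (R \<Otimes>\<^sub>M M)" for k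
    using Xm[of k] by (simp add: split_beta')
  \<comment> \<open>\<open>\<eta>\<close>, \<open>\<zeta>\<close> and \<open>Z\<close> are the
    second moment of a mode, its running time integral and the integral of that over the whole time
    interval.\<close>
  define \<eta> where "\<eta> k s = (\<integral>\<^sup>+\<omega>. ennreal ((norm (X k s \<omega>))\<^sup>2) \<partial>M)" for k s
  define \<zeta> where "\<zeta> k t = (\<integral>\<^sup>+s\<in>{0..t}. \<eta> k s \<partial>lborel)" for k t
  define Z where "Z k = (\<integral>\<^sup>+s. \<zeta> k s \<partial>R)" for k
  have \<eta>m: "\<eta> k \<in> borel_measurable R" for k
    unfolding \<eta>_def using borel_measurable_nn_integral[OF Xn] by simp
  have \<zeta>_mono: "\<zeta> k s \<le> \<zeta> k t" if "0 \<le> s" "s \<le> t" for k s t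
    unfolding \<zeta>_def by (rule nn_integral_time_space_le[OF that])
  have \<zeta>T: "\<zeta> k T = (\<integral>\<^sup>+s. \<eta> k s \<partial>R)" for k unfolding \<zeta>_def nnR ..
  have \<zeta>R: "\<zeta> k t = (\<integral>\<^sup>+s. (if s \<le> t then \<eta> k s else 0) \<partial>R)" if "t \<in> {0..T}" for k t
    unfolding \<zeta>_def nnR using that
    by (intro nn_integral_cong) (auto simp: indicator_def)
  have \<zeta>m: "\<zeta> k \<in> borel_measurable R" for k
  proof -
    have [measurable]: "(\<lambda>x. x) \<in> borel_measurable R"
      unfolding R_def by (auto intro!: measurable_restrict_space1)
    have [measurable]: "\<eta> k \<in> borel_measurable R" by (rule \<eta>m)
    have "(\<lambda>(t, s). if s \<le> t then \<eta> k s else 0) \<in> borel_measurable (R \<Otimes>\<^sub>M R)" by measurable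
    from R.borel_measurable_nn_integral[OF this]
    show ?thesis by (subst measurable_cong[where g = "\<lambda>t. \<integral>\<^sup>+s. (if s \<le> t then \<eta> k s else 0) \<partial>R"]) (simp_all add: spR \<zeta>R)
  qed
  \<comment> \<open>A bound for the sum of all \<open>\<zeta> k T\<close>: the squared modulus of a
    difference is at most twice the sum of the two squared moduli, and Bessel's inequality bounds
    the sums over modes.\<close>
  define E where "E = 2 * (\<integral>\<^sup>+s. (\<integral>\<^sup>+\<omega>. ennreal ((norm (u s \<omega>))\<^sup>2) \<partial>M) \<partial>R)
    + 2 * (\<integral>\<^sup>+s. (\<integral>\<^sup>+\<omega>. ennreal ((norm (v s \<omega>))\<^sup>2) \<partial>M) \<partial>R)"
  have Efin: "E < \<infinity>" using u2 v2 by (simp add: E_def nnR ennreal_mult_less_top)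
  have sum\<zeta>: "(\<Sum>k\<in>A. \<zeta> k T) \<le> E" if A: "finite A" "A \<subseteq> int_lattice" for A
  proof -
    have nm: "(\<lambda>x :: 'n torus_l2. ennreal ((norm x)\<^sup>2)) \<in> borel_measurable borel" by measurable
    have um: "(\<lambda>(s, \<omega>). ennreal ((norm (u s \<omega>))\<^sup>2)) \<in> borel_measurable (R \<Otimes>\<^sub>M M)"
      and vm: "(\<lambda>(s, \<omega>). ennreal ((norm (v s \<omega>))\<^sup>2)) \<in> borel_measurable (R \<Otimes>\<^sub>M M)"
      using measurable_compose[OF progressively_measurable_time_space[OF pu TT] nm]
        measurable_compose[OF progressively_measurable_time_space[OF pv TT] nm]
      by (simp_all add: time_space_def R_def split_beta')
    have le: "(\<Sum>k\<in>A. ennreal ((norm (X k s \<omega>))\<^sup>2))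
        \<le> 2 * ennreal ((norm (u s \<omega>))\<^sup>2) + 2 * ennreal ((norm (v s \<omega>))\<^sup>2)" for s \<omega>
    proof -
      have "(\<Sum>k\<in>A. (norm (X k s \<omega>))\<^sup>2)
          \<le> (\<Sum>k\<in>A. 2 * (norm (pairing (u s \<omega>) (fourier_mode (- k))))\<^sup>2 + 2 * (norm (pairing (v s \<omega>) (fourier_mode (- k))))\<^sup>2)"
        unfolding X_def
        by (intro sum_mono) (use norm_add_square_le[of _ "- _"] in simp)
      also have "\<dots> \<le> 2 * (norm (u s \<omega>))\<^sup>2 + 2 * (norm (v s \<omega>))\<^sup>2"
        unfolding sum.distrib sum_distrib_left[symmetric]
        by (intro add_mono mult_left_mono bessel_inequality A) auto
      finally have "ennreal (\<Sum>k\<in>A. (norm (X k s \<omega>))\<^sup>2) \<le> ennreal (2 * (norm (u s \<omega>))\<^sup>2 + 2 * (norm (v s \<omega>))\<^sup>2)"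
        by (rule ennreal_leI)
      then show ?thesis by (simp add: ennreal_mult sum_ennreal)
    qed
    have "(\<Sum>k\<in>A. \<zeta> k T) = (\<integral>\<^sup>+x. (\<Sum>k\<in>A. case x of (s, \<omega>) \<Rightarrow> ennreal ((norm (X k s \<omega>))\<^sup>2)) \<partial>(R \<Otimes>\<^sub>M M))"
      unfolding \<zeta>T \<eta>_def using nn_integral_fst[OF Xn] by (subst nn_integral_sum[OF Xn]) simp
    also have "\<dots> \<le> (\<integral>\<^sup>+x. 2 * (case x of (s, \<omega>) \<Rightarrow> ennreal ((norm (u s \<omega>))\<^sup>2)) + 2 * (case x of (s, \<omega>) \<Rightarrow> ennreal ((norm (v s \<omega>))\<^sup>2)) \<partial>(R \<Otimes>\<^sub>M M))"
      by (intro nn_integral_mono) (simp only: split_beta' le)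
    also have "\<dots> = E"
      unfolding E_def using um vm nn_integral_fst[OF um] nn_integral_fst[OF vm]
      by (simp add: nn_integral_add nn_integral_cmult)
    finally show ?thesis .
  qed
  have \<zeta>fin: "\<zeta> k s < \<infinity>" if "k \<in> int_lattice" "s \<in> {0..T}" for k s
  proof -
    have "\<zeta> k s \<le> \<zeta> k T" using that(2) by (intro \<zeta>_mono) auto
    also have "\<dots> \<le> E" using sum\<zeta>[of "{k}"] that(1) by simp
    finally show ?thesis using Efin by (rule order_le_less_trans)
  qed
  \<comment> \<open>The factor 2 is the covariation rate of a complex component; the others are the
    squares of its weight and of the factor produced by differentiating mode
    \<open>k\<close>.\<close>
  define w where "w k i = 2 * (\<theta> (snd i))\<^sup>2 * (a (fst i) (snd i) \<bullet> k)\<^sup>2" for k i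
  define q where "q k = 2 * (c * (k \<bullet> k))" for k :: "real ^ 'n"
  have c0: "0 \<le> c" unfolding c by (intro mult_nonneg_nonneg divide_nonneg_nonneg infsum_nonneg) auto
  have q0: "0 \<le> q k" for k using c0 by (simp add: q_def)
  have w0: "0 \<le> w k i" for k i by (simp add: w_def)
  \<comment> \<open>The choice of \<open>c\<close> enters here: the total rate of transfer equals
    the damping rate \<open>q k\<close>, by isotropy.\<close>
  have wq: "(\<integral>\<^sup>+i. ennreal (w k i) \<partial>count_space noise_index) = ennreal (q k)" for k
  proof (rule nn_integral_count_space_has_sum[OF _ w0])
    have "((\<lambda>i. 2 * ((\<theta> (snd i))\<^sup>2 * (a (fst i) (snd i) \<bullet> k)\<^sup>2)) has_sum (2 * (c * (k \<bullet> k)))) noise_index"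
    proof (rule has_sum_cmult_right)
      have "((\<lambda>(j, l). (\<theta> l)\<^sup>2 * (a j l \<bullet> k)\<^sup>2) has_sum
        (real CARD('n) - 1) / real CARD('n) * (\<Sum>\<^sub>\<infinity>k\<in>int_lattice0. (\<theta> k)\<^sup>2) * (k \<bullet> k)) noise_index"
        by (rule has_sum_noise_index[OF \<Lambda>(2) on sp am sm]) (simp_all add: inv)
      then show "((\<lambda>i. (\<theta> (snd i))\<^sup>2 * (a (fst i) (snd i) \<bullet> k)\<^sup>2) has_sum c * (k \<bullet> k)) noise_index"
        by (simp add: c split_beta')
    qed
    then show "(w k has_sum q k) noise_index" by (simp add: w_def[abs_def] q_def mult.assoc)
  qed
  \<comment> \<open>The energy identity for mode \<open>k\<close> with its martingale term evaluated
    by the isometry. The damping stays on the left, so every term is nonnegative.\<close>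
  have balance: "\<eta> k s + ennreal (q k) * \<zeta> k s = (\<integral>\<^sup>+i. ennreal (w k i) * \<zeta> (k - snd i) s \<partial>count_space noise_index)"
    if k: "k \<in> int_lattice" and s: "s \<in> {0..T}" for k s
  proof -
    obtain S1 S2 where Su: "has_noise_integral M F T \<theta> ?W
        (\<lambda>j l s \<omega>. pairing (u s \<omega>) (\<lambda>x. fourier_mode l x * complex_of_real (a j l \<bullet> grad (wave 1 0 k) x))) S1"
      "has_noise_integral M F T \<theta> ?W
        (\<lambda>j l s \<omega>. pairing (u s \<omega>) (\<lambda>x. fourier_mode l x * complex_of_real (a j l \<bullet> grad (wave 0 1 k) x))) S2"
      "AE \<omega> in M. (\<forall>t\<in>{0..T}. set_integrable lborel {0..t} (\<lambda>s. pairing (u s \<omega>) (fourier_mode (- k))) \<and>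
        pairing (u t \<omega>) (fourier_mode (- k)) = pairing u0 (fourier_mode (- k))
          - complex_of_real (c * (k \<bullet> k)) * (LINT s:{0..t}|lborel. pairing (u s \<omega>) (fourier_mode (- k)))
          - (S1 t \<omega> - \<i> * S2 t \<omega>))"
      using weak_solution_fourier_mode[OF u k] by blast
    obtain S3 S4 where Sv: "has_noise_integral M F T \<theta> ?W
        (\<lambda>j l s \<omega>. pairing (v s \<omega>) (\<lambda>x. fourier_mode l x * complex_of_real (a j l \<bullet> grad (wave 1 0 k) x))) S3"
      "has_noise_integral M F T \<theta> ?W
        (\<lambda>j l s \<omega>. pairing (v s \<omega>) (\<lambda>x. fourier_mode l x * complex_of_real (a j l \<bullet> grad (wave 0 1 k) x))) S4"
      "AE \<omega> in M. (\<forall>t\<in>{0..T}. set_integrable lborel {0..t} (\<lambda>s. pairing (v s \<omega>) (fourier_mode (- k))) \<and>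
        pairing (v t \<omega>) (fourier_mode (- k)) = pairing u0 (fourier_mode (- k))
          - complex_of_real (c * (k \<bullet> k)) * (LINT s:{0..t}|lborel. pairing (v s \<omega>) (fourier_mode (- k)))
          - (S3 t \<omega> - \<i> * S4 t \<omega>))"
      using weak_solution_fourier_mode[OF v k] by blast
    \<comment> \<open>Cosine and sine for \<open>u\<close>, then cosine and sine for
      \<open>v\<close>: four noise integrals, which the coefficients 1, -\<i>, -1, \<i> assemble
      into the one driving \<open>X k\<close>.\<close>
    define A where "A = {0, 1, 2, 3 :: nat}"
    define \<gamma> :: "nat \<Rightarrow> complex" where "\<gamma> \<alpha> = (if \<alpha> = 0 then 1 else if \<alpha> = 1 then - \<i> else if \<alpha> = 2 then - 1 else \<i>)" for \<alpha>
    define S where "S \<alpha> = (if \<alpha> = 0 then S1 else if \<alpha> = 1 then S2 else if \<alpha> = 2 then S3 else S4)" for \<alpha> :: nat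
    define H where "H \<alpha> = (\<lambda>j l s \<omega>. pairing (if \<alpha> < 2 then u s \<omega> else v s \<omega>) (\<lambda>x. fourier_mode l x *
        complex_of_real (a j l \<bullet> grad (if even \<alpha> then wave 1 0 k else wave 0 1 k) x)))" for \<alpha> :: nat
    have hS: "has_noise_integral M F T \<theta> ?W (H \<alpha>) (S \<alpha>)" if "\<alpha> \<in> A" for \<alpha>
      using that Su(1,2) Sv(1,2) by (auto simp: A_def H_def S_def)
    define Sk where "Sk t \<omega> = (\<Sum>\<alpha>\<in>A. \<gamma> \<alpha> * S \<alpha> t \<omega>)" for t \<omega>
    have Sk: "Sk t \<omega> = (S1 t \<omega> - \<i> * S2 t \<omega>) - (S3 t \<omega> - \<i> * S4 t \<omega>)" for t \<omega>
      by (simp add: Sk_def A_def \<gamma>_def S_def)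
    have Hk: "(\<Sum>\<alpha>\<in>A. \<gamma> \<alpha> * H \<alpha> j l s \<omega>) = - \<i> * complex_of_real (a j l \<bullet> k) * X (k - l) s \<omega>" for j l s \<omega>
    proof -
      have "(\<Sum>\<alpha>\<in>A. \<gamma> \<alpha> * H \<alpha> j l s \<omega>) =
         (pairing (u s \<omega>) (\<lambda>x. fourier_mode l x * complex_of_real (a j l \<bullet> grad (wave 1 0 k) x))
           - \<i> * pairing (u s \<omega>) (\<lambda>x. fourier_mode l x * complex_of_real (a j l \<bullet> grad (wave 0 1 k) x)))
         - (pairing (v s \<omega>) (\<lambda>x. fourier_mode l x * complex_of_real (a j l \<bullet> grad (wave 1 0 k) x))
           - \<i> * pairing (v s \<omega>) (\<lambda>x. fourier_mode l x * complex_of_real (a j l \<bullet> grad (wave 0 1 k) x)))"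
        by (simp add: A_def \<gamma>_def H_def)
      then show ?thesis unfolding pairing_gradient_modes X_def right_diff_distrib .
    qed
    have X2: "(\<integral>\<^sup>+s\<in>{0..T}. (\<integral>\<^sup>+\<omega>. ennreal ((norm (X k s \<omega>))\<^sup>2) \<partial>M) \<partial>lborel) < \<infinity>"
      using \<zeta>fin[OF k TT] by (simp add: \<zeta>_def \<eta>_def)
    have Xeq: "AE \<omega> in M. \<forall>t\<in>{0..T}. X k t \<omega> = - complex_of_real (c * (k \<bullet> k)) * (LINT s:{0..t}|lborel. X k s \<omega>) - Sk t \<omega>"
      using Su(3) Sv(3)
    proof eventually_elim
      case (elim \<omega>)
      show ?case
      proof
        fix t assume t: "t \<in> {0..T}"
        note e = bspec[OF elim(1) t] bspec[OF elim(2) t]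
        have L: "(LINT s:{0..t}|lborel. X k s \<omega>)
            = (LINT s:{0..t}|lborel. pairing (u s \<omega>) (fourier_mode (- k))) - (LINT s:{0..t}|lborel. pairing (v s \<omega>) (fourier_mode (- k)))"
          unfolding X_def by (rule set_integral_diff(2)) (use e in auto)
        show "X k t \<omega> = - complex_of_real (c * (k \<bullet> k)) * (LINT s:{0..t}|lborel. X k s \<omega>) - Sk t \<omega>"
          unfolding L unfolding X_def[of k t] Sk e(1)[THEN conjunct2] e(2)[THEN conjunct2] by (simp add: algebra_simps)
      qed
    qed
    have Sk2: "csquare_integrable M (Sk t)" if "t \<in> {0..T}" for t
      unfolding Sk_def
      by (intro csquare_integrable_sum csquare_integrable_scale csquare_integrable_noise[OF mart cov hS that])
    have orth: "l2_inner M (Sk t) Z = l2_inner M (Sk s) Z"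
      if "0 \<le> s" "s \<le> t" "t \<le> T" "Z \<in> borel_measurable (F s)" "csquare_integrable M Z" for s t Z
      unfolding Sk_def by (rule noise_martingale_combination[OF mart cov hS that])
    have en1: "csquare_integrable M (X k s)"
      by (rule energy_identity(1)[OF Xp X2 _ Xeq _ s]) (erule Sk2, rule orth)
    have en2: "(\<integral>\<omega>. (norm (X k s \<omega>))\<^sup>2 \<partial>M) + 2 * (c * (k \<bullet> k)) * (\<integral>(s', \<omega>). (norm (X k s' \<omega>))\<^sup>2 \<partial>time_space s)
        = (\<integral>\<omega>. (norm (Sk s \<omega>))\<^sup>2 \<partial>M)"
      by (rule energy_identity(2)[OF Xp X2 _ Xeq _ s]) (erule Sk2, rule orth)
    define z where "z k = (\<integral>(s', \<omega>). (norm (X k s' \<omega>))\<^sup>2 \<partial>time_space s)" for k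
    have z: "\<zeta> l s = ennreal (z l)" "0 \<le> z l" if l: "l \<in> int_lattice" for l
    proof -
      have m: "(\<lambda>(s', \<omega>). X l s' \<omega>) \<in> borel_measurable (time_space s)"
        by (rule progressively_measurable_time_space[OF Xp s])
      have m2: "(\<lambda>(s', \<omega>). ennreal ((norm (X l s' \<omega>))\<^sup>2)) \<in> borel_measurable (time_space s)"
        using m by (simp add: split_beta')
      have e: "\<zeta> l s = (\<integral>\<^sup>+x. ennreal (case x of (s', \<omega>) \<Rightarrow> (norm (X l s' \<omega>))\<^sup>2) \<partial>time_space s)"
        unfolding \<zeta>_def \<eta>_def using nn_integral_time_space[OF m2] by (simp add: split_beta')
      have "integrable (time_space s) (\<lambda>(s', \<omega>). (norm (X l s' \<omega>))\<^sup>2)"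
        unfolding integrable_iff_bounded using m \<zeta>fin[OF l s] by (simp add: e split_beta')
      then show "\<zeta> l s = ennreal (z l)" unfolding e z_def
        by (rule nn_integral_eq_integral) (auto simp: split_beta')
      show "0 \<le> z l" by (simp add: z_def split_beta')
    qed
    define y where "y = (\<integral>\<omega>. (norm (X k s \<omega>))\<^sup>2 \<partial>M)"
    have y: "\<eta> k s = ennreal y" unfolding \<eta>_def y_def
      by (rule nn_integral_eq_integral[OF csquare_integrableD(2)[OF en1]]) simp
    have y0: "0 \<le> y" by (simp add: y_def)
    have "((\<lambda>i. 2 * (\<theta> (snd i))\<^sup>2 * (\<integral>(s', \<omega>). (norm (\<Sum>\<alpha>\<in>A. \<gamma> \<alpha> * H \<alpha> (fst i) (snd i) s' \<omega>))\<^sup>2 \<partial>time_space s))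
      has_sum (\<integral>\<omega>. (norm (Sk s \<omega>))\<^sup>2 \<partial>M)) noise_index"
      unfolding Sk_def by (rule noise_isometry_combination[OF mart cov _ hS s]) (simp_all add: A_def)
    moreover have "2 * (\<theta> (snd i))\<^sup>2 * (\<integral>(s', \<omega>). (norm (\<Sum>\<alpha>\<in>A. \<gamma> \<alpha> * H \<alpha> (fst i) (snd i) s' \<omega>))\<^sup>2 \<partial>time_space s)
        = w k i * z (k - snd i)" for i
    proof -
      have "(\<lambda>(s', \<omega>). (norm (\<Sum>\<alpha>\<in>A. \<gamma> \<alpha> * H \<alpha> (fst i) (snd i) s' \<omega>))\<^sup>2)
          = (\<lambda>x. (a (fst i) (snd i) \<bullet> k)\<^sup>2 * (case x of (s', \<omega>) \<Rightarrow> (norm (X (k - snd i) s' \<omega>))\<^sup>2))"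
        unfolding Hk by (auto simp: fun_eq_iff norm_mult power_mult_distrib)
      then show ?thesis by (simp add: w_def z_def)
    qed
    \<comment> \<open>The unimodular factor of the integrand disappears in the modulus, so only
      second moments of shifted modes remain: this is what closes the system.\<close>
    ultimately have hs: "((\<lambda>i. w k i * z (k - snd i)) has_sum (\<integral>\<omega>. (norm (Sk s \<omega>))\<^sup>2 \<partial>M)) noise_index"
      by (simp only:)
    have lat: "k - snd i \<in> int_lattice" if "i \<in> noise_index" for i
      using that k by (auto simp: noise_index_def int_lattice0_def intro: int_lattice_diff)
    have "(\<integral>\<^sup>+i. ennreal (w k i) * \<zeta> (k - snd i) s \<partial>count_space noise_index)
        = (\<integral>\<^sup>+i. ennreal (w k i * z (k - snd i)) \<partial>count_space noise_index)"
      by (intro nn_integral_cong) (simp add: z[OF lat] ennreal_mult w0)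
    also have "\<dots> = ennreal (\<integral>\<omega>. (norm (Sk s \<omega>))\<^sup>2 \<partial>M)"
      by (rule nn_integral_count_space_has_sum[OF hs]) (simp add: w0 z(2)[OF lat])
    also have "(\<integral>\<omega>. (norm (Sk s \<omega>))\<^sup>2 \<partial>M) = y + q k * z k"
      using en2 by (simp add: y_def z_def q_def)
    also have "ennreal (y + q k * z k) = \<eta> k s + ennreal (q k) * \<zeta> k s"
      unfolding y z(1)[OF k] using y0 z(2)[OF k] q0[of k] by (simp add: ennreal_mult)
    finally show ?thesis by simp
  qed
  \<comment> \<open>The maximum principle is applied to the balance integrated once more over time.
    The summability bound for \<open>Z\<close> is \<open>E\<close> times the length of the time
    interval.\<close>
  have \<zeta>0: "\<zeta> k T = 0" if k: "k \<in> int_lattice" for k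
  proof (rule maximum_principle[where L = int_lattice and N = noise_index and Z = Z and Q = "\<lambda>k. ennreal (q k)"
        and w = "\<lambda>k i. ennreal (w k i)" and \<kappa> = "\<lambda>k i. k - snd i" and C = "E * emeasure R (space R)"])
    show "\<zeta> k T + ennreal (q k) * Z k = (\<integral>\<^sup>+i. ennreal (w k i) * Z (k - snd i) \<partial>count_space noise_index)"
      if k: "k \<in> int_lattice" for k
    proof -
      have "\<zeta> k T + ennreal (q k) * Z k = (\<integral>\<^sup>+s. \<eta> k s + ennreal (q k) * \<zeta> k s \<partial>R)"
        unfolding \<zeta>T Z_def using \<eta>m[of k] \<zeta>m[of k] by (simp add: nn_integral_add nn_integral_cmult)
      also have "\<dots> = (\<integral>\<^sup>+s. (\<integral>\<^sup>+i. ennreal (w k i) * \<zeta> (k - snd i) s \<partial>count_space noise_index) \<partial>R)"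
        by (intro nn_integral_cong balance k) (simp add: spR)
      also have "\<dots> = (\<integral>\<^sup>+i. (\<integral>\<^sup>+s. ennreal (w k i) * \<zeta> (k - snd i) s \<partial>R) \<partial>count_space noise_index)"
        by (rule nn_integral_count_space_nn_integral[OF countable_noise_index])
          (intro borel_measurable_times_ennreal measurable_const \<zeta>m; simp)
      also have "\<dots> = (\<integral>\<^sup>+i. ennreal (w k i) * Z (k - snd i) \<partial>count_space noise_index)"
        unfolding Z_def using \<zeta>m by (simp add: nn_integral_cmult)
      finally show ?thesis .
    qed
    show "k - snd i \<in> int_lattice" if "k \<in> int_lattice" "i \<in> noise_index" for k and i :: "nat \<times> (real ^ 'n)"
      using that by (auto simp: noise_index_def int_lattice0_def intro: int_lattice_diff)
    \<comment> \<open>\<open>\<zeta> k\<close> is nonnegative and nondecreasing in time, so its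
      vanishing at \<open>T\<close> makes it vanish throughout; this is the gain from the second
      time integration.\<close>
    show "Z k = 0" if "\<zeta> k T = 0" for k
    proof -
      have "Z k = (\<integral>\<^sup>+s. 0 \<partial>R)"
        unfolding Z_def
      proof (rule nn_integral_cong)
        fix s assume "s \<in> space R"
        then have "\<zeta> k s \<le> \<zeta> k T" by (intro \<zeta>_mono) (auto simp: spR)
        then show "\<zeta> k s = 0" using that by simp
      qed
      then show ?thesis by simp
    qed
    show "(\<Sum>k\<in>A. Z k) \<le> E * emeasure R (space R)" if A: "finite A" "A \<subseteq> int_lattice" for A
    proof -
      have "(\<Sum>k\<in>A. Z k) = (\<integral>\<^sup>+s. (\<Sum>k\<in>A. \<zeta> k s) \<partial>R)"
        unfolding Z_def by (rule nn_integral_sum[symmetric]) (rule \<zeta>m)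
      also have "\<dots> \<le> (\<integral>\<^sup>+s. E \<partial>R)"
      proof (rule nn_integral_mono)
        fix s assume "s \<in> space R"
        then have "(\<Sum>k\<in>A. \<zeta> k s) \<le> (\<Sum>k\<in>A. \<zeta> k T)" by (intro sum_mono \<zeta>_mono) (auto simp: spR)
        also have "\<dots> \<le> E" by (rule sum\<zeta>[OF A])
        finally show "(\<Sum>k\<in>A. \<zeta> k s) \<le> E" .
      qed
      finally show ?thesis by simp
    qed
    have "emeasure R (space R) < top" by (simp add: less_top[symmetric])
    then show "E * emeasure R (space R) < \<infinity>"
      using Efin by (simp add: ennreal_mult_less_top)
  qed (simp_all add: wq k)
  \<comment> \<open>Back to the fixed time \<open>t\<close>: with all \<open>\<zeta>\<close> equal
    to 0, the balance before the second integration gives \<open>\<eta> k t = 0\<close>.\<close>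
  have "\<eta> k t + ennreal (q k) * \<zeta> k t = (\<integral>\<^sup>+i. 0 \<partial>(count_space noise_index :: (nat \<times> (real ^ 'n)) measure))"
    unfolding balance[OF k t]
  proof (rule nn_integral_cong)
    fix i assume "i \<in> space (count_space (noise_index :: (nat \<times> (real ^ 'n)) set))"
    then have "k - snd i \<in> int_lattice"
      using k by (auto simp: noise_index_def int_lattice0_def intro: int_lattice_diff)
    moreover have "\<zeta> (k - snd i) t \<le> \<zeta> (k - snd i) T" using t by (intro \<zeta>_mono) auto
    ultimately show "ennreal (w k i) * \<zeta> (k - snd i) t = 0" using \<zeta>0 by simp
  qed
  then have "\<eta> k t = 0" by simp
  moreover have "X k t \<in> borel_measurable M"
    using measurable_filtration[OF _ progressively_measurable_adapted[OF Xp t]] t by simp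
  ultimately have "AE \<omega> in M. ennreal ((norm (X k t \<omega>))\<^sup>2) = 0"
    unfolding \<eta>_def by (subst (asm) nn_integral_0_iff_AE) auto
  then show ?thesis by eventually_elim (simp add: X_def)
qed

theorem theorem4p4:
  fixes M :: "'w measure" and F :: "real \<Rightarrow> 'w measure" and T c :: real
    and \<theta> :: "real ^ 'n \<Rightarrow> real" and \<Lambda> :: "(real ^ 'n) set"
    and a :: "nat \<Rightarrow> real ^ 'n \<Rightarrow> real ^ 'n"
    and B :: "nat \<times> (real ^ 'n) \<Rightarrow> real \<Rightarrow> 'w \<Rightarrow> real"
    and W :: "nat \<Rightarrow> real ^ 'n \<Rightarrow> real \<Rightarrow> 'w \<Rightarrow> complex"
    and u0 :: "('n::finite) torus_l2" and u v :: "real \<Rightarrow> 'w \<Rightarrow> 'n torus_l2"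
  assumes "CARD('n) \<ge> 2" and "T > 0"
    and "prob_space M" and "normal_filtration M F"
    and "\<And>i. i \<in> noise_index \<Longrightarrow> brownian_motion M F (B i)"
    and "independent_processes M B noise_index"
    and "\<Lambda> \<inter> uminus ` \<Lambda> = {}" and "\<Lambda> \<union> uminus ` \<Lambda> = int_lattice0"
    and "\<And>k j m. k \<in> \<Lambda> \<Longrightarrow> j \<in> {1..CARD('n) - 1} \<Longrightarrow> m \<in> {1..CARD('n) - 1} \<Longrightarrow>
           a j k \<bullet> a m k = (if j = m then 1 else 0)"
    and "\<And>k. k \<in> \<Lambda> \<Longrightarrow> span ((\<lambda>j. a j k) ` {1..CARD('n) - 1}) = {k}\<^sup>\<bottom>"
    and "\<And>k j. k \<in> \<Lambda> \<Longrightarrow> j \<in> {1..CARD('n) - 1} \<Longrightarrow> a j (- k) = a j k"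
    and "W = complex_noise \<Lambda> B"
    and "\<And>k. k \<in> int_lattice0 \<Longrightarrow> \<theta> (- k) = \<theta> k"
    and "(\<lambda>k. (\<theta> k)\<^sup>2) summable_on int_lattice0"
    and "\<And>k R. k \<in> int_lattice0 \<Longrightarrow> lattice_isometry R \<Longrightarrow> \<theta> (R k) = \<theta> k"
    and "c = (real CARD('n) - 1) / real CARD('n) * (\<Sum>\<^sub>\<infinity>k\<in>int_lattice0. (\<theta> k)\<^sup>2)"
    and "weak_solution M F T \<theta> a W c u0 u" and "weak_solution M F T \<theta> a W c u0 v"
  shows "\<forall>t\<in>{0..T}. \<P>(\<omega> in M. u t \<omega> = v t \<omega>) = 1"
proof
  fix t assume t: "t \<in> {0..T}"
  interpret filtered_prob_space M F
    using assms(3,4) by (simp add: filtered_prob_space_def filtered_prob_space_axioms_def)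
  let ?e = "\<lambda>k :: real ^ 'n. fourier_mode (- k)"
  have mode: "AE \<omega> in M. pairing (u t \<omega>) (?e k) = pairing (v t \<omega>) (?e k)" if "k \<in> int_lattice" for k
  proof (rule unique_fourier_modes[OF assms(2,5,6,7,8,9,10,11,14) _ assms(16) _ _ that t])
    show "\<theta> (R l) = \<theta> l" if "l \<in> int_lattice0" "lattice_isometry R" for l R
      by (rule assms(15)[OF that])
    show "weak_solution M F T \<theta> a (complex_noise \<Lambda> B) c u0 u" "weak_solution M F T \<theta> a (complex_noise \<Lambda> B) c u0 v"
      using assms(17,18) unfolding assms(12) by blast+
  qed
  \<comment> \<open>Completeness turns the equality in the function space into countably many scalar
    equations. This provides both the measurability of the event and its almost sure
    validity.\<close>
  have eq_iff: "u t \<omega> = v t \<omega> \<longleftrightarrow> (\<forall>k\<in>int_lattice. pairing (u t \<omega>) (?e k) = pairing (v t \<omega>) (?e k))" for \<omega>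
  proof
    assume h: "\<forall>k\<in>int_lattice. pairing (u t \<omega>) (?e k) = pairing (v t \<omega>) (?e k)"
    have "u t \<omega> - v t \<omega> = 0"
    proof (rule fourier_complete)
      fix k :: "real ^ 'n" assume "k \<in> int_lattice"
      then have "pairing (u t \<omega>) (?e (- k)) = pairing (v t \<omega>) (?e (- k))"
        using h int_lattice_uminus by blast
      then show "pairing (u t \<omega> - v t \<omega>) (fourier_mode k) = 0"
        by (subst pairing_diff_left[where K = 1]) auto
    qed
    then show "u t \<omega> = v t \<omega>" by simp
  qed simp
  have "u t \<in> borel_measurable M" "v t \<in> borel_measurable M"
    using assms(17,18) t measurable_filtration[OF _ progressively_measurable_adapted[OF _ t]]
    by (auto simp: weak_solution_def)
  then have m: "(\<lambda>\<omega>. pairing (u t \<omega>) (?e k)) \<in> borel_measurable M" "(\<lambda>\<omega>. pairing (v t \<omega>) (?e k)) \<in> borel_measurable M" for k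
    by (auto intro!: measurable_compose[OF _ borel_measurable_pairing[where K = 1]])
  have "{\<omega> \<in> space M. pairing (u t \<omega>) (?e k) = pairing (v t \<omega>) (?e k)} \<in> sets M" for k
    using m[of k] by measurable
  then have "{\<omega> \<in> space M. \<forall>k\<in>int_lattice. pairing (u t \<omega>) (?e k) = pairing (v t \<omega>) (?e k)} \<in> sets M"
    by (intro sets.sets_Collect_countable_All'[OF _ countable_int_lattice])
  moreover have "AE \<omega> in M. \<forall>k\<in>int_lattice. pairing (u t \<omega>) (?e k) = pairing (v t \<omega>) (?e k)"
    by (subst AE_ball_countable[OF countable_int_lattice]) (use mode in blast)
  ultimately show "\<P>(\<omega> in M. u t \<omega> = v t \<omega>) = 1"
    unfolding eq_iff by (simp add: prob_Collect_eq_1)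
qed

end
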